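(* Let $\Omega\subset\mathbb R^d$ be a bounded open set with uniformly Lipschitz boundary, $s\in\mathbb N$, and let $\mathcal L:H^s_0(\Omega)\to H^{-s}(\Omega)$ be a symmetric (positive) continuous linear bijection with continuity constants $C_{\mathcal L},C_{\mathcal L^{-1}}$. Let the measurement functions $\phi^{(k)}_i$, their spans $\Phi^{(k)}$, the gamblets $\psi^{(k)}_i$, $\chi^{(k)}_i$, the maps $u\mapsto u^{(k)}$ and the stiffness matrices $A^{(k)},B^{(k)}$ be as in the context. Assume that there exist constants $C_s\ge1$ and $H\in(0,1)$ such that for all $k\in\{1,\dots,q\}$: (i) $\|\phi\|_{L^2(\Omega)}\le C_sH^{-k}\|\phi\|_{H^{-s}(\Omega)}$ for $\phi\in\Phi^{(k)}$; (ii) $\|\phi\|_{H^{-s}(\Omega)}\le C_sH^k\|\phi\|_{L^2(\Omega)}$ for $\phi$ that are $L^2(\Omega)$-orthogonal to $\Phi^{(k)}$. Then there exists a constant $C$ depending only on $C_s$, $C_{\mathcal L}$ and $C_{\mathcal L^{-1}}$ such that for $u\in H^s_0(\Omega)$ and $k\in\{1,\dots,q\}$, $$\|u-u^{(k)}\|_{H^s_0(\Omega)}\le CH^k\|\mathcal Lu\|_{L^2(\Omega)}$$ (the right-hand side being $+\infty$ if $\mathcal Lu\notin L^2(\Omega)$). Furthermore, $C^{-1}I^{(1)}\le A^{(1)}\le CH^{-2}I^{(1)}$, $\operatorname{Cond}(A^{(1)})\le CH^{-2}$, and for $k\in\{2,\dots,q\}$, $C^{-1}H^{-2(k-1)}J^{(k)}\le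 B^{(k)}\le CH^{-2k}J^{(k)}$ and $\operatorname{Cond}(B^{(k)})\le CH^{-2}$.
   Context: $H^s_0(\Omega)$ is the closure of the smooth compactly supported functions in $H^s(\Omega)$, with norm $\|u\|_{H^s_0(\Omega)}=\|\Delta^m u\|_{L^2(\Omega)}$ if $s=2m$ and $\|\nabla\Delta^m u\|_{L^2(\Omega)}$ if $s=2m+1$. $H^{-s}(\Omega)$ is its dual via the Gelfand triple $H^s_0\subset L^2\subset H^{-s}$, with pairing $[g,v]=\int_\Omega gv$ and norm $\|g\|_{H^{-s}(\Omega)}=\sup_{v\in H^s_0(\Omega)}\int_\Omega gv/\|v\|_{H^s_0(\Omega)}$. $C_{\mathcal L}=\sup_u\|\mathcal Lu\|_{H^{-s}}/\|u\|_{H^s_0}$, $C_{\mathcal L^{-1}}=\sup_u\|u\|_{H^s_0}/\|\mathcal Lu\|_{H^{-s}}$ (suprema over $u\in H^s_0(\Omega)$). $\|u\|:=[\mathcal Lu,u]^{1/2}$ with scalar product $\langle u,v\rangle=[\mathcal Lu,v]$. Index tree: $\mathcal I^{(q)}$ ($q\in\mathbb N^*$) is a finite set of $q$-tuples; for a tuple $i$ of length $\geq k$, $i^{(k)}:=(i_1,\dots,i_k)$; $\mathcal I^{(k)}:=\{i^{(k)}:i\in\mathcal I^{(q)}\}$; $I^{(k)}$ is the $\mathcal I^{(k)}\times\mathcal I^{(k)}$ identity. $\pi^{(k,k+1)}$ ($1\le k\le q-1$) is an $\mathcal I^{(k)}\times\mathcal I^{(k+1)}$ matrix with $\pi^{(k,k+1)}(\pi^{(k,k+1)})^T=I^{(k)}$.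 $(\phi^{(q)}_i)_{i\in\mathcal I^{(q)}}$ are orthonormal elements of $L^2(\Omega)$ and $\phi^{(k)}_i=\sum_{j\in\mathcal I^{(k+1)}}\pi^{(k,k+1)}_{i,j}\phi^{(k+1)}_j$ for $k<q$; $\Phi^{(k)}:=\operatorname{span}\{\phi^{(k)}_i:i\in\mathcal I^{(k)}\}$. Gamblets: $\psi^{(k)}_i$ is the minimizer of $\|\psi\|$ over $\psi\in H^s_0(\Omega)$ with $[\phi^{(k)}_j,\psi]=\delta_{i,j}$ for $j\in\mathcal I^{(k)}$. $u^{(k)}:=\sum_{i\in\mathcal I^{(k)}}[\phi^{(k)}_i,u]\psi^{(k)}_i$. For $k\in\{2,\dots,q\}$, $\mathcal J^{(k)}$ is a finite set of $k$-tuples with $\{j^{(k-1)}:j\in\mathcal J^{(k)}\}=\mathcal I^{(k-1)}$ and $\#\{j\in\mathcal J^{(k)}:j^{(k-1)}=i\}=\#\{t\in\mathcal I^{(k)}:t^{(k-1)}=i\}-1$ for $i\in\mathcal I^{(k-1)}$; $J^{(k)}$ is the $\mathcal J^{(k)}\times\mathcal J^{(k)}$ identity; $W^{(k)}$ is a $\mathcal J^{(k)}\times\mathcal I^{(k)}$ matrix with $\operatorname{Im}(W^{(k),T})=\operatorname{Ker}(\pi^{(k-1,k)})$ and $W^{(k)}W^{(k),T}=J^{(k)}$. $\chi^{(k)}_i:=\sum_{j\in\mathcal I^{(k)}}W^{(k)}_{i,j}\psi^{(k)}_j$ for $i\in\mathcal J^{(k)}$. $A^{(k)}_{i,j}=\langle\psi^{(k)}_i,\psi^{(k)}_j\rangle$,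 $B^{(k)}_{i,j}=\langle\chi^{(k)}_i,\chi^{(k)}_j\rangle$. $\operatorname{Cond}(X)=\lambda_{\max}(X)/\lambda_{\min}(X)$; matrix inequalities are in the sense of quadratic forms.
   Formalization: In the lower bound for A^(1) and in the bound on Cond(A^(1)) the constant may also depend on Ω, d and s, since with C depending only on C_s, C_L, C_{L^{-1}} these two bounds fail for −Δ on (0,R) as R grows; all other bounds keep the original dependence. *)

theory Defs
  imports "HOL-Analysis.Analysis"
begin

section \<open>Euclidean space of dimension \<open>d\<close>\<close>

text \<open>
  The dimension is a natural number and not a type, so that a constant can be chosen before
  the dimension.  Points are extensional functions on \<open>{..<d}\<close>: this is the carrier both of
  the product topology and of the product measure.
\<close>

type_synonym point = "nat \<Rightarrow> real"
type_synonym fn = "point \<Rightarrow> real"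

definition Rd :: "nat \<Rightarrow> point topology" where
  "Rd d = product_topology (\<lambda>_. euclideanreal) {..<d}"

definition leb_on :: "nat \<Rightarrow> point set \<Rightarrow> point measure" where
  "leb_on d \<Omega> = restrict_space (Pi\<^sub>M {..<d} (\<lambda>_. lborel)) \<Omega>"

definition vdist :: "nat \<Rightarrow> point \<Rightarrow> point \<Rightarrow> real" where
  "vdist d x y = L2_set (\<lambda>i. x i - y i) {..<d}"

definition vinner :: "nat \<Rightarrow> point \<Rightarrow> point \<Rightarrow> real" where
  "vinner d x y = (\<Sum>i<d. x i * y i)"

text \<open>
  Near each boundary point, \<open>\<Omega>\<close> is the set of points above the graph of a Lipschitz function
  \<open>\<gamma>\<close> of the component orthogonal to some unit vector \<open>e\<close>.  Uniformity: the radius \<open>r\<close> and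
  the Lipschitz constant \<open>M\<close> do not depend on the boundary point.
\<close>

definition uniformly_lipschitz_boundary :: "nat \<Rightarrow> point set \<Rightarrow> bool" where
  "uniformly_lipschitz_boundary d \<Omega> \<longleftrightarrow>
     (\<exists>r>0. \<exists>M. \<forall>x \<in> Rd d frontier_of \<Omega>. \<exists>e \<in> topspace (Rd d). \<exists>\<gamma> :: fn.
        vinner d e e = 1 \<and>
        (\<forall>y \<in> topspace (Rd d). \<forall>z \<in> topspace (Rd d). \<bar>\<gamma> y - \<gamma> z\<bar> \<le> M * vdist d y z) \<and>
        (\<forall>y \<in> topspace (Rd d). vdist d x y < r \<longrightarrow>
           (y \<in> \<Omega> \<longleftrightarrow> \<gamma> (\<lambda>i\<in>{..<d}. y i - vinner d y e * e i) < vinner d y e)))"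

definition bounded_lipschitz_domain :: "nat \<Rightarrow> point set \<Rightarrow> bool" where
  "bounded_lipschitz_domain d \<Omega> \<longleftrightarrow>
     openin (Rd d) \<Omega> \<and> (\<exists>R. \<forall>x\<in>\<Omega>. \<forall>i<d. \<bar>x i\<bar> \<le> R) \<and> uniformly_lipschitz_boundary d \<Omega>"


section \<open>Sobolev spaces\<close>

text \<open>
  Elements of function spaces are represented by functions; almost everywhere equal functions
  represent the same element.  Values outside \<open>\<Omega>\<close> are irrelevant.
\<close>

definition L2 :: "nat \<Rightarrow> point set \<Rightarrow> fn set" where
  "L2 d \<Omega> = {f \<in> borel_measurable (leb_on d \<Omega>). integrable (leb_on d \<Omega>) (\<lambda>x. (f x)\<^sup>2)}"

definition pairing :: "nat \<Rightarrow> point set \<Rightarrow> fn \<Rightarrow> fn \<Rightarrow> real" where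
  "pairing d \<Omega> f g = (\<integral>x. f x * g x \<partial>leb_on d \<Omega>)"

definition L2_norm :: "nat \<Rightarrow> point set \<Rightarrow> fn \<Rightarrow> real" where
  "L2_norm d \<Omega> f = sqrt (pairing d \<Omega> f f)"

definition partial :: "nat \<Rightarrow> fn \<Rightarrow> fn" where
  "partial i f x = deriv (\<lambda>t. f (x(i := t))) (x i)"

definition smooth :: "nat \<Rightarrow> fn \<Rightarrow> bool" where
  "smooth d f \<longleftrightarrow>
     (\<forall>is. set is \<subseteq> {..<d} \<longrightarrow>
        continuous_map (Rd d) euclideanreal (foldr partial is f) \<and>
        (\<forall>i<d. \<forall>x \<in> topspace (Rd d).
           (\<lambda>t. foldr partial is f (x(i := t))) differentiable (at (x i))))"

definition test_functions :: "nat \<Rightarrow> point set \<Rightarrow> fn set" where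
  "test_functions d \<Omega> =
     {f. smooth d f \<and> (\<exists>K. compactin (Rd d) K \<and> K \<subseteq> \<Omega> \<and> (\<forall>x \<in> topspace (Rd d) - K. f x = 0))}"

text \<open>A multi-index of order \<open>n\<close> is a sorted list of \<open>n\<close> coordinate directions.\<close>

definition multi_indices :: "nat \<Rightarrow> nat \<Rightarrow> nat list set" where
  "multi_indices d s = {is. sorted is \<and> set is \<subseteq> {..<d} \<and> length is \<le> s}"

definition is_weak_deriv :: "nat \<Rightarrow> point set \<Rightarrow> nat list \<Rightarrow> fn \<Rightarrow> fn \<Rightarrow> bool" where
  "is_weak_deriv d \<Omega> is u w \<longleftrightarrow> w \<in> L2 d \<Omega> \<and>
     (\<forall>\<eta> \<in> test_functions d \<Omega>.
        pairing d \<Omega> u (foldr partial is \<eta>) = (- 1) ^ length is * pairing d \<Omega> w \<eta>)"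

definition weak_deriv :: "nat \<Rightarrow> point set \<Rightarrow> nat list \<Rightarrow> fn \<Rightarrow> fn" where
  "weak_deriv d \<Omega> is u = (SOME w. is_weak_deriv d \<Omega> is u w)"

definition sobolev :: "nat \<Rightarrow> point set \<Rightarrow> nat \<Rightarrow> fn set" where
  "sobolev d \<Omega> s = {u \<in> L2 d \<Omega>. \<forall>is \<in> multi_indices d s. \<exists>w. is_weak_deriv d \<Omega> is u w}"

definition sobolev_norm :: "nat \<Rightarrow> point set \<Rightarrow> nat \<Rightarrow> fn \<Rightarrow> real" where
  "sobolev_norm d \<Omega> s u =
     sqrt (\<Sum>is \<in> multi_indices d s. (L2_norm d \<Omega> (weak_deriv d \<Omega> is u))\<^sup>2)"

definition sobolev0 :: "nat \<Rightarrow> point set \<Rightarrow> nat \<Rightarrow> fn set" where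
  "sobolev0 d \<Omega> s =
     {u \<in> sobolev d \<Omega> s. \<exists>\<eta>. (\<forall>n::nat. \<eta> n \<in> test_functions d \<Omega>) \<and>
        (\<lambda>n. sobolev_norm d \<Omega> s (\<lambda>x. u x - \<eta> n x)) \<longlonglongrightarrow> 0}"

definition laplacian :: "nat \<Rightarrow> point set \<Rightarrow> fn \<Rightarrow> fn" where
  "laplacian d \<Omega> u = (\<lambda>x. \<Sum>i<d. weak_deriv d \<Omega> [i, i] u x)"

definition sobolev0_norm :: "nat \<Rightarrow> point set \<Rightarrow> nat \<Rightarrow> fn \<Rightarrow> real" where
  "sobolev0_norm d \<Omega> s u =
     (let v = (laplacian d \<Omega> ^^ (s div 2)) u in
      if even s then L2_norm d \<Omega> v
      else sqrt (\<Sum>i<d. (L2_norm d \<Omega> (weak_deriv d \<Omega> [i] v))\<^sup>2))"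

text \<open>
  The dual space consists of functionals on \<^term>\<open>sobolev0 d \<Omega> s\<close>; functionals that agree there
  are identified.  A function \<open>g\<close> in \<open>L2\<close> is identified with \<^term>\<open>pairing d \<Omega> g\<close>.
\<close>

definition sobolev_dual :: "nat \<Rightarrow> point set \<Rightarrow> nat \<Rightarrow> (fn \<Rightarrow> real) set" where
  "sobolev_dual d \<Omega> s =
     {F. (\<forall>u \<in> sobolev0 d \<Omega> s. \<forall>v \<in> sobolev0 d \<Omega> s. F (\<lambda>x. u x + v x) = F u + F v) \<and>
         (\<forall>u \<in> sobolev0 d \<Omega> s. \<forall>c. F (\<lambda>x. c * u x) = c * F u) \<and>
         (\<exists>K. \<forall>u \<in> sobolev0 d \<Omega> s. \<bar>F u\<bar> \<le> K * sobolev0_norm d \<Omega> s u)}"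

text \<open>In this and the following suprema, the term for the zero function is \<open>0 / 0 = 0\<close>.\<close>

definition dual_norm :: "nat \<Rightarrow> point set \<Rightarrow> nat \<Rightarrow> (fn \<Rightarrow> real) \<Rightarrow> real" where
  "dual_norm d \<Omega> s F = (SUP v \<in> sobolev0 d \<Omega> s. F v / sobolev0_norm d \<Omega> s v)"


section \<open>The operator\<close>

text \<open>
  \<open>L u v\<close> is the duality pairing of \<open>L u\<close> with \<open>v\<close>.  Linearity and continuity imply that
  \<open>L\<close> respects almost everywhere equality.
\<close>

definition sym_pos_bijection ::
    "nat \<Rightarrow> point set \<Rightarrow> nat \<Rightarrow> (fn \<Rightarrow> fn \<Rightarrow> real) \<Rightarrow> bool" where
  "sym_pos_bijection d \<Omega> s L \<longleftrightarrow>
     (let V = sobolev0 d \<Omega> s in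
      (\<forall>u\<in>V. L u \<in> sobolev_dual d \<Omega> s) \<and>
      (\<forall>u\<in>V. \<forall>v\<in>V. \<forall>w\<in>V. L (\<lambda>x. u x + v x) w = L u w + L v w) \<and>
      (\<forall>u\<in>V. \<forall>c. \<forall>w\<in>V. L (\<lambda>x. c * u x) w = c * L u w) \<and>
      (\<exists>K. \<forall>u\<in>V. dual_norm d \<Omega> s (L u) \<le> K * sobolev0_norm d \<Omega> s u) \<and>
      (\<forall>u\<in>V. \<forall>v\<in>V. (\<forall>w\<in>V. L u w = L v w) \<longrightarrow> (AE x in leb_on d \<Omega>. u x = v x)) \<and>
      (\<forall>F \<in> sobolev_dual d \<Omega> s. \<exists>u\<in>V. \<forall>w\<in>V. L u w = F w) \<and>
      (\<forall>u\<in>V. \<forall>v\<in>V. L u v = L v u) \<and>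
      (\<forall>u\<in>V. 0 \<le> L u u))"

text \<open>
  These suprema are extended reals, so that an equation with a real number on the other side
  includes finiteness.
\<close>

definition continuity_const :: "nat \<Rightarrow> point set \<Rightarrow> nat \<Rightarrow> (fn \<Rightarrow> fn \<Rightarrow> real) \<Rightarrow> ereal" where
  "continuity_const d \<Omega> s L =
     (SUP u \<in> sobolev0 d \<Omega> s. ereal (dual_norm d \<Omega> s (L u) / sobolev0_norm d \<Omega> s u))"

definition inverse_continuity_const ::
    "nat \<Rightarrow> point set \<Rightarrow> nat \<Rightarrow> (fn \<Rightarrow> fn \<Rightarrow> real) \<Rightarrow> ereal" where
  "inverse_continuity_const d \<Omega> s L =
     (SUP u \<in> sobolev0 d \<Omega> s. ereal (sobolev0_norm d \<Omega> s u / dual_norm d \<Omega> s (L u)))"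

definition energy_norm :: "(fn \<Rightarrow> fn \<Rightarrow> real) \<Rightarrow> fn \<Rightarrow> real" where
  "energy_norm L u = sqrt (L u u)"


section \<open>Matrices indexed by finite sets\<close>

type_synonym index = "nat list"
type_synonym matrix = "index \<Rightarrow> index \<Rightarrow> real"

definition id_mat :: matrix where
  "id_mat i j = (if i = j then 1 else 0)"

definition mat_le :: "index set \<Rightarrow> matrix \<Rightarrow> matrix \<Rightarrow> bool" where
  "mat_le S X Y \<longleftrightarrow>
     (\<forall>x. (\<Sum>i\<in>S. \<Sum>j\<in>S. x i * X i j * x j) \<le> (\<Sum>i\<in>S. \<Sum>j\<in>S. x i * Y i j * x j))"

definition eigenvalues :: "index set \<Rightarrow> matrix \<Rightarrow> real set" where
  "eigenvalues S X =
     {\<mu>. \<exists>x. (\<exists>i\<in>S. x i \<noteq> 0) \<and> (\<forall>i\<in>S. (\<Sum>j\<in>S. X i j * x j) = \<mu> * x i)}"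

definition cond_number :: "index set \<Rightarrow> matrix \<Rightarrow> real" where
  "cond_number S X = Max (eigenvalues S X) / Min (eigenvalues S X)"


section \<open>Measurement functions and gamblets\<close>

definition index_tree :: "nat \<Rightarrow> index set \<Rightarrow> bool" where
  "index_tree q Iq \<longleftrightarrow> 1 \<le> q \<and> finite Iq \<and> Iq \<noteq> {} \<and> (\<forall>i\<in>Iq. length i = q)"

definition level :: "index set \<Rightarrow> nat \<Rightarrow> index set" where
  "level Iq k = take k ` Iq"

text \<open>\<open>P k\<close> is the matrix \<open>\<pi>\<close> from level \<open>k + 1\<close> to level \<open>k\<close>.\<close>

definition measurement_hierarchy ::
    "nat \<Rightarrow> point set \<Rightarrow> nat \<Rightarrow> index set \<Rightarrow> (nat \<Rightarrow> matrix) \<Rightarrow> (nat \<Rightarrow> index \<Rightarrow> fn) \<Rightarrow> bool" where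
  "measurement_hierarchy d \<Omega> q Iq P \<phi> \<longleftrightarrow>
     index_tree q Iq \<and>
     (\<forall>k\<in>{1..<q}. \<forall>i \<in> level Iq k. \<forall>i' \<in> level Iq k.
        (\<Sum>j \<in> level Iq (k + 1). P k i j * P k i' j) = id_mat i i') \<and>
     (\<forall>i\<in>Iq. \<phi> q i \<in> L2 d \<Omega>) \<and>
     (\<forall>i\<in>Iq. \<forall>j\<in>Iq. pairing d \<Omega> (\<phi> q i) (\<phi> q j) = id_mat i j) \<and>
     (\<forall>k\<in>{1..<q}. \<forall>i \<in> level Iq k.
        \<phi> k i = (\<lambda>x. \<Sum>j \<in> level Iq (k + 1). P k i j * \<phi> (k + 1) j x))"

definition measurement_span :: "index set \<Rightarrow> (nat \<Rightarrow> index \<Rightarrow> fn) \<Rightarrow> nat \<Rightarrow> fn set" where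
  "measurement_span Iq \<phi> k = {f. \<exists>c. f = (\<lambda>x. \<Sum>i \<in> level Iq k. c i * \<phi> k i x)}"

definition gamblets ::
    "nat \<Rightarrow> point set \<Rightarrow> nat \<Rightarrow> (fn \<Rightarrow> fn \<Rightarrow> real) \<Rightarrow> nat \<Rightarrow> index set \<Rightarrow>
     (nat \<Rightarrow> index \<Rightarrow> fn) \<Rightarrow> (nat \<Rightarrow> index \<Rightarrow> fn) \<Rightarrow> bool" where
  "gamblets d \<Omega> s L q Iq \<phi> \<psi> \<longleftrightarrow>
     (\<forall>k\<in>{1..q}. \<forall>i \<in> level Iq k.
        is_arg_min (energy_norm L)
          (\<lambda>v. v \<in> sobolev0 d \<Omega> s \<and> (\<forall>j \<in> level Iq k. pairing d \<Omega> (\<phi> k j) v = id_mat i j))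
          (\<psi> k i))"

definition gamblet_approx ::
    "nat \<Rightarrow> point set \<Rightarrow> index set \<Rightarrow> (nat \<Rightarrow> index \<Rightarrow> fn) \<Rightarrow> (nat \<Rightarrow> index \<Rightarrow> fn) \<Rightarrow>
     nat \<Rightarrow> fn \<Rightarrow> fn" where
  "gamblet_approx d \<Omega> Iq \<phi> \<psi> k u =
     (\<lambda>x. \<Sum>i \<in> level Iq k. pairing d \<Omega> (\<phi> k i) u * \<psi> k i x)"

text \<open>
  The condition on \<open>W k\<close> quantified over \<open>x\<close> states that the image of its transpose is the
  kernel of \<open>P (k - 1)\<close>.
\<close>

definition wavelet_matrices ::
    "nat \<Rightarrow> index set \<Rightarrow> (nat \<Rightarrow> matrix) \<Rightarrow> (nat \<Rightarrow> index set) \<Rightarrow> (nat \<Rightarrow> matrix) \<Rightarrow> bool" where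
  "wavelet_matrices q Iq P J W \<longleftrightarrow>
     (\<forall>k\<in>{2..q}.
        finite (J k) \<and> (\<forall>j \<in> J k. length j = k) \<and>
        take (k - 1) ` J k = level Iq (k - 1) \<and>
        (\<forall>i \<in> level Iq (k - 1).
           card {j \<in> J k. take (k - 1) j = i} = card {t \<in> level Iq k. take (k - 1) t = i} - 1) \<and>
        (\<forall>x. (\<exists>y. \<forall>j \<in> level Iq k. x j = (\<Sum>l \<in> J k. W k l j * y l)) \<longleftrightarrow>
             (\<forall>i \<in> level Iq (k - 1). (\<Sum>j \<in> level Iq k. P (k - 1) i j * x j) = 0)) \<and>
        (\<forall>l \<in> J k. \<forall>l' \<in> J k. (\<Sum>j \<in> level Iq k. W k l j * W k l' j) = id_mat l l'))"

definition chi ::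
    "index set \<Rightarrow> (nat \<Rightarrow> matrix) \<Rightarrow> (nat \<Rightarrow> index \<Rightarrow> fn) \<Rightarrow> nat \<Rightarrow> index \<Rightarrow> fn" where
  "chi Iq W \<psi> k i = (\<lambda>x. \<Sum>j \<in> level Iq k. W k i j * \<psi> k j x)"

definition stiffness :: "(fn \<Rightarrow> fn \<Rightarrow> real) \<Rightarrow> (index \<Rightarrow> fn) \<Rightarrow> matrix" where
  "stiffness L f i j = L (f i) (f j)"

end

theory Submission
  imports Defs
begin

text \<open>
  For \<open>u\<close> in \<^term>\<open>sobolev0 d \<Omega> s\<close> with energy norm \<open>e = sqrt (L u u)\<close>, Cauchy--Schwarz for the form \<open>L\<close>
  bounds the dual norm of \<open>L u\<close> by \<open>sqrt C\<^sub>L * e\<close> and hence the norm of \<open>u\<close> by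
  \<open>C\<^sub>L\<^sub>i * sqrt C\<^sub>L * e\<close>.  Gamblets minimise energy, so a combination \<open>v\<close> of them is \<open>L\<close>-orthogonal to
  every function with vanishing measurements; therefore \<open>L v\<close> lies in the span of the measurement
  functions, with coefficients \<open>A y\<close> if \<open>v\<close> has coefficients \<open>y\<close>.  The inverse inequality (i) for
  \<open>L v\<close> bounds \<open>A\<close> from above.  A function orthogonal to the measurements of level \<open>k\<close>, for
  instance \<open>u - u\<^sup>(\<^sup>k\<^sup>)\<close> or a combination of the \<open>\<chi>\<close> of level \<open>k + 1\<close>, is small in \<open>L\<^sup>2\<close> compared to
  its energy by (ii); this gives the error estimate and the lower bound for \<open>B\<close>.  Only the lower
  bound for \<open>A\<close> at level 1 needs the constant of the Poincare inequality.  The inequality itself also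
  makes the dual norm of an \<open>L\<^sup>2\<close> function finite.
\<close>

section \<open>Positive semidefinite forms\<close>

text \<open>The geometry lives in two semidefinite forms, \<open>pairing\<close> on
  \<open>L2\<close> and \<open>L\<close> on \<open>sobolev0\<close>; they are only semidefinite
  because functions equal almost everywhere are not identified. The norm of \<open>sobolev0\<close>
  enters through three facts: it is nonnegative, it vanishes on null functions, and it satisfies the
  Poincare inequality. The obstacle is that this norm iterates weak derivatives picked by
  \<open>SOME\<close>, which need not be pointwise linear in the function. So
  \<open>sobolev0\<close> is redescribed through sequences of test functions whose classical
  derivatives converge in \<open>L2\<close>; the picked derivatives agree almost everywhere with the
  limits because test functions detect null functions. The factor \<open>CLi\<^sup>2 * CL\<close> in
  the constants is the square of \<open>CLi * sqrt CL\<close>, the price of comparing norm and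
  energy by Cauchy--Schwarz for \<open>L\<close>. At level 1 there is no coarser level to be
  orthogonal to, and (ii) says nothing about a general combination of the \<psi>; so the domain
  enters the lower bound for \<open>A\<close> through its Poincare constant. Hence the second
  constant \<open>C\<^sub>\<Omega>\<close>, for this bound and for the condition number of
  \<open>A\<close>.\<close>

locale psd_form =
  fixes V :: "('a \<Rightarrow> real) set" and b :: "('a \<Rightarrow> real) \<Rightarrow> ('a \<Rightarrow> real) \<Rightarrow> real"
  assumes zero_in: "(\<lambda>_. 0) \<in> V"
    and add_in: "u \<in> V \<Longrightarrow> v \<in> V \<Longrightarrow> (\<lambda>x. u x + v x) \<in> V"
    and scale_in: "u \<in> V \<Longrightarrow> (\<lambda>x. c * u x) \<in> V"
    and form_add: "u \<in> V \<Longrightarrow> v \<in> V \<Longrightarrow> w \<in> V \<Longrightarrow> b (\<lambda>x. u x + v x) w = b u w + b v w"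
    and form_scale: "u \<in> V \<Longrightarrow> w \<in> V \<Longrightarrow> b (\<lambda>x. c * u x) w = c * b u w"
    and form_sym: "u \<in> V \<Longrightarrow> v \<in> V \<Longrightarrow> b u v = b v u"
    and form_nonneg: "u \<in> V \<Longrightarrow> 0 \<le> b u u"
begin

lemma form_add_right: "u \<in> V \<Longrightarrow> v \<in> V \<Longrightarrow> w \<in> V \<Longrightarrow> b w (\<lambda>x. u x + v x) = b w u + b w v"
  by (simp add: form_add form_sym[of w] add_in)

lemma form_scale_right: "u \<in> V \<Longrightarrow> w \<in> V \<Longrightarrow> b w (\<lambda>x. c * u x) = c * b w u"
  by (simp add: form_scale form_sym[of w] scale_in)

lemma form_zero: "w \<in> V \<Longrightarrow> b (\<lambda>_. 0) w = 0"
  using form_scale[of "\<lambda>_. 0" w 0] zero_in by simp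

lemma diff_in: "u \<in> V \<Longrightarrow> v \<in> V \<Longrightarrow> (\<lambda>x. u x - v x) \<in> V"
  using add_in[of u "\<lambda>x. -1 * v x"] scale_in[of v "-1"] by simp

lemma form_diff: "u \<in> V \<Longrightarrow> v \<in> V \<Longrightarrow> w \<in> V \<Longrightarrow> b (\<lambda>x. u x - v x) w = b u w - b v w"
  using form_add[of u "\<lambda>x. -1 * v x" w] form_scale[of v w "-1"] scale_in[of v "-1"] by simp

lemma form_diff_right: "u \<in> V \<Longrightarrow> v \<in> V \<Longrightarrow> w \<in> V \<Longrightarrow> b w (\<lambda>x. u x - v x) = b w u - b w v"
  by (simp add: form_diff form_sym[of w] diff_in)

text \<open>One induction serves both claims, since additivity of \<open>b\<close> in the step needs
  membership of the partial sum. An infinite \<open>S\<close> gives the zero function, so finiteness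
  is not assumed.\<close>

lemma sum_in_and_form_sum:
  assumes "\<And>i. i \<in> S \<Longrightarrow> f i \<in> V"
  shows "(\<lambda>x. \<Sum>i\<in>S. c i * f i x) \<in> V \<and>
    (\<forall>w\<in>V. b (\<lambda>x. \<Sum>i\<in>S. c i * f i x) w = (\<Sum>i\<in>S. c i * b (f i) w))"
  using assms
proof (induction S rule: infinite_finite_induct)
  case (insert i S)
  then have "(\<lambda>x. c i * f i x) \<in> V" "(\<lambda>x. \<Sum>i\<in>S. c i * f i x) \<in> V"
    by (auto intro: scale_in)
  with insert show ?case
    by (auto simp: form_add form_scale intro: add_in)
qed (auto simp: zero_in form_zero)

lemmas sum_in = sum_in_and_form_sum[THEN conjunct1]
lemmas form_sum = sum_in_and_form_sum[THEN conjunct2, rule_format]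

lemma form_sum_right:
  assumes "\<And>i. i \<in> S \<Longrightarrow> f i \<in> V" "w \<in> V"
  shows "b w (\<lambda>x. \<Sum>i\<in>S. c i * f i x) = (\<Sum>i\<in>S. c i * b w (f i))"
  using assms form_sum[of S f w c] by (simp add: sum_in form_sym[of w])

lemma form_square_expand:
  assumes "u \<in> V" "v \<in> V"
  shows "b (\<lambda>x. u x + t * v x) (\<lambda>x. u x + t * v x) = b u u + 2 * t * b u v + t\<^sup>2 * b v v"
  using assms form_sym[of v u]
  by (simp add: form_add form_scale form_add_right form_scale_right scale_in add_in
      power2_eq_square algebra_simps)

text \<open>First-order optimality: the quadratic is the energy of \<psi> + t w minus that of a
  minimiser \<psi>.\<close>

lemma linear_coeff_zero:
  assumes "\<And>t::real. 0 \<le> 2 * t * p + t\<^sup>2 * q"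
  shows "p = 0"
proof -
  have "0 \<le> q" using assms[of 1] assms[of "-1"] by simp
  \<comment> \<open>The minimiser for leading coefficient \<open>q + 1\<close>; the added 1 keeps
    the denominator positive when \<open>q = 0\<close>.\<close>
  then have "2 * (- p / (q + 1)) * p + (- p / (q + 1))\<^sup>2 * (q + 1) = - (p\<^sup>2 / (q + 1))"
    by (simp add: power2_eq_square)
  moreover have "(- p / (q + 1))\<^sup>2 * q \<le> (- p / (q + 1))\<^sup>2 * (q + 1)"
    by (intro mult_left_mono) auto
  ultimately have "p\<^sup>2 / (q + 1) \<le> 0"
    using assms[of "- p / (q + 1)"] by linarith
  with \<open>0 \<le> q\<close> have "p\<^sup>2 \<le> 0" by (simp add: divide_le_0_iff)
  then show ?thesis by simp
qed

lemma Cauchy_Schwarz: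
  assumes u: "u \<in> V" and v: "v \<in> V"
  shows "(b u v)\<^sup>2 \<le> b u u * b v v"
proof (cases "b v v = 0")
  case True
  have lin: "0 \<le> b u u + 2 * t * b u v" for t
    using form_square_expand[OF u v, of t] form_nonneg[of "\<lambda>x. u x + t * v x"] True u v
    by (simp add: add_in scale_in)
  have "b u v = 0"
  proof (rule ccontr)
    assume "b u v \<noteq> 0"
    \<comment> \<open>At this \<open>t\<close> the nonnegative affine function would equal
      -1.\<close>
    then show False using lin[of "- (b u u + 1) / (2 * b u v)"] by (simp add: field_simps)
  qed
  then show ?thesis using True by simp
next
  case False
  then have pos: "b v v > 0" using form_nonneg[OF v] by simp
  define t where "t = - b u v / b v v"
  have "0 \<le> b u u + 2 * t * b u v + t\<^sup>2 * b v v"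
    using form_square_expand[OF u v, of t] form_nonneg[of "\<lambda>x. u x + t * v x"] u v
    by (simp add: add_in scale_in)
  also have "\<dots> = b u u - (b u v)\<^sup>2 / b v v"
    using pos by (simp add: t_def power2_eq_square field_simps)
  finally show ?thesis using pos by (simp add: field_simps)
qed

lemma Cauchy_Schwarz_sqrt:
  "u \<in> V \<Longrightarrow> v \<in> V \<Longrightarrow> \<bar>b u v\<bar> \<le> sqrt (b u u) * sqrt (b v v)"
  using real_sqrt_le_mono[OF Cauchy_Schwarz, of u v] by (simp add: real_sqrt_mult)

lemma seminorm_triangle:
  assumes u: "u \<in> V" and v: "v \<in> V"
  shows "sqrt (b (\<lambda>x. u x + v x) (\<lambda>x. u x + v x)) \<le> sqrt (b u u) + sqrt (b v v)"
proof (rule real_le_lsqrt)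
  have "b (\<lambda>x. u x + v x) (\<lambda>x. u x + v x) = b u u + 2 * b u v + b v v"
    using form_square_expand[OF u v, of 1] by simp
  also have "\<dots> \<le> b u u + 2 * (sqrt (b u u) * sqrt (b v v)) + b v v"
    using Cauchy_Schwarz_sqrt[OF u v] by simp
  also have "\<dots> = (sqrt (b u u) + sqrt (b v v))\<^sup>2"
    using u v by (simp add: form_nonneg power2_sum)
  finally show "b (\<lambda>x. u x + v x) (\<lambda>x. u x + v x) \<le> (sqrt (b u u) + sqrt (b v v))\<^sup>2" .
qed (use u v in \<open>simp_all add: form_nonneg add_in\<close>)

lemma seminorm_scale:
  "u \<in> V \<Longrightarrow> sqrt (b (\<lambda>x. c * u x) (\<lambda>x. c * u x)) = \<bar>c\<bar> * sqrt (b u u)"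
  by (simp add: form_scale form_scale_right scale_in real_sqrt_mult flip: mult.assoc)

end

section \<open>The Lebesgue space of a bounded domain\<close>

lemma topspace_Rd: "topspace (Rd d) = PiE {..<d} (\<lambda>_. UNIV)"
  by (simp add: Rd_def)

abbreviation leb :: "nat \<Rightarrow> point measure" where
  "leb d \<equiv> Pi\<^sub>M {..<d} (\<lambda>_. lborel)"

lemma space_leb: "space (leb d) = topspace (Rd d)"
  by (simp add: space_PiM topspace_Rd)

text \<open>Borel sets and product-measurable sets coincide on the full countable power of the
  reals. The map \<open>e\<close> embeds the d-dimensional space there by zero padding,
  \<open>r\<close> is a continuous left inverse, and so \<open>U\<close> is the preimage under
  \<open>e\<close> of an open set.\<close>

lemma openin_Rd_sets:
  assumes "openin (Rd d) U"
  shows "U \<in> sets (leb d)"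
proof -
  define r :: "point \<Rightarrow> point" where "r x = restrict x {..<d}" for x
  define e :: "point \<Rightarrow> point" where "e x = (\<lambda>i. if i < d then x i else 0)" for x
  have "continuous_map (product_topology (\<lambda>_. euclideanreal) UNIV) (Rd d) r"
    unfolding Rd_def r_def
    by (auto simp: continuous_map_componentwise intro!: continuous_map_product_projection)
  then have "openin (product_topology (\<lambda>_. euclideanreal) UNIV) {x \<in> UNIV. r x \<in> U}"
    using assms by (force simp: continuous_map_def)
  then have "open {x. r x \<in> U}"
    by (simp add: open_fun_def)
  then have *: "{x. r x \<in> U} \<in> sets (Pi\<^sub>M UNIV (\<lambda>_::nat. borel :: real measure))"
    by (simp add: sets_PiM_equal_borel)
  have "e \<in> measurable (leb d) (Pi\<^sub>M UNIV (\<lambda>_::nat. borel :: real measure))"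
    unfolding e_def
  proof (rule measurable_PiM_single')
    fix i :: nat
    show "(\<lambda>x. if i < d then x i else (0::real)) \<in> borel_measurable (leb d)"
    proof (cases "i < d")
      case True
      then have "(\<lambda>x. x i) \<in> measurable (leb d) lborel"
        by (intro measurable_component_singleton) simp
      then show ?thesis using True by simp
    qed simp
  qed auto
  then have "e -` {x. r x \<in> U} \<inter> space (leb d) \<in> sets (leb d)"
    using * by (rule measurable_sets)
  also have "e -` {x. r x \<in> U} \<inter> space (leb d) = U"
  proof -
    have "r (e x) = x" if "x \<in> topspace (Rd d)" for x
      using that by (force simp: r_def e_def topspace_Rd PiE_def extensional_def)
    moreover have "U \<subseteq> topspace (Rd d)" using assms by (rule openin_subset)
    ultimately show ?thesis by (auto simp: space_leb)
  qed
  finally show ?thesis .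
qed

lemma continuous_map_Rd_measurable:
  assumes "continuous_map (Rd d) euclideanreal f"
  shows "f \<in> borel_measurable (leb d)"
proof (rule borel_measurableI)
  fix S :: "real set" assume "open S"
  then have "openin (Rd d) {x \<in> topspace (Rd d). f x \<in> S}"
    using assms by (auto simp: continuous_map_def)
  moreover have "f -` S \<inter> space (leb d) = {x \<in> topspace (Rd d). f x \<in> S}"
    by (auto simp: space_leb)
  ultimately show "f -` S \<inter> space (leb d) \<in> sets (leb d)"
    by (simp add: openin_Rd_sets)
qed

lemma upd_in_topspace: "x \<in> topspace (Rd d) \<Longrightarrow> i < d \<Longrightarrow> x(i := t) \<in> topspace (Rd d)"
  by (auto simp: topspace_Rd PiE_def extensional_def)

lemma continuous_map_upd:
  assumes "x \<in> topspace (Rd d)" "i < d"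
  shows "continuous_map euclideanreal (Rd d) (\<lambda>t. x(i := t))"
  unfolding Rd_def continuous_map_componentwise
  using assms upd_in_topspace[OF assms] by (auto simp: topspace_Rd PiE_def)

lemma continuous_on_line:
  assumes "continuous_map (Rd d) euclideanreal f" "x \<in> topspace (Rd d)" "i < d"
  shows "continuous_on S (\<lambda>t. f (x(i := t)))"
  using continuous_map_compose[OF continuous_map_upd[OF assms(2,3)] assms(1)]
  by (auto simp: o_def intro: continuous_on_subset)

lemma continuous_map_coord: "i < d \<Longrightarrow> continuous_map (Rd d) euclideanreal (\<lambda>x. x i)"
  unfolding Rd_def by (rule continuous_map_product_projection) simp

lemma Hausdorff_Rd: "Hausdorff_space (Rd d)"
  by (simp add: Rd_def Hausdorff_space_product_topology)

section \<open>The domain and its square-integrable functions\<close>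

locale domain =
  fixes d :: nat and \<Omega> :: "point set" and R :: real
  assumes open_dom: "openin (Rd d) \<Omega>"
    and dom_bounded: "\<And>x i. x \<in> \<Omega> \<Longrightarrow> i < d \<Longrightarrow> \<bar>x i\<bar> \<le> R"
    and R_pos: "0 < R"
begin

lemma dom_subset: "\<Omega> \<subseteq> topspace (Rd d)"
  using open_dom by (rule openin_subset)

lemma dom_sets [measurable]: "\<Omega> \<in> sets (leb d)"
  using open_dom by (rule openin_Rd_sets)

lemma emeasure_box: "emeasure (leb d) (PiE {..<d} (\<lambda>_. {a..b})) < \<infinity>"
proof -
  interpret product_sigma_finite "\<lambda>_::nat. lborel :: real measure" ..
  show ?thesis
    by (subst emeasure_PiM) (auto simp: ennreal_prod_eq_top less_top[symmetric] emeasure_lborel_Icc_eq power_eq_top_ennreal)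
qed

lemma dom_subset_box: "\<Omega> \<subseteq> PiE {..<d} (\<lambda>_. {-R..R})"
proof
  fix x assume x: "x \<in> \<Omega>"
  then have "x \<in> extensional {..<d}"
    using dom_subset by (auto simp: topspace_Rd PiE_def)
  then show "x \<in> PiE {..<d} (\<lambda>_. {-R..R})"
    using dom_bounded[OF x] by (auto simp: PiE_def abs_le_iff minus_le_iff)
qed

lemma emeasure_dom: "emeasure (leb d) \<Omega> < \<infinity>"
proof -
  have "PiE {..<d} (\<lambda>_. {-R..R}) \<in> sets (leb d)"
    by (rule sets_PiM_I_finite) auto
  then have "emeasure (leb d) \<Omega> \<le> emeasure (leb d) (PiE {..<d} (\<lambda>_. {-R..R}))"
    by (intro emeasure_mono dom_subset_box)
  then show ?thesis using emeasure_box[of "-R" R] by (rule le_less_trans)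
qed

lemma space_leb_on: "space (leb_on d \<Omega>) = \<Omega>"
  using dom_subset by (auto simp: leb_on_def space_restrict_space space_leb)

lemma finite_leb_on: "emeasure (leb_on d \<Omega>) (space (leb_on d \<Omega>)) < \<infinity>"
  unfolding space_leb_on unfolding leb_on_def
  by (subst emeasure_restrict_space) (use emeasure_dom dom_sets in \<open>auto simp: Int_absorb2 sets.sets_into_space\<close>)

lemma measurable_leb_on: "f \<in> borel_measurable (leb d) \<Longrightarrow> f \<in> borel_measurable (leb_on d \<Omega>)"
  unfolding leb_on_def by (rule measurable_restrict_space1)

lemma integral_leb_on:
  fixes f :: fn
  shows "(\<integral>x. f x \<partial>leb_on d \<Omega>) = (\<integral>x. indicator \<Omega> x * f x \<partial>leb d)"
  unfolding leb_on_def
  by (subst integral_restrict_space) (use dom_sets in \<open>auto simp: Int_absorb2 sets.sets_into_space\<close>)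

lemma integrable_leb_on:
  fixes f :: fn
  shows "integrable (leb_on d \<Omega>) f \<longleftrightarrow> integrable (leb d) (\<lambda>x. indicator \<Omega> x * f x)"
  unfolding leb_on_def
  by (subst integrable_restrict_space) (use dom_sets in \<open>auto simp: Int_absorb2 sets.sets_into_space\<close>)

lemma L2_mult_integrable:
  assumes "f \<in> L2 d \<Omega>" "g \<in> L2 d \<Omega>"
  shows "integrable (leb_on d \<Omega>) (\<lambda>x. f x * g x)"
proof (rule Bochner_Integration.integrable_bound)
  show "integrable (leb_on d \<Omega>) (\<lambda>x. (f x)\<^sup>2 + (g x)\<^sup>2)"
    using assms by (auto simp: L2_def)
  show "(\<lambda>x. f x * g x) \<in> borel_measurable (leb_on d \<Omega>)"
    using assms by (auto simp: L2_def)
  have "\<bar>a * b\<bar> \<le> a\<^sup>2 + b\<^sup>2" for a b :: real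
  proof -
    have "2 * \<bar>a * b\<bar> \<le> a\<^sup>2 + b\<^sup>2"
      using sum_squares_bound[of "\<bar>a\<bar>" "\<bar>b\<bar>"] by (simp add: abs_mult)
    then show ?thesis using sum_power2_ge_zero[of a b] by linarith
  qed
  then show "AE x in leb_on d \<Omega>. norm (f x * g x) \<le> norm ((f x)\<^sup>2 + (g x)\<^sup>2)"
    by simp
qed

sublocale L2: psd_form "L2 d \<Omega>" "pairing d \<Omega>"
proof
  show "(\<lambda>_. 0) \<in> L2 d \<Omega>" by (simp add: L2_def)
next
  fix u v assume uv: "u \<in> L2 d \<Omega>" "v \<in> L2 d \<Omega>"
  have "integrable (leb_on d \<Omega>) (\<lambda>x. (u x)\<^sup>2 + (v x)\<^sup>2 + 2 * (u x * v x))"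
    using uv L2_mult_integrable[OF uv] by (auto simp: L2_def)
  then show "(\<lambda>x. u x + v x) \<in> L2 d \<Omega>"
    using uv by (auto simp: L2_def power2_sum algebra_simps)
next
  fix u :: fn and c assume "u \<in> L2 d \<Omega>"
  then show "(\<lambda>x. c * u x) \<in> L2 d \<Omega>"
    by (auto simp: L2_def power_mult_distrib)
next
  fix u v w assume "u \<in> L2 d \<Omega>" "v \<in> L2 d \<Omega>" "w \<in> L2 d \<Omega>"
  then show "pairing d \<Omega> (\<lambda>x. u x + v x) w = pairing d \<Omega> u w + pairing d \<Omega> v w"
    by (simp add: pairing_def distrib_right L2_mult_integrable)
next
  fix u w :: fn and c
  show "pairing d \<Omega> (\<lambda>x. c * u x) w = c * pairing d \<Omega> u w"
    by (simp add: pairing_def mult.assoc)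
  show "pairing d \<Omega> u w = pairing d \<Omega> w u"
    by (simp add: pairing_def mult.commute)
qed (simp add: pairing_def)

lemma L2_norm_nonneg: "0 \<le> L2_norm d \<Omega> f"
  by (simp add: L2_norm_def pairing_def)

lemma L2_norm_power2: "(L2_norm d \<Omega> f)\<^sup>2 = pairing d \<Omega> f f"
  by (simp add: L2_norm_def pairing_def)

lemma L2_norm_cong_AE:
  assumes "AE x in leb_on d \<Omega>. f x = f' x" "f \<in> L2 d \<Omega>" "f' \<in> L2 d \<Omega>"
  shows "L2_norm d \<Omega> f = L2_norm d \<Omega> f'"
  unfolding L2_norm_def pairing_def
  by (rule arg_cong[where f=sqrt], rule integral_cong_AE)
     (use assms in \<open>auto simp: L2_def elim!: eventually_mono\<close>)

lemma pairing_cong: "(\<And>x. x \<in> \<Omega> \<Longrightarrow> f x = f' x) \<Longrightarrow> (\<And>x. x \<in> \<Omega> \<Longrightarrow> g x = g' x)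
    \<Longrightarrow> pairing d \<Omega> f g = pairing d \<Omega> f' g'"
  unfolding pairing_def by (rule Bochner_Integration.integral_cong) (auto simp: space_leb_on)

lemma L2_norm_cong: "(\<And>x. x \<in> \<Omega> \<Longrightarrow> f x = f' x) \<Longrightarrow> L2_norm d \<Omega> f = L2_norm d \<Omega> f'"
  unfolding L2_norm_def by (metis pairing_cong)

lemma pairing_le_norms:
  "f \<in> L2 d \<Omega> \<Longrightarrow> g \<in> L2 d \<Omega> \<Longrightarrow> \<bar>pairing d \<Omega> f g\<bar> \<le> L2_norm d \<Omega> f * L2_norm d \<Omega> g"
  unfolding L2_norm_def by (rule L2.Cauchy_Schwarz_sqrt)

lemma L2_norm_triangle:
  "f \<in> L2 d \<Omega> \<Longrightarrow> g \<in> L2 d \<Omega> \<Longrightarrow> L2_norm d \<Omega> (\<lambda>x. f x + g x) \<le> L2_norm d \<Omega> f + L2_norm d \<Omega> g"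
  unfolding L2_norm_def by (rule L2.seminorm_triangle)

lemma L2_norm_scale: "f \<in> L2 d \<Omega> \<Longrightarrow> L2_norm d \<Omega> (\<lambda>x. c * f x) = \<bar>c\<bar> * L2_norm d \<Omega> f"
  unfolding L2_norm_def by (rule L2.seminorm_scale)

end

section \<open>Partial derivatives and smooth functions\<close>

lemma partial_cong:
  assumes "\<And>x. x \<in> topspace (Rd d) \<Longrightarrow> f x = g x" "i < d" "x \<in> topspace (Rd d)"
  shows "partial i f x = partial i g x"
proof -
  have "(\<lambda>t. f (x(i := t))) = (\<lambda>t. g (x(i := t)))"
    using assms upd_in_topspace by auto
  then show ?thesis by (simp add: partial_def)
qed

lemma smooth_continuous:
  "smooth d f \<Longrightarrow> set is \<subseteq> {..<d} \<Longrightarrow> continuous_map (Rd d) euclideanreal (foldr partial is f)"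
  by (simp add: smooth_def)

lemma smooth_foldr_partial: "smooth d f \<Longrightarrow> set is \<subseteq> {..<d} \<Longrightarrow> smooth d (foldr partial is f)"
  unfolding smooth_def by (auto simp flip: foldr_append simp del: foldr_append)

lemma smooth_partial: "smooth d f \<Longrightarrow> i < d \<Longrightarrow> smooth d (partial i f)"
  using smooth_foldr_partial[of d f "[i]"] by simp

lemma smooth_has_partial:
  assumes "smooth d f" "i < d" "x \<in> topspace (Rd d)"
  shows "((\<lambda>t. f (x(i := t))) has_real_derivative partial i f (x(i := t))) (at t)"
proof -
  have "(\<lambda>s. foldr partial [] f ((x(i := t))(i := s))) differentiable (at ((x(i := t)) i))"
    using assms upd_in_topspace[OF assms(3,2)] unfolding smooth_def by (metis empty_set empty_subsetI)
  then show ?thesis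
    by (simp add: partial_def DERIV_deriv_iff_real_differentiable)
qed

text \<open>A set of continuous functions closed under partial derivatives contains only smooth
  ones. The derivative in \<open>S\<close> has to be right on \<open>topspace (Rd d)\<close> only:
  by \<open>partial_cong\<close>, differentiation never looks at other points, so the iterated
  \<open>partial\<close> may differ from members of \<open>S\<close> there.\<close>

lemma smooth_coinduct:
  assumes "f \<in> S"
    and cont: "\<And>g. g \<in> S \<Longrightarrow> continuous_map (Rd d) euclideanreal g"
    and deriv: "\<And>g i. g \<in> S \<Longrightarrow> i < d \<Longrightarrow> \<exists>g'\<in>S. \<forall>x\<in>topspace (Rd d).
      ((\<lambda>t. g (x(i := t))) has_real_derivative g' x) (at (x i))"
  shows "smooth d f"
proof -
  have *: "\<exists>g\<in>S. \<forall>x\<in>topspace (Rd d). foldr partial is f x = g x" if "set is \<subseteq> {..<d}" for "is"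
    using that
  proof (induction "is")
    case Nil
    then show ?case using assms(1) by auto
  next
    case (Cons i "is")
    then obtain g where g: "g \<in> S" "\<And>x. x \<in> topspace (Rd d) \<Longrightarrow> foldr partial is f x = g x"
      by auto
    obtain g' where g': "g' \<in> S"
      "\<And>x. x \<in> topspace (Rd d) \<Longrightarrow> ((\<lambda>t. g (x(i := t))) has_real_derivative g' x) (at (x i))"
      using deriv[OF g(1), of i] Cons.prems by auto
    have "partial i (foldr partial is f) x = g' x" if "x \<in> topspace (Rd d)" for x
      using partial_cong[of d "foldr partial is f" g i x] g(2) g'(2) that Cons.prems
      by (auto simp: partial_def DERIV_imp_deriv)
    then show ?case using g' by auto
  qed
  show ?thesis
    unfolding smooth_def
  proof (intro allI impI conjI ballI)
    fix "is" assume "set is \<subseteq> {..<d}"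
    then obtain g where g: "g \<in> S" "\<And>x. x \<in> topspace (Rd d) \<Longrightarrow> foldr partial is f x = g x"
      using * by blast
    show "continuous_map (Rd d) euclideanreal (foldr partial is f)"
      using cont[OF g(1)] by (rule continuous_map_eq) (simp add: g)
    fix i x assume i: "i < d" and x: "x \<in> topspace (Rd d)"
    have "(\<lambda>t. foldr partial is f (x(i := t))) = (\<lambda>t. g (x(i := t)))"
      using g(2) upd_in_topspace[OF x i] by auto
    then show "(\<lambda>t. foldr partial is f (x(i := t))) differentiable (at (x i))"
      using deriv[OF g(1) i] x by (auto simp: real_differentiable_def)
  qed
qed

lemma smooth_lincomb:
  assumes "smooth d f" "smooth d g"
  shows "smooth d (\<lambda>x. a * f x + b * g x)"
proof (rule smooth_coinduct[where S = "{\<lambda>x. a * f x + b * g x |f g. smooth d f \<and> smooth d g}"])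
  show "continuous_map (Rd d) euclideanreal h"
    if "h \<in> {\<lambda>x. a * f x + b * g x |f g. smooth d f \<and> smooth d g}" for h
    using that smooth_continuous[of d _ "[]"]
    by (auto intro!: continuous_map_add continuous_map_real_mult_left)
next
  fix h i assume "h \<in> {\<lambda>x. a * f x + b * g x |f g. smooth d f \<and> smooth d g}" "i < d"
  then obtain f g where fg: "smooth d f" "smooth d g" "h = (\<lambda>x. a * f x + b * g x)" by blast
  have D: "((\<lambda>t. h (x(i := t))) has_real_derivative a * partial i f x + b * partial i g x) (at (x i))"
    if x: "x \<in> topspace (Rd d)" for x
    using smooth_has_partial[OF fg(1) \<open>i < d\<close> x, of "x i"] smooth_has_partial[OF fg(2) \<open>i < d\<close> x, of "x i"]
    unfolding fg(3) by (auto intro!: derivative_eq_intros)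
  have "(\<lambda>x. a * partial i f x + b * partial i g x)
      \<in> {\<lambda>x. a * f x + b * g x |f g. smooth d f \<and> smooth d g}"
    using smooth_partial[OF fg(1) \<open>i < d\<close>] smooth_partial[OF fg(2) \<open>i < d\<close>] by blast
  then show "\<exists>g'\<in>{\<lambda>x. a * f x + b * g x |f g. smooth d f \<and> smooth d g}. \<forall>x\<in>topspace (Rd d).
      ((\<lambda>t. h (x(i := t))) has_real_derivative g' x) (at (x i))"
    by (rule bexI[rotated]) (rule ballI, rule D)
qed (use assms in blast)

lemma partial_lincomb:
  assumes "smooth d f" "smooth d g" "i < d" "x \<in> topspace (Rd d)"
  shows "partial i (\<lambda>x. a * f x + b * g x) x = a * partial i f x + b * partial i g x"
proof -
  have "((\<lambda>t. a * f (x(i := t)) + b * g (x(i := t))) has_real_derivative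
      a * partial i f x + b * partial i g x) (at (x i))"
    using smooth_has_partial[OF assms(1,3,4), of "x i"] smooth_has_partial[OF assms(2,3,4), of "x i"]
    by (auto intro!: derivative_eq_intros)
  then show ?thesis
    unfolding partial_def[of i "\<lambda>x. a * f x + b * g x"] by (rule DERIV_imp_deriv)
qed

lemma foldr_partial_lincomb:
  assumes "smooth d f" "smooth d g" "set is \<subseteq> {..<d}" "x \<in> topspace (Rd d)"
  shows "foldr partial is (\<lambda>x. a * f x + b * g x) x = a * foldr partial is f x + b * foldr partial is g x"
  using assms(3,4)
proof (induction "is" arbitrary: x)
  case (Cons i "is")
  then have "partial i (foldr partial is (\<lambda>x. a * f x + b * g x)) x =
      partial i (\<lambda>x. a * foldr partial is f x + b * foldr partial is g x) x"
    by (intro partial_cong[of d]) auto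
  also have "\<dots> = a * partial i (foldr partial is f) x + b * partial i (foldr partial is g) x"
    using Cons.prems assms(1,2) by (intro partial_lincomb[of d]) (auto intro: smooth_foldr_partial)
  finally show ?case by simp
qed simp

lemma smooth_zero: "smooth d (\<lambda>_. 0)"
  by (rule smooth_coinduct[where S = "{\<lambda>_. 0}"]) auto

lemma foldr_partial_zero:
  "set is \<subseteq> {..<d} \<Longrightarrow> x \<in> topspace (Rd d) \<Longrightarrow> foldr partial is (\<lambda>_. 0) x = 0"
  using foldr_partial_lincomb[OF smooth_zero smooth_zero, of "is" d x 0 0] by simp

lemma smooth_sum_and_foldr:
  assumes "\<And>j. j \<in> S \<Longrightarrow> smooth d (f j)"
  shows "smooth d (\<lambda>x. \<Sum>j\<in>S. f j x) \<and> (\<forall>is x. set is \<subseteq> {..<d} \<longrightarrow> x \<in> topspace (Rd d) \<longrightarrow>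
    foldr partial is (\<lambda>x. \<Sum>j\<in>S. f j x) x = (\<Sum>j\<in>S. foldr partial is (f j) x))"
  using assms
proof (induction S rule: infinite_finite_induct)
  case (insert j S)
  then show ?case
    using smooth_lincomb[of d "f j" "\<lambda>x. \<Sum>j\<in>S. f j x" 1 1]
      foldr_partial_lincomb[of d "f j" "\<lambda>x. \<Sum>j\<in>S. f j x" _ _ 1 1]
    by auto
qed (auto simp: smooth_zero foldr_partial_zero)

lemmas foldr_partial_sum = smooth_sum_and_foldr[THEN conjunct2, rule_format]

section \<open>Symmetry of higher derivatives\<close>

lemma mixed_partials_eq:
  fixes g :: "real \<Rightarrow> real \<Rightarrow> real"
  assumes d1: "\<And>s t. ((\<lambda>s. g s t) has_real_derivative g1 s t) (at s)"
    and d2: "\<And>s t. ((\<lambda>t. g s t) has_real_derivative g2 s t) (at t)"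
    and d12: "\<And>s t. ((\<lambda>t. g1 s t) has_real_derivative g12 s t) (at t)"
    and d21: "\<And>s t. ((\<lambda>s. g2 s t) has_real_derivative g21 s t) (at s)"
    and c12: "isCont (\<lambda>p. g12 (fst p) (snd p)) (a, b)"
    and c21: "isCont (\<lambda>p. g21 (fst p) (snd p)) (a, b)"
  shows "g12 a b = g21 a b"
proof (rule ccontr)
  assume "g12 a b \<noteq> g21 a b"
  define e where "e = \<bar>g12 a b - g21 a b\<bar> / 2"
  have "e > 0" using \<open>g12 a b \<noteq> g21 a b\<close> by (simp add: e_def)
  obtain r1 where r1: "r1 > 0"
    "\<And>s t. dist (s, t) (a, b) < r1 \<Longrightarrow> \<bar>g12 s t - g12 a b\<bar> < e"
    using c12 \<open>e > 0\<close> unfolding continuous_at_eps_delta by (force simp: dist_real_def)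
  obtain r2 where r2: "r2 > 0"
    "\<And>s t. dist (s, t) (a, b) < r2 \<Longrightarrow> \<bar>g21 s t - g21 a b\<bar> < e"
    using c21 \<open>e > 0\<close> unfolding continuous_at_eps_delta by (force simp: dist_real_def)
  define h where "h = min r1 r2 / 2"
  have h: "h > 0" "2 * h \<le> r1" "2 * h \<le> r2" using r1(1) r2(1) by (auto simp: h_def)
  have near: "dist (s, t) (a, b) < 2 * h" if "a < s" "s < a + h" "b < t" "t < b + h" for s t
  proof -
    have "dist (s, t) (a, b) \<le> \<bar>s - a\<bar> + \<bar>t - b\<bar>"
      unfolding dist_Pair_Pair dist_real_def by (rule sqrt_sum_squares_le_sum_abs[THEN order_trans]) simp
    then show ?thesis using that by linarith
  qed
  \<comment> \<open>The double difference over a square of side \<open>h\<close>. Grouped along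
    either axis, two uses of the mean value theorem turn it into \<open>h\<^sup>2\<close> times a
    value of \<open>g12\<close>, respectively \<open>g21\<close>, inside the square. The common
    value is then within \<open>e\<close> of both limits, which are \<open>2 * e\<close>
    apart.\<close>
  define D where "D = g (a + h) (b + h) - g (a + h) b - g a (b + h) + g a b"
  have "\<exists>s. a < s \<and> s < a + h \<and>
      (g (a + h) (b + h) - g (a + h) b) - (g a (b + h) - g a b) = (a + h - a) * (g1 s (b + h) - g1 s b)"
    using h(1) by (intro MVT2) (auto intro!: DERIV_diff d1)
  then obtain s where s: "a < s" "s < a + h" "D = h * (g1 s (b + h) - g1 s b)"
    by (auto simp: D_def)
  have "\<exists>t. b < t \<and> t < b + h \<and> g1 s (b + h) - g1 s b = (b + h - b) * g12 s t"
    using h(1) by (intro MVT2) (auto intro!: d12)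
  then obtain t where t: "b < t" "t < b + h" "D = h * (h * g12 s t)"
    using s by auto
  have "\<exists>t. b < t \<and> t < b + h \<and>
      (g (a + h) (b + h) - g a (b + h)) - (g (a + h) b - g a b) = (b + h - b) * (g2 (a + h) t - g2 a t)"
    using h(1) by (intro MVT2) (auto intro!: DERIV_diff d2)
  then obtain t' where t': "b < t'" "t' < b + h" "D = h * (g2 (a + h) t' - g2 a t')"
    by (auto simp: D_def algebra_simps)
  have "\<exists>s. a < s \<and> s < a + h \<and> g2 (a + h) t' - g2 a t' = (a + h - a) * g21 s t'"
    using h(1) by (intro MVT2) (auto intro!: d21)
  then obtain s' where s': "a < s'" "s' < a + h" "D = h * (h * g21 s' t')"
    using t' by auto
  have "g12 s t = g21 s' t'" using t(3) s'(3) h(1) by simp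
  moreover have "\<bar>g12 s t - g12 a b\<bar> < e"
    using near[OF s(1,2) t(1,2)] h by (intro r1(2)) linarith
  moreover have "\<bar>g21 s' t' - g21 a b\<bar> < e"
    using near[OF s'(1,2) t'(1,2)] h by (intro r2(2)) linarith
  moreover have "\<bar>g12 a b - g21 a b\<bar> \<le> \<bar>z - g12 a b\<bar> + \<bar>z - g21 a b\<bar>" for z
    by linarith
  ultimately show False unfolding e_def by (smt (verit) field_sum_of_halves)
qed

lemma partial_commute:
  assumes f: "smooth d f" and i: "i < d" and j: "j < d" and x: "x \<in> topspace (Rd d)"
  shows "partial i (partial j f) x = partial j (partial i f) x"
proof (cases "i = j")
  case False
  define X where "X s t = x(i := s, j := t)" for s t
  have X: "X s t \<in> topspace (Rd d)" for s t
    unfolding X_def by (intro upd_in_topspace i j x)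
  have upd: "(X s t)(i := s') = X s' t" "(X s t)(j := t') = X s t'" for s t s' t'
    using False by (auto simp: X_def)
  have Xmap: "continuous_map (prod_topology euclideanreal euclideanreal) (Rd d) (\<lambda>p. X (fst p) (snd p))"
    unfolding Rd_def continuous_map_componentwise
  proof (intro conjI ballI)
    show "(\<lambda>p. X (fst p) (snd p)) ` topspace (prod_topology euclideanreal euclideanreal) \<subseteq> extensional {..<d}"
      using X by (auto simp: topspace_Rd PiE_def)
    fix k
    show "continuous_map (prod_topology euclideanreal euclideanreal) euclideanreal (\<lambda>p. X (fst p) (snd p) k)"
      by (cases "k = j"; cases "k = i") (auto simp: X_def intro: continuous_intros)
  qed
  have cont: "isCont (\<lambda>p. F (X (fst p) (snd p))) q" if "continuous_map (Rd d) euclideanreal F" for F :: fn and q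
    using continuous_map_compose[OF Xmap that] by (cases q) (simp add: o_def continuous_on_eq_continuous_at)
  have D: "((\<lambda>s. F (X s t)) has_real_derivative partial i F (X s t)) (at s)"
    "((\<lambda>t. F (X s t)) has_real_derivative partial j F (X s t)) (at t)" if "smooth d F" for F s t
    using smooth_has_partial[OF that i X[of s t], of s] smooth_has_partial[OF that j X[of s t], of t]
    by (simp_all add: upd)
  have "partial j (partial i f) (X (x i) (x j)) = partial i (partial j f) (X (x i) (x j))"
    by (rule mixed_partials_eq[where g = "\<lambda>s t. f (X s t)"
          and ?g1.0 = "\<lambda>s t. partial i f (X s t)" and ?g2.0 = "\<lambda>s t. partial j f (X s t)"])
       (use i j f smooth_continuous[OF f, of "[i, j]"] smooth_continuous[OF f, of "[j, i]"]
         in \<open>auto intro!: D cont smooth_partial\<close>)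
  then show ?thesis by (simp add: X_def)
qed simp

lemma foldr_partial_commute:
  assumes f: "smooth d f" and "i < d" "set is \<subseteq> {..<d}" "x \<in> topspace (Rd d)"
  shows "foldr partial is (partial i f) x = partial i (foldr partial is f) x"
  using assms(3,4)
proof (induction "is" arbitrary: x)
  case (Cons j "is")
  then have "partial j (foldr partial is (partial i f)) x = partial j (partial i (foldr partial is f)) x"
    by (intro partial_cong[of d]) auto
  also have "\<dots> = partial i (partial j (foldr partial is f)) x"
    using Cons.prems \<open>i < d\<close> by (intro partial_commute[of d] smooth_foldr_partial f) auto
  finally show ?case by simp
qed simp

text \<open>Links arbitrary lists of directions to the sorted ones over which
  \<open>sobolev_norm\<close> sums. Insertion sort performs only adjacent swaps, each justified by
  \<open>partial_commute\<close>.\<close>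

lemma foldr_partial_sort:
  assumes f: "smooth d f" and "set is \<subseteq> {..<d}" "x \<in> topspace (Rd d)"
  shows "foldr partial (sort is) f x = foldr partial is f x"
  using assms(2,3)
proof (induction "is" arbitrary: x)
  case (Cons i "is")
  have insort: "foldr partial (insort i js) f x = partial i (foldr partial js f) x"
    if "set js \<subseteq> {..<d}" "x \<in> topspace (Rd d)" for js x
    using that
  proof (induction js arbitrary: x)
    case (Cons j js)
    show ?case
    proof (cases "i \<le> j")
      case False
      have "partial j (foldr partial (insort i js) f) x = partial j (partial i (foldr partial js f)) x"
        using Cons by (intro partial_cong[of d]) auto
      also have "\<dots> = partial i (partial j (foldr partial js f)) x"
        using Cons.prems \<open>set (i # is) \<subseteq> {..<d}\<close>
        by (intro partial_commute[of d] smooth_foldr_partial f) auto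
      finally show ?thesis using False by simp
    qed simp
  qed simp
  have "foldr partial (insort i (sort is)) f x = partial i (foldr partial (sort is) f) x"
    using Cons.prems by (intro insort) auto
  also have "\<dots> = partial i (foldr partial is f) x"
    using Cons by (intro partial_cong[of d]) auto
  finally show ?case by simp
qed simp

section \<open>Integration by parts and the Poincare inequality for one variable\<close>

context domain
begin

text \<open>Integrability and the vanishing of boundary terms depend on continuity and support
  alone. This class is stable under multiplication by coordinates, which the Poincare inequality
  requires.\<close>

definition Cc :: "fn set" where
  "Cc = {f. continuous_map (Rd d) euclideanreal f \<and>
     (\<exists>K. compactin (Rd d) K \<and> K \<subseteq> \<Omega> \<and> (\<forall>x \<in> topspace (Rd d) - K. f x = 0))}"

lemma Cc_zero: "f \<in> Cc \<Longrightarrow> x \<in> topspace (Rd d) \<Longrightarrow> x \<notin> \<Omega> \<Longrightarrow> f x = 0"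
  unfolding Cc_def by blast

lemma Cc_mult: "f \<in> Cc \<Longrightarrow> continuous_map (Rd d) euclideanreal g \<Longrightarrow> (\<lambda>x. g x * f x) \<in> Cc"
  unfolding Cc_def by (fastforce intro: continuous_map_real_mult)

lemma Cc_add:
  assumes "f \<in> Cc" "g \<in> Cc"
  shows "(\<lambda>x. f x + g x) \<in> Cc"
proof -
  obtain K K' where "compactin (Rd d) K" "K \<subseteq> \<Omega>" "\<forall>x \<in> topspace (Rd d) - K. f x = 0"
    "compactin (Rd d) K'" "K' \<subseteq> \<Omega>" "\<forall>x \<in> topspace (Rd d) - K'. g x = 0"
    using assms unfolding Cc_def by blast
  then have "compactin (Rd d) (K \<union> K') \<and> K \<union> K' \<subseteq> \<Omega> \<and>
      (\<forall>x \<in> topspace (Rd d) - (K \<union> K'). f x + g x = 0)"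
    by (auto intro: compactin_Un)
  with assms show ?thesis unfolding Cc_def by (auto intro: continuous_map_add)
qed

lemma Cc_bounded:
  assumes "f \<in> Cc"
  obtains B where "\<And>x. x \<in> topspace (Rd d) \<Longrightarrow> \<bar>f x\<bar> \<le> B"
proof -
  obtain K where K: "compactin (Rd d) K" "K \<subseteq> \<Omega>" "\<And>x. x \<in> topspace (Rd d) - K \<Longrightarrow> f x = 0"
    and f: "continuous_map (Rd d) euclideanreal f"
    using assms unfolding Cc_def by blast
  have "compact (f ` K)"
    using image_compactin[OF K(1) f] by simp
  then have "bounded (f ` K)" by (rule compact_imp_bounded)
  then obtain B where B: "\<And>x. x \<in> K \<Longrightarrow> \<bar>f x\<bar> \<le> B"
    unfolding bounded_iff by auto
  have "\<bar>f x\<bar> \<le> max 0 B" if "x \<in> topspace (Rd d)" for x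
    using that K(3)[of x] B[of x] by (cases "x \<in> K") auto
  then show ?thesis by (rule that)
qed

lemma Cc_measurable: "f \<in> Cc \<Longrightarrow> f \<in> borel_measurable (leb d)"
  by (simp add: Cc_def continuous_map_Rd_measurable)

lemma Cc_integrable:
  assumes "f \<in> Cc"
  shows "integrable (leb d) f"
proof -
  obtain B where "\<And>x. x \<in> topspace (Rd d) \<Longrightarrow> \<bar>f x\<bar> \<le> B"
    using Cc_bounded[OF assms] by blast
  then show ?thesis
    using Cc_zero[OF assms] emeasure_dom Cc_measurable[OF assms]
    by (intro integrableI_bounded_set[OF dom_sets, where B = B]) (auto simp: space_leb)
qed

lemma Cc_indicator: "f \<in> Cc \<Longrightarrow> x \<in> space (leb d) \<Longrightarrow> indicator \<Omega> x * f x = f x"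
  using Cc_zero[of f x] by (auto simp: space_leb indicator_def)

lemma integral_Cc: "f \<in> Cc \<Longrightarrow> (\<integral>x. f x \<partial>leb_on d \<Omega>) = (\<integral>x. f x \<partial>leb d)"
  unfolding integral_leb_on by (rule Bochner_Integration.integral_cong) (simp_all add: Cc_indicator)

lemma integrable_Cc_leb_on: "f \<in> Cc \<Longrightarrow> integrable (leb_on d \<Omega>) f"
  unfolding integrable_leb_on
  by (subst Bochner_Integration.integrable_cong[OF refl Cc_indicator]) (auto intro: Cc_integrable)

lemma Cc_L2:
  assumes "f \<in> Cc"
  shows "f \<in> L2 d \<Omega>"
proof -
  have "(\<lambda>x. f x * f x) \<in> Cc"
    using assms by (intro Cc_mult) (auto simp: Cc_def)
  then show ?thesis
    using integrable_Cc_leb_on Cc_measurable[OF assms]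
    by (auto simp: L2_def power2_eq_square intro: measurable_leb_on)
qed

text \<open>By Fubini it suffices to integrate along lines in direction \<open>i\<close>, where the
  fundamental theorem leaves values of \<open>F\<close> outside the bounded domain.\<close>

lemma integral_derivative_zero:
  assumes F: "F \<in> Cc" and F': "F' \<in> Cc" and i: "i < d"
    and deriv: "\<And>x t. x \<in> topspace (Rd d) \<Longrightarrow>
      ((\<lambda>t. F (x(i := t))) has_real_derivative F' (x(i := t))) (at t)"
  shows "(\<integral>x. F' x \<partial>leb_on d \<Omega>) = 0"
proof -
  interpret product_sigma_finite "\<lambda>_::nat. lborel :: real measure" ..
  define I where "I = {..<d} - {i}"
  have I: "insert i I = {..<d}" "finite I" "i \<notin> I" using i by (auto simp: I_def)
  have inner: "(\<integral>t. F' (x(i := t)) \<partial>lborel) = 0" if "x \<in> space (Pi\<^sub>M I (\<lambda>_. lborel :: real measure))" for x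
  proof -
    have x: "x(i := t) \<in> topspace (Rd d)" for t
    proof -
      have "x \<in> extensional I" using that by (simp add: space_PiM PiE_def)
      then show ?thesis
        using I(1) by (auto simp: topspace_Rd PiE_def extensional_def)
    qed
    have out: "F (x(i := t)) = 0" "F' (x(i := t)) = 0" if "R < \<bar>t\<bar>" for t
    proof -
      have "x(i := t) \<notin> \<Omega>" using dom_bounded[of "x(i := t)" i] i that by auto
      then show "F (x(i := t)) = 0" "F' (x(i := t)) = 0"
        using Cc_zero F F' x by blast+
    qed
    \<comment> \<open>The hypothesis speaks of full points, while \<open>x\<close> lacks coordinate
      \<open>i\<close>; the filler 0 is overwritten at once.\<close>
    have D: "((\<lambda>t. F (x(i := t))) has_real_derivative F' (x(i := t))) (at t)" for t
      using deriv[OF x[of 0], of t] by simp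
    have "continuous_on UNIV (\<lambda>t. F' ((x(i := 0))(i := t)))"
      by (rule continuous_on_line[OF _ x[of 0] i]) (use F' in \<open>simp add: Cc_def\<close>)
    then have cont: "isCont (\<lambda>t. F' (x(i := t))) t" for t
      by (simp add: continuous_on_eq_continuous_at)
    have "(\<integral>t. F' (x(i := t)) \<partial>lborel) = (\<integral>t. F' (x(i := t)) * indicator {-(R+1)..R+1} t \<partial>lborel)"
    proof (rule Bochner_Integration.integral_cong)
      show "F' (x(i := t)) = F' (x(i := t)) * indicator {-(R+1)..R+1} t" for t
        using out(2)[of t] by (cases "R < \<bar>t\<bar>") (auto simp: indicator_def)
    qed simp
    \<comment> \<open>The endpoints have modulus above \<open>R\<close>, so both points lie outside
      the domain and \<open>F\<close> vanishes there.\<close>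
    also have "\<dots> = F (x(i := R + 1)) - F (x(i := -(R + 1)))"
      using R_pos by (intro integral_FTC_Icc_real D cont) auto
    also have "\<dots> = 0" using out(1) R_pos by simp
    finally show ?thesis .
  qed
  have "(\<integral>x. F' x \<partial>leb_on d \<Omega>) = integral\<^sup>L (Pi\<^sub>M (insert i I) (\<lambda>_. lborel)) F'"
    using integral_Cc[OF F'] I(1) by simp
  also have "\<dots> = (\<integral>x. (\<integral>t. F' (x(i := t)) \<partial>lborel) \<partial>Pi\<^sub>M I (\<lambda>_. lborel))"
    using I Cc_integrable[OF F'] by (intro product_integral_insert) auto
  also have "\<dots> = 0"
    by (simp add: inner cong: Bochner_Integration.integral_cong)
  finally show ?thesis .
qed

section \<open>Test functions and integration by parts\<close>

lemma test_Cc: "\<eta> \<in> test_functions d \<Omega> \<Longrightarrow> \<eta> \<in> Cc"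
  using smooth_continuous[of d \<eta> "[]"] by (auto simp: test_functions_def Cc_def)

lemmas test_L2 = test_Cc[THEN Cc_L2]

lemma test_smooth: "\<eta> \<in> test_functions d \<Omega> \<Longrightarrow> smooth d \<eta>"
  by (simp add: test_functions_def)

text \<open>The same compact set supports the derivative: its complement is open, so off
  \<open>K\<close> the function vanishes on an interval of the coordinate line through the
  point.\<close>

lemma test_partial:
  assumes \<eta>: "\<eta> \<in> test_functions d \<Omega>" and i: "i < d"
  shows "partial i \<eta> \<in> test_functions d \<Omega>"
proof -
  obtain K where K: "compactin (Rd d) K" "K \<subseteq> \<Omega>" "\<And>x. x \<in> topspace (Rd d) - K \<Longrightarrow> \<eta> x = 0"
    using \<eta> unfolding test_functions_def by blast
  have op: "openin (Rd d) (topspace (Rd d) - K)"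
    using compactin_imp_closedin[OF Hausdorff_Rd K(1)] by blast
  have "partial i \<eta> x = 0" if x: "x \<in> topspace (Rd d) - K" for x
  proof -
    have x': "x \<in> topspace (Rd d)" using x by simp
    have "openin euclideanreal {t \<in> topspace euclideanreal. x(i := t) \<in> topspace (Rd d) - K}"
      using continuous_map_upd[OF x' i] op by (rule openin_continuous_map_preimage)
    then have "open {t. x(i := t) \<in> topspace (Rd d) - K}" by simp
    moreover have "x i \<in> {t. x(i := t) \<in> topspace (Rd d) - K}" using x by simp
    ultimately have "\<forall>\<^sub>F t in nhds (x i). x(i := t) \<in> topspace (Rd d) - K"
      unfolding eventually_nhds by blast
    then have "\<forall>\<^sub>F t in nhds (x i). \<eta> (x(i := t)) = 0"
      by (rule eventually_mono) (rule K)
    then have "deriv (\<lambda>t. \<eta> (x(i := t))) (x i) = deriv (\<lambda>t. 0) (x i)"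
      by (rule deriv_cong_ev) simp
    then show ?thesis by (simp add: partial_def)
  qed
  then show ?thesis
    using K smooth_partial[OF test_smooth[OF \<eta>] i] unfolding test_functions_def by blast
qed

lemma test_foldr_partial:
  "\<eta> \<in> test_functions d \<Omega> \<Longrightarrow> set is \<subseteq> {..<d} \<Longrightarrow> foldr partial is \<eta> \<in> test_functions d \<Omega>"
  by (induction "is") (auto intro: test_partial)

lemma test_lincomb:
  assumes "f \<in> test_functions d \<Omega>" "g \<in> test_functions d \<Omega>"
  shows "(\<lambda>x. a * f x + b * g x) \<in> test_functions d \<Omega>"
proof -
  obtain K K' where "compactin (Rd d) K" "K \<subseteq> \<Omega>" "\<forall>x \<in> topspace (Rd d) - K. f x = 0"
    "compactin (Rd d) K'" "K' \<subseteq> \<Omega>" "\<forall>x \<in> topspace (Rd d) - K'. g x = 0"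
    using assms unfolding test_functions_def by blast
  then have "compactin (Rd d) (K \<union> K') \<and> K \<union> K' \<subseteq> \<Omega> \<and>
      (\<forall>x \<in> topspace (Rd d) - (K \<union> K'). a * f x + b * g x = 0)"
    by (auto intro: compactin_Un)
  with assms show ?thesis unfolding test_functions_def by (auto intro: smooth_lincomb)
qed

lemma test_zero: "(\<lambda>_. 0) \<in> test_functions d \<Omega>"
  by (auto simp: test_functions_def smooth_zero intro!: exI[of _ "{}"])

lemma test_sum: "(\<And>j. j \<in> S \<Longrightarrow> f j \<in> test_functions d \<Omega>) \<Longrightarrow> (\<lambda>x. \<Sum>j\<in>S. f j x) \<in> test_functions d \<Omega>"
proof (induction S rule: infinite_finite_induct)
  case (insert j S)
  then show ?case using test_lincomb[of "f j" "\<lambda>x. \<Sum>j\<in>S. f j x" 1 1] by simp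
qed (simp_all add: test_zero)

lemma parts:
  assumes u: "u \<in> test_functions d \<Omega>" and v: "v \<in> test_functions d \<Omega>" and i: "i < d"
  shows "pairing d \<Omega> (partial i u) v = - pairing d \<Omega> u (partial i v)"
proof -
  note uv = test_partial[OF u i] test_partial[OF v i] u v
  have Cc: "(\<lambda>x. f x * g x) \<in> Cc" if "f \<in> test_functions d \<Omega>" "g \<in> test_functions d \<Omega>" for f g
    using that test_Cc by (intro Cc_mult) (auto simp: Cc_def)
  have "(\<integral>x. partial i u x * v x + u x * partial i v x \<partial>leb_on d \<Omega>) = 0"
  proof (rule integral_derivative_zero[OF _ _ i])
    show "(\<lambda>x. u x * v x) \<in> Cc" "(\<lambda>x. partial i u x * v x + u x * partial i v x) \<in> Cc"
      using uv by (intro Cc Cc_add; simp)+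
    show "((\<lambda>t. u (x(i := t)) * v (x(i := t))) has_real_derivative
        partial i u (x(i := t)) * v (x(i := t)) + u (x(i := t)) * partial i v (x(i := t))) (at t)"
      if "x \<in> topspace (Rd d)" for x t
      using smooth_has_partial[OF test_smooth[OF u] i that, of t]
        smooth_has_partial[OF test_smooth[OF v] i that, of t]
      by (auto intro!: derivative_eq_intros)
  qed
  also have "(\<integral>x. partial i u x * v x + u x * partial i v x \<partial>leb_on d \<Omega>)
      = pairing d \<Omega> (partial i u) v + pairing d \<Omega> u (partial i v)"
    unfolding pairing_def
    by (rule Bochner_Integration.integral_add) (intro integrable_Cc_leb_on Cc uv)+
  finally show ?thesis by simp
qed

text \<open>Derivatives are moved across one at a time and arrive in the wrong order, with direction
  \<open>i\<close> applied first instead of last; \<open>foldr_partial_commute\<close> restores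
  it.\<close>

lemma parts_foldr:
  assumes "u \<in> test_functions d \<Omega>" "v \<in> test_functions d \<Omega>" "set is \<subseteq> {..<d}"
  shows "pairing d \<Omega> u (foldr partial is v) = (-1) ^ length is * pairing d \<Omega> (foldr partial is u) v"
  using assms
proof (induction "is" arbitrary: u)
  case (Cons i "is")
  have "pairing d \<Omega> u (partial i (foldr partial is v)) = - pairing d \<Omega> (partial i u) (foldr partial is v)"
    using Cons.prems parts[of u "foldr partial is v" i] by (simp add: test_foldr_partial)
  also have "\<dots> = - ((-1) ^ length is * pairing d \<Omega> (foldr partial is (partial i u)) v)"
    using Cons by (simp add: test_partial)
  also have "pairing d \<Omega> (foldr partial is (partial i u)) v = pairing d \<Omega> (partial i (foldr partial is u)) v"
    using Cons.prems dom_subset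
    by (intro pairing_cong foldr_partial_commute[of d]) (auto simp: test_smooth)
  finally show ?case by simp
qed simp

text \<open>The derivative of \<open>x i * (\<eta> x)\<^sup>2\<close> in direction \<open>i\<close>
  has integral zero, so the square of the norm of \<eta> is -2 times the pairing of
  \<open>x i * \<eta> x\<close> with the derivative. The coordinate is at most \<open>R\<close> in
  modulus, whence \<open>2 * R\<close> after cancelling one norm of \<eta>.\<close>

lemma Poincare_partial:
  assumes \<eta>: "\<eta> \<in> test_functions d \<Omega>" and i: "i < d"
  shows "L2_norm d \<Omega> \<eta> \<le> 2 * R * L2_norm d \<Omega> (partial i \<eta>)"
proof -
  let ?\<eta>' = "partial i \<eta>"
  have Cc: "(\<lambda>x. f x * g x) \<in> Cc" if "f \<in> test_functions d \<Omega>" "g \<in> test_functions d \<Omega>" for f g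
    using that test_Cc by (intro Cc_mult) (auto simp: Cc_def)
  note \<eta>' = test_partial[OF \<eta> i]
  have Cc1: "(\<lambda>x. x i * (\<eta> x * ?\<eta>' x)) \<in> Cc"
    using \<eta> \<eta>' i by (intro Cc_mult Cc continuous_map_coord)
  have 0: "(\<integral>x. \<eta> x * \<eta> x + (x i * (\<eta> x * ?\<eta>' x) + x i * (\<eta> x * ?\<eta>' x)) \<partial>leb_on d \<Omega>) = 0"
  proof (rule integral_derivative_zero[OF _ _ i])
    show "(\<lambda>x. x i * (\<eta> x * \<eta> x)) \<in> Cc"
      using \<eta> i by (intro Cc_mult Cc continuous_map_coord)
    show "(\<lambda>x. \<eta> x * \<eta> x + (x i * (\<eta> x * ?\<eta>' x) + x i * (\<eta> x * ?\<eta>' x))) \<in> Cc"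
      using \<eta> by (intro Cc_add Cc Cc1)
    show "((\<lambda>t. (x(i := t)) i * (\<eta> (x(i := t)) * \<eta> (x(i := t)))) has_real_derivative
        \<eta> (x(i := t)) * \<eta> (x(i := t)) + ((x(i := t)) i * (\<eta> (x(i := t)) * ?\<eta>' (x(i := t)))
          + (x(i := t)) i * (\<eta> (x(i := t)) * ?\<eta>' (x(i := t))))) (at t)"
      if "x \<in> topspace (Rd d)" for x t
      using smooth_has_partial[OF test_smooth[OF \<eta>] i that, of t]
      by (auto intro!: derivative_eq_intros simp: algebra_simps)
  qed
  define w where "w = (\<lambda>x. x i * \<eta> x)"
  define a where "a = L2_norm d \<Omega> \<eta>"
  define b where "b = L2_norm d \<Omega> ?\<eta>'"
  have w: "w \<in> L2 d \<Omega>"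
    unfolding w_def by (intro Cc_L2 Cc_mult test_Cc \<eta> continuous_map_coord i)
  have ab: "0 \<le> a" "0 \<le> b" by (simp_all add: a_def b_def L2_norm_nonneg)
  have "a\<^sup>2 = pairing d \<Omega> \<eta> \<eta>"
    by (simp add: a_def L2_norm_power2)
  also have "\<dots> = - 2 * (\<integral>x. x i * (\<eta> x * ?\<eta>' x) \<partial>leb_on d \<Omega>)"
    using 0 integrable_Cc_leb_on[OF Cc[OF \<eta> \<eta>]] integrable_Cc_leb_on[OF Cc1]
    by (simp add: pairing_def)
  also have "\<dots> = - 2 * pairing d \<Omega> w ?\<eta>'"
    by (simp add: pairing_def w_def mult.assoc)
  also have "\<dots> \<le> 2 * (L2_norm d \<Omega> w * b)"
    using pairing_le_norms[OF w test_L2[OF \<eta>']] unfolding b_def by linarith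
  finally have 1: "a\<^sup>2 \<le> 2 * (L2_norm d \<Omega> w * b)" .
  have "L2_norm d \<Omega> w \<le> L2_norm d \<Omega> (\<lambda>x. R * \<eta> x)"
    unfolding L2_norm_def pairing_def
  proof (rule real_sqrt_le_mono, rule integral_mono)
    show "w x * w x \<le> R * \<eta> x * (R * \<eta> x)" if "x \<in> space (leb_on d \<Omega>)" for x
    proof -
      have "x \<in> \<Omega>" using that by (simp add: space_leb_on)
      then have "\<bar>w x\<bar> \<le> \<bar>R * \<eta> x\<bar>"
        using dom_bounded[OF _ i, of x] R_pos by (auto simp: w_def abs_mult intro: mult_right_mono)
      then show ?thesis unfolding abs_le_square_iff by (simp add: power2_eq_square)
    qed
    show "integrable (leb_on d \<Omega>) (\<lambda>x. w x * w x)"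
      "integrable (leb_on d \<Omega>) (\<lambda>x. R * \<eta> x * (R * \<eta> x))"
      using w test_L2[OF \<eta>] by (intro L2_mult_integrable L2.scale_in; simp)+
  qed
  also have "\<dots> = R * a"
    using R_pos test_L2[OF \<eta>] by (simp add: L2_norm_scale a_def)
  finally have "L2_norm d \<Omega> w * b \<le> R * a * b"
    using ab by (intro mult_right_mono)
  with 1 have "a * a \<le> (2 * R * b) * a"
    by (simp add: power2_eq_square algebra_simps)
  then show ?thesis
    using ab R_pos unfolding a_def[symmetric] b_def[symmetric] by (cases "a = 0") auto
qed

end

section \<open>Test functions detect almost everywhere vanishing\<close>

text \<open>The classical flat function exp(-1/t), with a polynomial in 1/t as a factor to make the
  family closed under differentiation: \<open>p\<close> becomes X^2 (p - p').\<close>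

definition flat :: "real poly \<Rightarrow> real \<Rightarrow> real" where
  "flat p t = (if 0 < t then poly p (inverse t) * exp (- inverse t) else 0)"

lemma poly_exp_tendsto_0: "((\<lambda>y::real. poly p y * exp (- y)) \<longlongrightarrow> 0) at_top"
proof -
  have "((\<lambda>y::real. \<Sum>i\<le>degree p. coeff p i * (y ^ i / exp y)) \<longlongrightarrow> (\<Sum>i\<le>degree p. coeff p i * 0)) at_top"
    by (intro tendsto_sum tendsto_mult tendsto_const tendsto_power_div_exp_0)
  moreover have "(\<Sum>i\<le>degree p. coeff p i * (y ^ i / exp y)) = poly p y * exp (- y)" for y :: real
    by (simp add: poly_altdef sum_distrib_right exp_minus divide_inverse mult.assoc)
  ultimately show ?thesis by simp
qed

lemma flat_has_derivative:
  "(flat p has_real_derivative flat ([:0, 0, 1:] * (p - pderiv p)) t) (at t)"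
proof (cases "t = 0")
  case False
  show ?thesis
  proof (cases "0 < t")
    case True
    have "((\<lambda>t. poly p (inverse t) * exp (- inverse t)) has_real_derivative
        flat ([:0, 0, 1:] * (p - pderiv p)) t) (at t)"
      using True unfolding flat_def
      by (auto intro!: derivative_eq_intros DERIV_chain2[OF poly_DERIV]
          simp: power2_eq_square field_simps)
    then show ?thesis
      by (rule has_field_derivative_transform_within_open[where S = "{0<..}"])
         (use True in \<open>auto simp: flat_def\<close>)
  next
    case F: False
    have "((\<lambda>_. 0) has_real_derivative flat ([:0, 0, 1:] * (p - pderiv p)) t) (at t)"
      using F by (simp add: flat_def)
    then show ?thesis
      by (rule has_field_derivative_transform_within_open[where S = "{..<0}"])
         (use F False in \<open>auto simp: flat_def\<close>)
  qed
next
  case True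
  have "((\<lambda>h. flat p h / h) \<longlongrightarrow> 0) (at 0)"
  proof (rule filterlim_split_at)
    have "\<forall>\<^sub>F h in at_left 0. flat p h / h = (0::real)"
      unfolding eventually_at_filter by (auto simp: flat_def)
    then show "((\<lambda>h. flat p h / h) \<longlongrightarrow> 0) (at_left 0)"
      by (rule tendsto_eventually)
    \<comment> \<open>Dividing by \<open>h\<close> multiplies the polynomial in 1/h by its variable,
      which is \<open>pCons 0 p\<close>.\<close>
    have "((\<lambda>h. poly (pCons 0 p) (inverse h) * exp (- inverse h)) \<longlongrightarrow> 0) (at_right (0::real))"
      by (rule filterlim_compose[OF poly_exp_tendsto_0 filterlim_inverse_at_top_right])
    then show "((\<lambda>h. flat p h / h) \<longlongrightarrow> 0) (at_right 0)"
      by (rule Lim_transform_eventually)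
         (auto simp: eventually_at_filter flat_def divide_inverse mult_ac)
  qed
  then show ?thesis
    using True by (simp add: has_field_derivative_iff flat_def)
qed

text \<open>A syntactic class closed under derivatives, so that products of its members over the
  coordinates can serve as the set in \<open>smooth_coinduct\<close>.\<close>

inductive smooth1 :: "(real \<Rightarrow> real) \<Rightarrow> bool" where
  flat: "smooth1 (\<lambda>t. flat p (c * t + b))"
| mult: "smooth1 f \<Longrightarrow> smooth1 g \<Longrightarrow> smooth1 (\<lambda>t. f t * g t)"
| add: "smooth1 f \<Longrightarrow> smooth1 g \<Longrightarrow> smooth1 (\<lambda>t. f t + g t)"

lemma smooth1_derivative:
  assumes "smooth1 f"
  shows "\<exists>f'. smooth1 f' \<and> (\<forall>t. (f has_real_derivative f' t) (at t))"
  using assms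
proof induction
  case (flat p c b)
  define r where "r = [:0, 0, 1:] * (p - pderiv p)"
  \<comment> \<open>The inner derivative \<open>c\<close> is absorbed into the polynomial, which
    keeps the derivative of the required shape.\<close>
  have "((\<lambda>t. flat p (c * t + b)) has_real_derivative flat (smult c r) (c * t + b)) (at t)" for t
  proof -
    have "((\<lambda>t. c * t + b) has_real_derivative c) (at t)"
      by (auto intro!: derivative_eq_intros)
    from DERIV_chain2[OF flat_has_derivative this, of p]
    have "((\<lambda>t. flat p (c * t + b)) has_real_derivative flat r (c * t + b) * c) (at t)"
      by (simp add: r_def)
    moreover have "flat r (c * t + b) * c = flat (smult c r) (c * t + b)"
      by (simp add: flat_def)
    ultimately show ?thesis by simp
  qed
  then show ?case using smooth1.flat by blast
next
  case (mult f g)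
  then obtain f' g' where "smooth1 f'" "\<And>t. (f has_real_derivative f' t) (at t)"
    "smooth1 g'" "\<And>t. (g has_real_derivative g' t) (at t)" by blast
  with mult show ?case
    by (intro exI[of _ "\<lambda>t. f t * g' t + f' t * g t"])
       (auto intro!: smooth1.intros derivative_eq_intros)
next
  case (add f g)
  then obtain f' g' where "smooth1 f'" "\<And>t. (f has_real_derivative f' t) (at t)"
    "smooth1 g'" "\<And>t. (g has_real_derivative g' t) (at t)" by blast
  then show ?case
    by (intro exI[of _ "\<lambda>t. f' t + g' t"]) (auto intro!: smooth1.intros derivative_eq_intros)
qed

text \<open>A partial derivative in direction \<open>j\<close> replaces the factor
  \<open>g j\<close> by its derivative and so stays among products of one-variable
  functions.\<close>

lemma smooth_prod_smooth1:
  assumes "\<And>i. i < d \<Longrightarrow> smooth1 (g i)"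
  shows "smooth d (\<lambda>x. \<Prod>i<d. g i (x i))"
proof (rule smooth_coinduct[where S = "{\<lambda>x. \<Prod>i<d. g i (x i) |g. \<forall>i<d. smooth1 (g i)}"])
  fix f assume "f \<in> {\<lambda>x. \<Prod>i<d. g i (x i) |g. \<forall>i<d. smooth1 (g i)}"
  then obtain g where f: "f = (\<lambda>x. \<Prod>i<d. g i (x i))" and g: "\<And>i. i < d \<Longrightarrow> smooth1 (g i)"
    by blast
  show "continuous_map (Rd d) euclideanreal f"
    unfolding f
  proof (rule continuous_map_prod)
    fix i assume i: "i \<in> {..<d}"
    then obtain g' where "\<And>t. (g i has_real_derivative g' t) (at t)"
      using smooth1_derivative[OF g[of i]] by auto
    then have "continuous_map euclideanreal euclideanreal (g i)"
      by (auto intro!: continuous_at_imp_continuous_on DERIV_isCont)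
    from continuous_map_compose[OF continuous_map_coord this, of i d] i
    show "continuous_map (Rd d) euclideanreal (\<lambda>x. g i (x i))"
      by (simp add: o_def)
  qed simp
next
  fix f j assume "f \<in> {\<lambda>x. \<Prod>i<d. g i (x i) |g. \<forall>i<d. smooth1 (g i)}" and j: "j < d"
  then obtain g where f: "f = (\<lambda>x. \<Prod>i<d. g i (x i))" and g: "\<And>i. i < d \<Longrightarrow> smooth1 (g i)"
    by blast
  obtain g' where g': "smooth1 g'" "\<And>t. (g j has_real_derivative g' t) (at t)"
    using smooth1_derivative[OF g[OF j]] by blast
  have split: "(\<Prod>i<d. h i) = h j * (\<Prod>i\<in>{..<d}-{j}. h i)" for h :: "nat \<Rightarrow> real"
    using j by (simp add: prod.remove)
  have D: "((\<lambda>t. f (x(j := t))) has_real_derivative (\<Prod>i<d. (g(j := g')) i (x i))) (at (x j))" for x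
  proof -
    have "f (x(j := t)) = g j t * (\<Prod>i\<in>{..<d}-{j}. g i (x i))" for t
      unfolding f split by simp
    moreover have "(\<Prod>i<d. (g(j := g')) i (x i)) = g' (x j) * (\<Prod>i\<in>{..<d}-{j}. g i (x i))"
      unfolding split by simp
    ultimately show ?thesis
      using g'(2)[of "x j"] by (auto intro!: derivative_eq_intros)
  qed
  have "(\<lambda>x. \<Prod>i<d. (g(j := g')) i (x i)) \<in> {\<lambda>x. \<Prod>i<d. g i (x i) |g. \<forall>i<d. smooth1 (g i)}"
    by (rule CollectI, rule exI[of _ "g(j := g')"]) (use g g' in auto)
  then show "\<exists>g'\<in>{\<lambda>x. \<Prod>i<d. g i (x i) |g. \<forall>i<d. smooth1 (g i)}. \<forall>x\<in>topspace (Rd d).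
      ((\<lambda>t. f (x(j := t))) has_real_derivative g' x) (at (x j))"
    by (rule bexI[rotated]) (rule ballI, rule D)
qed (use assms in blast)

text \<open>Written with affine arguments to match the rule \<open>smooth1.flat\<close>;
  \<open>bump_eq\<close> is the readable form. The factor n + 1 steepens both edges: exp(-1/((n+1)
  r)) tends to 1 for each r > 0, so the bumps tend to the indicator of the open interval.\<close>

definition bump :: "nat \<Rightarrow> real \<Rightarrow> real \<Rightarrow> real \<Rightarrow> real" where
  "bump n a b t = flat 1 (real (Suc n) * t + (- real (Suc n) * a)) * flat 1 (- real (Suc n) * t + real (Suc n) * b)"

lemma bump_eq: "bump n a b t = flat 1 (real (Suc n) * (t - a)) * flat 1 (real (Suc n) * (b - t))"
  by (simp add: bump_def algebra_simps)

lemma smooth1_bump: "smooth1 (bump n a b)"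
  unfolding bump_def by (intro smooth1.intros)

lemma flat1_bounds: "0 \<le> flat 1 t" "flat 1 t \<le> 1"
  by (simp_all add: flat_def)

lemma bump_bounds: "0 \<le> bump n a b t" "bump n a b t \<le> 1"
  using flat1_bounds by (simp_all add: bump_def mult_le_one)

lemma bump_zero: "t \<notin> {a<..<b} \<Longrightarrow> bump n a b t = 0"
  unfolding bump_eq flat_def by (auto simp: zero_less_mult_iff)

lemma bump_tendsto: "(\<lambda>n. bump n a b t) \<longlonglongrightarrow> indicator {a<..<b} t"
proof (cases "t \<in> {a<..<b}")
  case True
  have "(\<lambda>n. flat 1 (real (Suc n) * s)) \<longlonglongrightarrow> 1" if "0 < s" for s
  proof -
    have "(\<lambda>n. exp (- (inverse (real (Suc n)) * inverse s))) \<longlonglongrightarrow> exp (- (0 * inverse s))"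
      by (intro tendsto_intros LIMSEQ_inverse_real_of_nat)
    then show ?thesis
      using that by (simp add: flat_def zero_less_mult_iff)
  qed
  from tendsto_mult[OF this[of "t - a"] this[of "b - t"]] True
  show ?thesis by (simp add: bump_eq)
qed (simp add: bump_zero)

section \<open>From test functions to boxes to Borel sets\<close>

context domain
begin

lemma box_sets: "PiE {..<d} (\<lambda>i. {a i<..<b i}) \<in> sets (leb d)"
  by (rule sets_PiM_I_finite) auto

lemma bump_test:
  assumes "PiE {..<d} (\<lambda>i. {a i..b i}) \<subseteq> \<Omega>"
  shows "(\<lambda>x. \<Prod>i<d. bump n (a i) (b i) (x i)) \<in> test_functions d \<Omega>"
  unfolding test_functions_def
proof (intro CollectI conjI exI)
  show "smooth d (\<lambda>x. \<Prod>i<d. bump n (a i) (b i) (x i))"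
    by (intro smooth_prod_smooth1 smooth1_bump)
  show "compactin (Rd d) (PiE {..<d} (\<lambda>i. {a i..b i}))"
    by (simp add: Rd_def compactin_PiE)
  show "\<forall>x\<in>topspace (Rd d) - PiE {..<d} (\<lambda>i. {a i..b i}). (\<Prod>i<d. bump n (a i) (b i) (x i)) = 0"
  proof
    fix x assume "x \<in> topspace (Rd d) - PiE {..<d} (\<lambda>i. {a i..b i})"
    then obtain i where "i < d" "x i \<notin> {a i..b i}"
      by (auto simp: topspace_Rd PiE_def Pi_def)
    then have "bump n (a i) (b i) (x i) = 0"
      by (intro bump_zero) auto
    then show "(\<Prod>i<d. bump n (a i) (b i) (x i)) = 0" using \<open>i < d\<close> by auto
  qed
qed fact

lemma L2_integrable:
  assumes "w \<in> L2 d \<Omega>"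
  shows "integrable (leb_on d \<Omega>) w"
proof -
  have "integrable (leb_on d \<Omega>) (\<lambda>_. 1 :: real)"
    using finite_leb_on by (simp add: integrable_iff_bounded)
  then have "(\<lambda>_. 1) \<in> L2 d \<Omega>" by (simp add: L2_def)
  from L2_mult_integrable[OF assms this] show ?thesis by simp
qed

lemma prod_indicator_box:
  assumes "x \<in> space (leb d)"
  shows "(\<Prod>i<d. indicator {a i<..<b i} (x i)) = (indicator (PiE {..<d} (\<lambda>i. {a i<..<b i})) x :: real)"
proof (cases "\<forall>i<d. x i \<in> {a i<..<b i}")
  case True
  then have "x \<in> PiE {..<d} (\<lambda>i. {a i<..<b i})"
    using assms by (auto simp: space_PiM PiE_def)
  then show ?thesis using True by simp
next
  case False
  then obtain i where i: "i < d" "x i \<notin> {a i<..<b i}" by blast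
  then have "x \<notin> PiE {..<d} (\<lambda>i. {a i<..<b i})" by (metis PiE_mem lessThan_iff)
  moreover have "(\<Prod>i<d. indicator {a i<..<b i} (x i)) = (0::real)"
    using i by (intro prod_zero) (auto simp: indicator_def)
  ultimately show ?thesis by (metis indicator_simps(2))
qed

text \<open>Products of bumps are test functions because the closed box is compact in the domain,
  and they tend pointwise to the indicator of the open box. Dominated convergence applies with
  \<bar>w\<bar>, which is integrable since the domain has finite measure.\<close>

lemma orthogonal_test_box:
  assumes w: "w \<in> L2 d \<Omega>" and orth: "\<And>\<eta>. \<eta> \<in> test_functions d \<Omega> \<Longrightarrow> pairing d \<Omega> w \<eta> = 0"
    and box: "PiE {..<d} (\<lambda>i. {a i..b i}) \<subseteq> \<Omega>"
  shows "(\<integral>x. w x * indicator (PiE {..<d} (\<lambda>i. {a i<..<b i})) x \<partial>leb_on d \<Omega>) = 0"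
proof -
  let ?\<beta> = "\<lambda>n x. \<Prod>i<d. bump n (a i) (b i) (x i)"
  note test = bump_test[OF box]
  have "(\<lambda>n. \<integral>x. w x * ?\<beta> n x \<partial>leb_on d \<Omega>) \<longlonglongrightarrow>
      (\<integral>x. w x * indicator (PiE {..<d} (\<lambda>i. {a i<..<b i})) x \<partial>leb_on d \<Omega>)"
  proof (rule integral_dominated_convergence)
    show "integrable (leb_on d \<Omega>) (\<lambda>x. \<bar>w x\<bar>)" using L2_integrable[OF w] by simp
    show "(\<lambda>x. w x * indicator (PiE {..<d} (\<lambda>i. {a i<..<b i})) x) \<in> borel_measurable (leb_on d \<Omega>)"
      by (rule borel_measurable_times[OF _ measurable_leb_on[OF borel_measurable_indicator[OF box_sets]]])
         (use w in \<open>simp add: L2_def\<close>)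
    show "(\<lambda>x. w x * ?\<beta> n x) \<in> borel_measurable (leb_on d \<Omega>)" for n
      using w test_L2[OF test[of n]] by (auto simp: L2_def)
    show "AE x in leb_on d \<Omega>. (\<lambda>n. w x * ?\<beta> n x) \<longlonglongrightarrow> w x * indicator (PiE {..<d} (\<lambda>i. {a i<..<b i})) x"
    proof (rule AE_I2)
      fix x assume "x \<in> space (leb_on d \<Omega>)"
      then have x: "x \<in> space (leb d)" using dom_subset by (auto simp: space_leb_on space_leb)
      show "(\<lambda>n. w x * ?\<beta> n x) \<longlonglongrightarrow> w x * indicator (PiE {..<d} (\<lambda>i. {a i<..<b i})) x"
        unfolding prod_indicator_box[OF x, symmetric]
        by (intro tendsto_intros bump_tendsto)
    qed
    show "AE x in leb_on d \<Omega>. norm (w x * ?\<beta> n x) \<le> \<bar>w x\<bar>" for n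
    proof (rule AE_I2)
      fix x
      have "0 \<le> ?\<beta> n x" "?\<beta> n x \<le> 1"
        by (auto intro!: prod_nonneg prod_le_1 simp: bump_bounds)
      then show "norm (w x * ?\<beta> n x) \<le> \<bar>w x\<bar>"
        by (simp add: abs_mult mult_left_le)
    qed
  qed
  moreover have "(\<integral>x. w x * ?\<beta> n x \<partial>leb_on d \<Omega>) = 0" for n
    using orth[OF test] by (simp add: pairing_def)
  ultimately show ?thesis by (simp add: LIMSEQ_const_iff)
qed

lemma sets_leb_box:
  "sets (leb d) = sigma_sets (topspace (Rd d)) {PiE {..<d} (\<lambda>i. {a i<..<b i}) |a b. True}"
proof -
  define G where "G = {PiE {..<d} (\<lambda>i. {a i<..<b i}) |a b :: nat \<Rightarrow> real. True}"
  define E where "E = range (\<lambda>(a, b). {a<..<b :: real})"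
  have "sets (leb d) = sets (Pi\<^sub>M {..<d} (\<lambda>_. sigma UNIV E))"
    by (rule sets_PiM_cong) (simp_all add: E_def borel_eq_box box_real)
  also have "\<dots> = sets (sigma (PiE {..<d} (\<lambda>_. UNIV))
      {{f\<in>(\<Pi>\<^sub>E i\<in>{..<d}. UNIV). \<forall>i\<in>j. f i \<in> A i} | A j. j \<in> {{..<d}} \<and> A \<in> Pi j (\<lambda>_. E)})"
  proof (rule sets_PiM_sigma)
    show "\<exists>S\<subseteq>E. countable S \<and> UNIV = \<Union> S" if "i \<in> {..<d}" for i
    proof (intro exI conjI)
      show "range (\<lambda>n::nat. {- real n<..<real n}) \<subseteq> E" by (auto simp: E_def)
      show "UNIV = \<Union> (range (\<lambda>n::nat. {- real n<..<real n}))"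
      proof (intro equalityI subsetI)
        fix x :: real
        obtain n where "\<bar>x\<bar> < real n" using reals_Archimedean2 by blast
        then show "x \<in> \<Union> (range (\<lambda>n::nat. {- real n<..<real n}))" by (auto intro!: exI[of _ n])
      qed simp
    qed simp
  qed auto
  also have "{{f\<in>(\<Pi>\<^sub>E i\<in>{..<d}. UNIV). \<forall>i\<in>j. f i \<in> A i} | A j. j \<in> {{..<d}} \<and> A \<in> Pi j (\<lambda>_. E)} = G"
  proof (intro equalityI subsetI)
    fix X assume "X \<in> {{f\<in>(\<Pi>\<^sub>E i\<in>{..<d}. UNIV). \<forall>i\<in>j. f i \<in> A i} | A j. j \<in> {{..<d}} \<and> A \<in> Pi j (\<lambda>_. E)}"
    then obtain A where A: "\<And>i. i < d \<Longrightarrow> A i \<in> E"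
      and X: "X = {f\<in>(\<Pi>\<^sub>E i\<in>{..<d}. UNIV). \<forall>i\<in>{..<d}. f i \<in> A i}" by auto
    have "\<exists>a b. A i = {a<..<b}" if "i < d" for i
      using A[OF that] by (auto simp: E_def)
    then obtain a b where ab: "\<And>i. i < d \<Longrightarrow> A i = {a i<..<b i}" by metis
    have "X = PiE {..<d} (\<lambda>i. {a i<..<b i})"
      unfolding X using ab by (auto simp: PiE_def Pi_def)
    then show "X \<in> G" by (auto simp: G_def)
  next
    fix X assume "X \<in> G"
    then obtain a b where X: "X = PiE {..<d} (\<lambda>i. {a i<..<b i})" by (auto simp: G_def)
    have "X = {f\<in>(\<Pi>\<^sub>E i\<in>{..<d}. UNIV). \<forall>i\<in>{..<d}. f i \<in> {a i<..<b i}}"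
      unfolding X by (auto simp: PiE_def Pi_def)
    then show "X \<in> {{f\<in>(\<Pi>\<^sub>E i\<in>{..<d}. UNIV). \<forall>i\<in>j. f i \<in> A i} | A j. j \<in> {{..<d}} \<and> A \<in> Pi j (\<lambda>_. E)}"
      by (intro CollectI exI[of _ "\<lambda>i. {a i<..<b i}"] exI[of _ "{..<d}"]) (auto simp: E_def)
  qed
  also have "sets (sigma (PiE {..<d} (\<lambda>_. UNIV)) G) = sigma_sets (topspace (Rd d)) G"
    unfolding topspace_Rd by (rule sets_measure_of) (auto simp: G_def PiE_def)
  finally show ?thesis by (simp add: G_def)
qed

lemma box_Int: "PiE {..<d} (\<lambda>i. {a i<..<b i}) \<inter> PiE {..<d} (\<lambda>i. {a' i<..<b' i})
    = PiE {..<d} (\<lambda>i. {max (a i) (a' i)<..<min (b i) (b' i :: real)})"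
  by (auto simp: PiE_def Pi_def)

text \<open>Dynkin's argument: the cut-off of \<open>w\<close> to the box has integral zero over
  every open box, hence over every measurable set, hence is null.\<close>

lemma orthogonal_test_zero_box:
  assumes w: "w \<in> L2 d \<Omega>" and orth: "\<And>\<eta>. \<eta> \<in> test_functions d \<Omega> \<Longrightarrow> pairing d \<Omega> w \<eta> = 0"
    and box: "PiE {..<d} (\<lambda>i. {a i..b i}) \<subseteq> \<Omega>"
  shows "AE x in leb d. x \<in> PiE {..<d} (\<lambda>i. {a i<..<b i}) \<longrightarrow> w x = 0"
proof -
  define Q where "Q = PiE {..<d} (\<lambda>i. {a i<..<b i})"
  have Q: "Q \<subseteq> \<Omega>" "Q \<in> sets (leb d)"
    using box box_sets by (auto simp: Q_def PiE_def Pi_def less_imp_le)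
  \<comment> \<open>The cut-off is integrable on the whole space, and its integral over a box is one
    of \<open>w\<close> over a smaller box whose closed version still lies in the domain.\<close>
  define w' where "w' = (\<lambda>x. indicator Q x * w x)"
  have w'eq: "w' x = indicator Q x * (indicator \<Omega> x * w x)" for x
    using Q by (auto simp: w'_def indicator_def)
  have int: "integrable (leb d) w'"
    unfolding w'eq
    using L2_integrable[OF w] Q(2) by (auto simp: integrable_leb_on intro: integrable_mult_indicator[where 'b=real, simplified])
  have zero: "(\<integral>x\<in>A. w' x \<partial>leb d) = 0" if A_in: "A \<in> {PiE {..<d} (\<lambda>i. {a i<..<b i}) |a b. True}" for A
  proof -
    obtain a' b' where A: "A = PiE {..<d} (\<lambda>i. {a' i<..<b' i})" using A_in by blast
    have AQ: "Q \<inter> A = PiE {..<d} (\<lambda>i. {max (a i) (a' i)<..<min (b i) (b' i)})"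
      unfolding A Q_def box_Int by simp
    have "(\<integral>x\<in>A. w' x \<partial>leb d) = (\<integral>x. indicator \<Omega> x * (w x * indicator (Q \<inter> A) x) \<partial>leb d)"
      unfolding set_lebesgue_integral_def
      by (rule Bochner_Integration.integral_cong) (auto simp: w'eq indicator_def)
    also have "\<dots> = (\<integral>x. w x * indicator (Q \<inter> A) x \<partial>leb_on d \<Omega>)"
      by (simp add: integral_leb_on)
    also have "\<dots> = 0"
      unfolding AQ
    proof (rule orthogonal_test_box[OF w orth])
      show "PiE {..<d} (\<lambda>i. {max (a i) (a' i)..min (b i) (b' i)}) \<subseteq> \<Omega>"
        using box by (auto simp: PiE_def Pi_def subset_iff)
    qed
    finally show ?thesis .
  qed
  have "AE x in leb d. w' x = 0"
  proof (rule density_unique_real[OF int])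
    show "integrable (leb d) (\<lambda>_. 0 :: real)" by simp
    fix A assume "A \<in> sets (leb d)"
    then have A: "A \<in> sigma_sets (topspace (Rd d)) {PiE {..<d} (\<lambda>i. {a i<..<b i}) |a b. True}"
      by (simp add: sets_leb_box)
    have sint: "set_integrable (leb d) B w'" if "B \<in> sets (leb d)" for B
      unfolding set_integrable_def using that int by (rule integrable_mult_indicator)
    have Int: "Int_stable {PiE {..<d} (\<lambda>i. {a i<..<b i :: real}) |a b. True}"
    proof (rule Int_stableI)
      fix X Y :: "point set"
      assume "X \<in> {PiE {..<d} (\<lambda>i. {a i<..<b i}) |a b. True}" "Y \<in> {PiE {..<d} (\<lambda>i. {a i<..<b i}) |a b. True}"
      then obtain a b a' b' where XY: "X = PiE {..<d} (\<lambda>i. {a i<..<b i})" "Y = PiE {..<d} (\<lambda>i. {a' i<..<b' i})"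
        by blast
      then show "X \<inter> Y \<in> {PiE {..<d} (\<lambda>i. {a i<..<b i}) |a b. True}"
        unfolding XY box_Int
        by (intro CollectI exI[of _ "\<lambda>i. max (a i) (a' i)"] exI[of _ "\<lambda>i. min (b i) (b' i)"] conjI refl TrueI)
    qed
    have sub: "{PiE {..<d} (\<lambda>i. {a i<..<b i :: real}) |a b. True} \<subseteq> Pow (topspace (Rd d))"
      by (auto simp: topspace_Rd PiE_def)
    show "(\<integral>x\<in>A. w' x \<partial>leb d) = (\<integral>x\<in>A. 0 \<partial>leb d)"
      using Int sub A
    proof (induction rule: sigma_sets_induct_disjoint)
      case (basic A)
      then show ?case using zero by simp
    next
      case (compl A)
      then have A: "A \<in> sets (leb d)" by (simp add: sets_leb_box)
      have top: "topspace (Rd d) \<in> sets (leb d)" by (metis space_leb sets.top)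
      \<comment> \<open>Complements need the integral over the whole space, which is not in general
        one of the bounded generating boxes; \<open>w'\<close> lives on \<open>Q\<close>, which is
        one.\<close>
      have "(\<integral>x\<in>topspace (Rd d). w' x \<partial>leb d) = (\<integral>x\<in>Q. w' x \<partial>leb d)"
        unfolding set_lebesgue_integral_def
        by (rule Bochner_Integration.integral_cong) (auto simp: space_leb w'_def indicator_def)
      also have "\<dots> = 0" by (rule zero) (auto simp: Q_def)
      finally have "(\<integral>x\<in>topspace (Rd d). w' x \<partial>leb d) = 0" .
      moreover have "(\<integral>x\<in>topspace (Rd d). w' x \<partial>leb d)
          = (\<integral>x\<in>topspace (Rd d) - A. w' x \<partial>leb d) + (\<integral>x\<in>A. w' x \<partial>leb d)"
      proof -
        have "A \<subseteq> topspace (Rd d)" using sets.sets_into_space[OF A] by (simp add: space_leb)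
        then have "topspace (Rd d) = (topspace (Rd d) - A) \<union> A" by blast
        then show ?thesis
          using set_integral_Un[of "topspace (Rd d) - A" A "leb d" w'] sint A top
          by (metis Diff_disjoint Int_commute sets.Diff)
      qed
      ultimately show ?case using compl by simp
    next
      case (union A)
      have A: "A i \<in> sets (leb d)" for i using union(2) by (auto simp: sets_leb_box)
      have "(\<integral>x\<in>(\<Union>i. A i). w' x \<partial>leb d) = (\<Sum>i. \<integral>x\<in>A i. w' x \<partial>leb d)"
        using union(1) A
        by (intro lebesgue_integral_countable_add sint sets.countable_UN') (auto simp: disjoint_family_on_def)
      then show ?case using union(3) by simp
    qed (simp add: set_lebesgue_integral_def)
  qed
  then show ?thesis
    unfolding Q_def[symmetric] by (rule eventually_mono) (auto simp: w'_def)
qed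

text \<open>An open set is a union of open boxes with rational corners whose closed versions it
  contains, so countably many null sets suffice.\<close>

lemma orthogonal_test_zero:
  assumes w: "w \<in> L2 d \<Omega>" and orth: "\<And>\<eta>. \<eta> \<in> test_functions d \<Omega> \<Longrightarrow> pairing d \<Omega> w \<eta> = 0"
  shows "AE x in leb_on d \<Omega>. w x = 0"
proof -
  \<comment> \<open>Corners are extensional functions on finitely many coordinates; this makes
    \<open>Z\<close> countable.\<close>
  define Z where "Z = {ab \<in> PiE {..<d} (\<lambda>_. \<rat>) \<times> PiE {..<d} (\<lambda>_. \<rat>).
      PiE {..<d} (\<lambda>i. {fst ab i..snd ab i}) \<subseteq> \<Omega>}"
  have "countable (PiE {..<d} (\<lambda>_. \<rat>) \<times> PiE {..<d} (\<lambda>_. \<rat> :: real set))"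
    by (intro countable_SIGMA countable_PiE) (auto simp: countable_rat)
  then have "countable Z"
    by (rule countable_subset[rotated]) (auto simp: Z_def)
  then have "AE x in leb d. \<forall>ab\<in>Z. x \<in> PiE {..<d} (\<lambda>i. {fst ab i<..<snd ab i}) \<longrightarrow> w x = 0"
    using orthogonal_test_zero_box[OF w orth]
    by (subst AE_ball_countable) (auto simp: Z_def)
  moreover have "\<exists>ab\<in>Z. x \<in> PiE {..<d} (\<lambda>i. {fst ab i<..<snd ab i})" if x: "x \<in> \<Omega>" for x
  proof -
    obtain U where U: "\<And>i. i < d \<Longrightarrow> open (U i)" "x \<in> PiE {..<d} U" "PiE {..<d} U \<subseteq> \<Omega>"
      using open_dom x unfolding Rd_def openin_product_topology_alt by (metis lessThan_iff open_openin)
    have "\<exists>a b. a \<in> \<rat> \<and> b \<in> \<rat> \<and> a < x i \<and> x i < b \<and> {a..b} \<subseteq> U i" if i: "i < d" for i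
    proof -
      have "x i \<in> U i" using U(2) i by auto
      then obtain e where e: "e > 0" "\<And>y. \<bar>y - x i\<bar> < e \<Longrightarrow> y \<in> U i"
        using U(1)[OF i] unfolding open_dist dist_real_def by blast
      obtain a where a: "a \<in> \<rat>" "x i - e < a" "a < x i"
        using Rats_dense_in_real[of "x i - e" "x i"] e(1) by auto
      obtain b where b: "b \<in> \<rat>" "x i < b" "b < x i + e"
        using Rats_dense_in_real[of "x i" "x i + e"] e(1) by auto
      have "{a..b} \<subseteq> U i" using a b by (auto intro!: e(2))
      then show ?thesis using a b by blast
    qed
    then obtain a b where ab: "\<And>i. i < d \<Longrightarrow> a i \<in> \<rat> \<and> b i \<in> \<rat> \<and> a i < x i \<and> x i < b i \<and> {a i..b i} \<subseteq> U i"
      by metis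
    define p where "p = (restrict a {..<d}, restrict b {..<d})"
    have "PiE {..<d} (\<lambda>i. {fst p i..snd p i}) \<subseteq> PiE {..<d} U"
      using ab by (intro PiE_mono) (auto simp: p_def)
    then have "p \<in> Z"
      using U(3) ab by (auto simp: Z_def p_def)
    moreover have "x \<in> PiE {..<d} (\<lambda>i. {fst p i<..<snd p i})"
      using ab U(2) by (auto simp: p_def PiE_def)
    ultimately show ?thesis by blast
  qed
  ultimately have "AE x in leb d. x \<in> \<Omega> \<longrightarrow> w x = 0"
    by (auto elim!: eventually_mono)
  then show ?thesis
    unfolding leb_on_def
    by (subst AE_restrict_space_iff) (use dom_sets in \<open>auto simp: Int_absorb2 sets.sets_into_space\<close>)
qed

end

section \<open>The space \<open>sobolev0\<close> as a closure\<close>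

definition lap :: "nat \<Rightarrow> fn \<Rightarrow> fn" where
  "lap d \<eta> = (\<lambda>x. \<Sum>i<d. partial i (partial i \<eta>) x)"

text \<open>The formula of \<open>sobolev0_norm\<close> with classical derivatives, hence free of
  choices; on it the one-variable Poincare inequality can be iterated.\<close>

definition test_norm :: "nat \<Rightarrow> point set \<Rightarrow> nat \<Rightarrow> fn \<Rightarrow> real" where
  "test_norm d \<Omega> s \<eta> =
     (let v = (lap d ^^ (s div 2)) \<eta> in
      if even s then L2_norm d \<Omega> v else sqrt (\<Sum>i<d. (L2_norm d \<Omega> (partial i v))\<^sup>2))"

text \<open>
  \<^term>\<open>D is\<close> is the \<open>L\<^sup>2\<close> limit of the classical derivatives of the \<open>\<eta> n\<close>, and therefore a weak
  derivative of \<^term>\<open>D []\<close>.  Unlike in \<^const>\<open>sobolev_norm\<close>, the lists need not be sorted, which is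
  what iterating the Laplacian requires.
\<close>

definition approximates :: "nat \<Rightarrow> point set \<Rightarrow> nat \<Rightarrow> (nat \<Rightarrow> fn) \<Rightarrow> (nat list \<Rightarrow> fn) \<Rightarrow> bool" where
  "approximates d \<Omega> s \<eta> D \<longleftrightarrow> (\<forall>n. \<eta> n \<in> test_functions d \<Omega>) \<and>
     (\<forall>is. set is \<subseteq> {..<d} \<longrightarrow> length is \<le> s \<longrightarrow> D is \<in> L2 d \<Omega> \<and>
        (\<lambda>n. L2_norm d \<Omega> (\<lambda>x. foldr partial is (\<eta> n) x - D is x)) \<longlonglongrightarrow> 0)"

lemma null_squeeze:
  fixes f g :: "nat \<Rightarrow> real"
  assumes "\<And>n. \<bar>f n\<bar> \<le> g n" "g \<longlonglongrightarrow> 0"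
  shows "f \<longlonglongrightarrow> 0"
  by (rule Lim_null_comparison[OF always_eventually assms(2)]) (use assms(1) in auto)

lemma null_squeeze_nonneg:
  fixes f g :: "nat \<Rightarrow> real"
  assumes "\<And>n. 0 \<le> f n" "\<And>n. f n \<le> g n" "g \<longlonglongrightarrow> 0"
  shows "f \<longlonglongrightarrow> 0"
  by (rule null_squeeze[OF _ assms(3)]) (use assms(1,2) in simp)

section \<open>Limits in the mean and weak derivatives\<close>

context domain
begin

lemma L2_norm_minus_commute: "L2_norm d \<Omega> (\<lambda>x. f x - g x) = L2_norm d \<Omega> (\<lambda>x. g x - f x)"
  by (simp add: L2_norm_def pairing_def algebra_simps)

lemma L2_norm_sum_le:
  assumes "\<And>i. i \<in> S \<Longrightarrow> f i \<in> L2 d \<Omega>"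
  shows "L2_norm d \<Omega> (\<lambda>x. \<Sum>i\<in>S. f i x) \<le> (\<Sum>i\<in>S. L2_norm d \<Omega> (f i))"
  using assms
proof (induction S rule: infinite_finite_induct)
  case (insert i S)
  then have "L2_norm d \<Omega> (\<lambda>x. f i x + (\<Sum>i\<in>S. f i x)) \<le> L2_norm d \<Omega> (f i) + L2_norm d \<Omega> (\<lambda>x. \<Sum>i\<in>S. f i x)"
    using L2.sum_in[of S f "\<lambda>_. 1"] by (intro L2_norm_triangle) auto
  with insert show ?case by fastforce
qed (simp_all add: L2_norm_def pairing_def)

lemma L2_norm_tendsto:
  assumes f: "\<And>n::nat. f n \<in> L2 d \<Omega>" and g: "g \<in> L2 d \<Omega>"
    and lim: "(\<lambda>n. L2_norm d \<Omega> (\<lambda>x. f n x - g x)) \<longlonglongrightarrow> 0"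
  shows "(\<lambda>n. L2_norm d \<Omega> (f n)) \<longlonglongrightarrow> L2_norm d \<Omega> g"
proof -
  have "\<bar>L2_norm d \<Omega> (f n) - L2_norm d \<Omega> g\<bar> \<le> L2_norm d \<Omega> (\<lambda>x. f n x - g x)" for n
  proof -
    have "L2_norm d \<Omega> (f n) \<le> L2_norm d \<Omega> (\<lambda>x. f n x - g x) + L2_norm d \<Omega> g"
      using L2_norm_triangle[OF L2.diff_in[OF f[of n] g] g] by simp
    moreover have "L2_norm d \<Omega> g \<le> L2_norm d \<Omega> (\<lambda>x. g x - f n x) + L2_norm d \<Omega> (f n)"
      using L2_norm_triangle[OF L2.diff_in[OF g f[of n]] f[of n]] by simp
    ultimately show ?thesis
      using L2_norm_minus_commute[of g "f n"] by linarith
  qed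
  then have "(\<lambda>n. L2_norm d \<Omega> (f n) - L2_norm d \<Omega> g) \<longlonglongrightarrow> 0"
    by (rule null_squeeze[OF _ lim])
  then show ?thesis by (simp add: LIM_zero_iff)
qed

lemma pairing_tendsto:
  assumes f: "\<And>n::nat. f n \<in> L2 d \<Omega>" and g: "g \<in> L2 d \<Omega>" and h: "h \<in> L2 d \<Omega>"
    and lim: "(\<lambda>n. L2_norm d \<Omega> (\<lambda>x. f n x - g x)) \<longlonglongrightarrow> 0"
  shows "(\<lambda>n. pairing d \<Omega> (f n) h) \<longlonglongrightarrow> pairing d \<Omega> g h"
proof -
  have "\<bar>pairing d \<Omega> (f n) h - pairing d \<Omega> g h\<bar> \<le> L2_norm d \<Omega> (\<lambda>x. f n x - g x) * L2_norm d \<Omega> h" for n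
    using pairing_le_norms[OF L2.diff_in[OF f[of n] g] h] L2.form_diff[OF f[of n] g h] by simp
  moreover have "(\<lambda>n. L2_norm d \<Omega> (\<lambda>x. f n x - g x) * L2_norm d \<Omega> h) \<longlonglongrightarrow> 0"
    using lim by (rule tendsto_mult_left_zero)
  ultimately have "(\<lambda>n. pairing d \<Omega> (f n) h - pairing d \<Omega> g h) \<longlonglongrightarrow> 0"
    by (rule null_squeeze)
  then show ?thesis by (simp add: LIM_zero_iff)
qed

text \<open>This makes the choice in \<open>weak_deriv\<close> harmless: any other weak derivative
  has the same norm.\<close>

lemma is_weak_deriv_unique:
  assumes "is_weak_deriv d \<Omega> is u w" "is_weak_deriv d \<Omega> is u w'"
  shows "AE x in leb_on d \<Omega>. w x = w' x"
proof -
  have w: "w \<in> L2 d \<Omega>" "w' \<in> L2 d \<Omega>" using assms by (auto simp: is_weak_deriv_def)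
  have "AE x in leb_on d \<Omega>. w x - w' x = 0"
  proof (rule orthogonal_test_zero)
    fix \<eta> assume \<eta>: "\<eta> \<in> test_functions d \<Omega>"
    have "(- 1) ^ length is * pairing d \<Omega> w \<eta> = (- 1 :: real) ^ length is * pairing d \<Omega> w' \<eta>"
      using assms \<eta> by (simp add: is_weak_deriv_def)
    then have "pairing d \<Omega> w \<eta> = pairing d \<Omega> w' \<eta>" by simp
    then show "pairing d \<Omega> (\<lambda>x. w x - w' x) \<eta> = 0"
      using w test_L2[OF \<eta>] by (simp add: L2.form_diff)
  qed (use w in \<open>rule L2.diff_in\<close>)
  then show ?thesis by (rule eventually_mono) simp
qed

lemma weak_deriv_is_weak_deriv:
  "is_weak_deriv d \<Omega> is u w \<Longrightarrow> is_weak_deriv d \<Omega> is u (weak_deriv d \<Omega> is u)"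
  unfolding weak_deriv_def by (rule someI[of "is_weak_deriv d \<Omega> is u"])

lemma weak_deriv_L2: "is_weak_deriv d \<Omega> is u w \<Longrightarrow> weak_deriv d \<Omega> is u \<in> L2 d \<Omega>"
  by (drule weak_deriv_is_weak_deriv) (simp add: is_weak_deriv_def)

lemma weak_deriv_AE:
  "is_weak_deriv d \<Omega> is u w \<Longrightarrow> AE x in leb_on d \<Omega>. weak_deriv d \<Omega> is u x = w x"
  by (rule is_weak_deriv_unique[OF weak_deriv_is_weak_deriv])

lemma weak_deriv_norm:
  assumes "is_weak_deriv d \<Omega> is u w"
  shows "L2_norm d \<Omega> (weak_deriv d \<Omega> is u) = L2_norm d \<Omega> w"
  using assms by (intro L2_norm_cong_AE weak_deriv_AE weak_deriv_L2) (auto simp: is_weak_deriv_def)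

lemma is_weak_deriv_diff:
  assumes "is_weak_deriv d \<Omega> is u w" "is_weak_deriv d \<Omega> is v z" "u \<in> L2 d \<Omega>" "v \<in> L2 d \<Omega>"
    and "set is \<subseteq> {..<d}"
  shows "is_weak_deriv d \<Omega> is (\<lambda>x. u x - v x) (\<lambda>x. w x - z x)"
proof -
  have "w \<in> L2 d \<Omega>" "z \<in> L2 d \<Omega>" using assms by (auto simp: is_weak_deriv_def)
  with assms show ?thesis
    by (simp add: is_weak_deriv_def L2.diff_in L2.form_diff test_L2 test_foldr_partial right_diff_distrib)
qed

lemma test_is_weak_deriv:
  assumes "\<eta> \<in> test_functions d \<Omega>" "set is \<subseteq> {..<d}"
  shows "is_weak_deriv d \<Omega> is \<eta> (foldr partial is \<eta>)"
  unfolding is_weak_deriv_def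
  using assms parts_foldr[OF assms(1)] test_L2[OF test_foldr_partial[OF assms]] by blast

section \<open>Approximating sequences\<close>

lemma approximates_test: "approximates d \<Omega> s \<eta> D \<Longrightarrow> \<eta> n \<in> test_functions d \<Omega>"
  by (simp add: approximates_def)

lemma approximates_L2:
  "approximates d \<Omega> s \<eta> D \<Longrightarrow> set is \<subseteq> {..<d} \<Longrightarrow> length is \<le> s \<Longrightarrow> D is \<in> L2 d \<Omega>"
  by (simp add: approximates_def)

lemma approximates_tendsto:
  "approximates d \<Omega> s \<eta> D \<Longrightarrow> set is \<subseteq> {..<d} \<Longrightarrow> length is \<le> s \<Longrightarrow>
    (\<lambda>n. L2_norm d \<Omega> (\<lambda>x. foldr partial is (\<eta> n) x - D is x)) \<longlonglongrightarrow> 0"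
  by (simp add: approximates_def)

text \<open>Both sides of the classical integration by parts converge, since pairing with a fixed
  function is continuous.\<close>

lemma approximates_is_weak_deriv:
  assumes A: "approximates d \<Omega> s \<eta> D" and "is": "set is \<subseteq> {..<d}" "length is \<le> s"
  shows "is_weak_deriv d \<Omega> is (D []) (D is)"
  unfolding is_weak_deriv_def
proof (intro conjI ballI)
  show D: "D is \<in> L2 d \<Omega>" using assms by (rule approximates_L2)
  have D0: "D [] \<in> L2 d \<Omega>" using A by (rule approximates_L2) simp_all
  fix \<zeta> assume \<zeta>: "\<zeta> \<in> test_functions d \<Omega>"
  note \<eta> = approximates_test[OF A]
  have "(\<lambda>n. pairing d \<Omega> (\<eta> n) (foldr partial is \<zeta>)) \<longlonglongrightarrow> pairing d \<Omega> (D []) (foldr partial is \<zeta>)"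
    using approximates_tendsto[OF A, of "[]"]
    by (intro pairing_tendsto D0 test_L2 \<eta> test_foldr_partial \<zeta> "is") simp
  moreover have "(\<lambda>n. (-1) ^ length is * pairing d \<Omega> (foldr partial is (\<eta> n)) \<zeta>)
      \<longlonglongrightarrow> (-1) ^ length is * pairing d \<Omega> (D is) \<zeta>"
    using approximates_tendsto[OF A "is"]
    by (intro tendsto_mult tendsto_const pairing_tendsto D test_L2 \<eta> test_foldr_partial \<zeta> "is")
  ultimately show "pairing d \<Omega> (D []) (foldr partial is \<zeta>) = (-1) ^ length is * pairing d \<Omega> (D is) \<zeta>"
    unfolding parts_foldr[OF \<eta> \<zeta> "is"(1)] by (rule LIMSEQ_unique)
qed

lemma approximates_lincomb:
  assumes A: "approximates d \<Omega> s \<eta> D" and B: "approximates d \<Omega> s \<zeta> E"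
  shows "approximates d \<Omega> s (\<lambda>n x. a * \<eta> n x + b * \<zeta> n x) (\<lambda>is x. a * D is x + b * E is x)"
  unfolding approximates_def
proof (intro conjI allI impI)
  note \<eta> = approximates_test[OF A] and \<zeta> = approximates_test[OF B]
  show "(\<lambda>x. a * \<eta> n x + b * \<zeta> n x) \<in> test_functions d \<Omega>" for n
    by (intro test_lincomb \<eta> \<zeta>)
  fix "is" assume "is": "set is \<subseteq> {..<d}" "length is \<le> s"
  note D = approximates_L2[OF A "is"] and E = approximates_L2[OF B "is"]
  show "(\<lambda>x. a * D is x + b * E is x) \<in> L2 d \<Omega>"
    by (intro L2.add_in L2.scale_in D E)
  let ?f = "\<lambda>n x. foldr partial is (\<eta> n) x - D is x" and ?g = "\<lambda>n x. foldr partial is (\<zeta> n) x - E is x"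
  have fg: "?f n \<in> L2 d \<Omega>" "?g n \<in> L2 d \<Omega>" for n
    by (intro L2.diff_in D E test_L2 test_foldr_partial \<eta> \<zeta> "is")+
  have le: "L2_norm d \<Omega> (\<lambda>x. foldr partial is (\<lambda>x. a * \<eta> n x + b * \<zeta> n x) x - (a * D is x + b * E is x))
      \<le> \<bar>a\<bar> * L2_norm d \<Omega> (?f n) + \<bar>b\<bar> * L2_norm d \<Omega> (?g n)" for n
  proof -
    have le: "L2_norm d \<Omega> (\<lambda>x. foldr partial is (\<lambda>x. a * \<eta> n x + b * \<zeta> n x) x - (a * D is x + b * E is x))
        = L2_norm d \<Omega> (\<lambda>x. a * ?f n x + b * ?g n x)"
      using dom_subset "is"(1) by (intro L2_norm_cong)
        (auto simp: foldr_partial_lincomb[OF test_smooth[OF \<eta>] test_smooth[OF \<zeta>]] algebra_simps)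
    also have "\<dots> \<le> \<bar>a\<bar> * L2_norm d \<Omega> (?f n) + \<bar>b\<bar> * L2_norm d \<Omega> (?g n)"
      unfolding L2_norm_scale[OF fg(1), symmetric] L2_norm_scale[OF fg(2), symmetric]
      by (intro L2_norm_triangle L2.scale_in fg)
    finally show ?thesis .
  qed
  have lim: "(\<lambda>n. \<bar>a\<bar> * L2_norm d \<Omega> (?f n) + \<bar>b\<bar> * L2_norm d \<Omega> (?g n)) \<longlonglongrightarrow> \<bar>a\<bar> * 0 + \<bar>b\<bar> * 0"
    by (intro tendsto_intros approximates_tendsto[OF A "is"] approximates_tendsto[OF B "is"])
  show "(\<lambda>n. L2_norm d \<Omega> (\<lambda>x. foldr partial is (\<lambda>x. a * \<eta> n x + b * \<zeta> n x) x
      - (a * D is x + b * E is x))) \<longlonglongrightarrow> 0"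
    by (rule null_squeeze_nonneg[OF L2_norm_nonneg le]) (use lim in simp)
qed

lemma finite_multi_indices: "finite (multi_indices d s)"
  by (rule finite_subset[OF _ finite_lists_length_le[of "{..<d}" s]]) (auto simp: multi_indices_def)

text \<open>The right-hand side is visibly closed under linear combinations, and it controls
  derivatives in every order of directions, not only the sorted lists of
  \<open>sobolev_norm\<close>.\<close>

lemma sobolev0_iff: "u \<in> sobolev0 d \<Omega> s \<longleftrightarrow> (\<exists>\<eta> D. approximates d \<Omega> s \<eta> D \<and> D [] = u)"
proof
  assume "\<exists>\<eta> D. approximates d \<Omega> s \<eta> D \<and> D [] = u"
  then obtain \<eta> D where A: "approximates d \<Omega> s \<eta> D" and u: "u = D []" by blast
  note \<eta> = approximates_test[OF A]
  have u2: "u \<in> L2 d \<Omega>" unfolding u using A by (rule approximates_L2) simp_all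
  have w: "is_weak_deriv d \<Omega> is u (D is)" if "is \<in> multi_indices d s" for "is"
    using that approximates_is_weak_deriv[OF A] by (auto simp: multi_indices_def u)
  have "sobolev_norm d \<Omega> s (\<lambda>x. u x - \<eta> n x) =
      sqrt (\<Sum>is \<in> multi_indices d s. (L2_norm d \<Omega> (\<lambda>x. foldr partial is (\<eta> n) x - D is x))\<^sup>2)" for n
    unfolding sobolev_norm_def
  proof (intro arg_cong[where f = sqrt] sum.cong refl)
    fix "is" assume "is": "is \<in> multi_indices d s"
    then have "set is \<subseteq> {..<d}" by (simp add: multi_indices_def)
    then have "is_weak_deriv d \<Omega> is (\<lambda>x. u x - \<eta> n x) (\<lambda>x. D is x - foldr partial is (\<eta> n) x)"
      using \<eta> "is" by (intro is_weak_deriv_diff w test_is_weak_deriv u2 test_L2)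
    from weak_deriv_norm[OF this]
    show "(L2_norm d \<Omega> (weak_deriv d \<Omega> is (\<lambda>x. u x - \<eta> n x)))\<^sup>2 =
        (L2_norm d \<Omega> (\<lambda>x. foldr partial is (\<eta> n) x - D is x))\<^sup>2"
      by (simp add: L2_norm_minus_commute[of "D is"])
  qed
  moreover have "(\<lambda>n. sqrt (\<Sum>is \<in> multi_indices d s. (L2_norm d \<Omega> (\<lambda>x. foldr partial is (\<eta> n) x - D is x))\<^sup>2))
      \<longlonglongrightarrow> sqrt (\<Sum>is \<in> multi_indices d s. 0\<^sup>2)"
    by (intro tendsto_intros approximates_tendsto[OF A]) (auto simp: multi_indices_def)
  ultimately have "(\<lambda>n. sobolev_norm d \<Omega> s (\<lambda>x. u x - \<eta> n x)) \<longlonglongrightarrow> 0" by simp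
  then show "u \<in> sobolev0 d \<Omega> s"
    using u2 w \<eta> unfolding sobolev0_def sobolev_def by blast
next
  assume u: "u \<in> sobolev0 d \<Omega> s"
  then have u2: "u \<in> L2 d \<Omega>" by (simp add: sobolev0_def sobolev_def)
  obtain \<eta> where \<eta>: "\<And>n. \<eta> n \<in> test_functions d \<Omega>"
    and lim: "(\<lambda>n. sobolev_norm d \<Omega> s (\<lambda>x. u x - \<eta> n x)) \<longlonglongrightarrow> 0"
    using u unfolding sobolev0_def by blast
  \<comment> \<open>The chosen weak derivative of order zero equals \<open>u\<close> only almost
    everywhere, while \<open>D [] = u\<close> is claimed exactly. Unsorted lists borrow the
    derivative of the sorted list.\<close>
  define D where "D = (\<lambda>is. if is = [] then u else weak_deriv d \<Omega> (sort is) u)"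
  have D: "is_weak_deriv d \<Omega> (sort is) u (D is)" if "set is \<subseteq> {..<d}" "length is \<le> s" for "is"
  proof (cases "is = []")
    case True
    then show ?thesis using u2 by (simp add: D_def is_weak_deriv_def)
  next
    case False
    have "sort is \<in> multi_indices d s" using that by (simp add: multi_indices_def)
    then show ?thesis
      using u False weak_deriv_is_weak_deriv unfolding sobolev0_def sobolev_def D_def by auto
  qed
  have "approximates d \<Omega> s \<eta> D"
    unfolding approximates_def
  proof (intro conjI allI impI \<eta>)
    fix "is" assume "is": "set is \<subseteq> {..<d}" "length is \<le> s"
    show "D is \<in> L2 d \<Omega>" using D[OF "is"] by (simp add: is_weak_deriv_def)
    have "L2_norm d \<Omega> (\<lambda>x. foldr partial is (\<eta> n) x - D is x) \<le> sobolev_norm d \<Omega> s (\<lambda>x. u x - \<eta> n x)" for n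
    proof -
      \<comment> \<open>Each derivative is one summand of \<open>sobolev_norm\<close>, once its list
        has been sorted.\<close>
      have "L2_norm d \<Omega> (\<lambda>x. foldr partial is (\<eta> n) x - D is x)
          = L2_norm d \<Omega> (\<lambda>x. foldr partial (sort is) (\<eta> n) x - D is x)"
        using dom_subset "is"(1) by (intro L2_norm_cong) (auto simp: foldr_partial_sort[of d] test_smooth[OF \<eta>])
      also have "\<dots> = L2_norm d \<Omega> (\<lambda>x. D is x - foldr partial (sort is) (\<eta> n) x)"
        by (rule L2_norm_minus_commute)
      also have "\<dots> = L2_norm d \<Omega> (weak_deriv d \<Omega> (sort is) (\<lambda>x. u x - \<eta> n x))"
        using "is"(1)
        by (intro weak_deriv_norm[symmetric] is_weak_deriv_diff D "is" test_is_weak_deriv \<eta> u2 test_L2) simp_all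
      also have "\<dots> \<le> sobolev_norm d \<Omega> s (\<lambda>x. u x - \<eta> n x)"
        unfolding sobolev_norm_def
      proof (rule real_le_rsqrt)
        have "sort is \<in> multi_indices d s" using "is" by (simp add: multi_indices_def)
        then show "(L2_norm d \<Omega> (weak_deriv d \<Omega> (sort is) (\<lambda>x. u x - \<eta> n x)))\<^sup>2
            \<le> (\<Sum>is \<in> multi_indices d s. (L2_norm d \<Omega> (weak_deriv d \<Omega> is (\<lambda>x. u x - \<eta> n x)))\<^sup>2)"
          by (intro member_le_sum finite_multi_indices) simp_all
      qed
      finally show ?thesis .
    qed
    then show "(\<lambda>n. L2_norm d \<Omega> (\<lambda>x. foldr partial is (\<eta> n) x - D is x)) \<longlonglongrightarrow> 0"
      by (rule null_squeeze_nonneg[OF L2_norm_nonneg _ lim])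
  qed
  then show "\<exists>\<eta> D. approximates d \<Omega> s \<eta> D \<and> D [] = u"
    by (intro exI[of _ \<eta>] exI[of _ D]) (simp add: D_def)
qed

lemma sobolev0_lincomb:
  "u \<in> sobolev0 d \<Omega> s \<Longrightarrow> v \<in> sobolev0 d \<Omega> s \<Longrightarrow> (\<lambda>x. a * u x + b * v x) \<in> sobolev0 d \<Omega> s"
  unfolding sobolev0_iff by (blast intro: approximates_lincomb)

lemma sobolev0_L2: "u \<in> sobolev0 d \<Omega> s \<Longrightarrow> u \<in> L2 d \<Omega>"
  by (simp add: sobolev0_def sobolev_def)

text \<open>A null function is a limit of the zero sequence, so its norm can be read off from the
  norms of zero test functions.\<close>

lemma approximates_zero:
  assumes "u \<in> L2 d \<Omega>" "AE x in leb_on d \<Omega>. u x = 0"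
  shows "approximates d \<Omega> s (\<lambda>_ _. 0) (\<lambda>is. if is = [] then u else (\<lambda>_. 0))"
  unfolding approximates_def
proof (intro conjI allI impI test_zero)
  fix "is" assume "is": "set is \<subseteq> {..<d}"
  show "(if is = [] then u else (\<lambda>_. 0)) \<in> L2 d \<Omega>" using assms L2.zero_in by simp
  have u0: "L2_norm d \<Omega> u = 0"
    using L2_norm_cong_AE[OF assms(2,1) L2.zero_in] by (simp add: L2_norm_def pairing_def)
  have "L2_norm d \<Omega> (\<lambda>x. foldr partial is (\<lambda>_. 0) x - (if is = [] then u else (\<lambda>_. 0)) x) = 0"
  proof (cases "is = []")
    case True
    then show ?thesis using u0 by (simp add: L2_norm_def pairing_def)
  next
    case False
    have "L2_norm d \<Omega> (\<lambda>x. foldr partial is (\<lambda>_. 0) x - 0) = L2_norm d \<Omega> (\<lambda>_. 0)"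
      using "is" dom_subset by (intro L2_norm_cong) (auto simp: foldr_partial_zero[of _ d])
    then show ?thesis using False by (simp add: L2_norm_def pairing_def)
  qed
  then show "(\<lambda>n. L2_norm d \<Omega> (\<lambda>x. foldr partial is (\<lambda>_. 0) x - (if is = [] then u else (\<lambda>_. 0)) x)) \<longlonglongrightarrow> 0"
    by simp
qed

section \<open>The Laplacian along approximating sequences\<close>

lemma lap_test: "\<eta> \<in> test_functions d \<Omega> \<Longrightarrow> lap d \<eta> \<in> test_functions d \<Omega>"
  unfolding lap_def by (intro test_sum test_partial) auto

lemma lap_pow_test: "\<eta> \<in> test_functions d \<Omega> \<Longrightarrow> (lap d ^^ m) \<eta> \<in> test_functions d \<Omega>"
  by (induction m) (auto intro: lap_test)

text \<open>Appending \<open>[i, i]\<close> to a list differentiates twice in direction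
  \<open>i\<close> before all else, so the limits for the Laplacian are sums of limits at lists
  longer by two. Such lists are in general unsorted.\<close>

lemma approximates_laplacian:
  assumes A: "approximates d \<Omega> (Suc (Suc s)) \<eta> D"
  shows "\<exists>E. approximates d \<Omega> s (\<lambda>n. lap d (\<eta> n)) E \<and> E [] = laplacian d \<Omega> (D [])"
proof -
  define G where "G is = (\<lambda>x. \<Sum>i<d. D (is @ [i, i]) x)" for "is"
  \<comment> \<open>At the empty list the chosen weak Laplacian itself must appear, since
    \<open>sobolev0_norm\<close> iterates it; it equals \<open>G []\<close> almost
    everywhere.\<close>
  define E where "E is = (if is = [] then laplacian d \<Omega> (D []) else G is)" for "is"
  note \<eta> = approximates_test[OF A]
  have w: "is_weak_deriv d \<Omega> [i, i] (D []) (D [i, i])" if "i < d" for i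
    using that by (intro approximates_is_weak_deriv[OF A]) auto
  have "AE x in leb_on d \<Omega>. \<forall>i\<in>{..<d}. weak_deriv d \<Omega> [i, i] (D []) x = D [i, i] x"
    by (rule AE_ball_countable') (auto intro: weak_deriv_AE w)
  then have AE: "AE x in leb_on d \<Omega>. laplacian d \<Omega> (D []) x = G [] x"
    by (rule eventually_mono) (simp add: laplacian_def G_def)
  have lapL2: "laplacian d \<Omega> (D []) \<in> L2 d \<Omega>"
    unfolding laplacian_def
    using L2.sum_in[of "{..<d}" "\<lambda>i. weak_deriv d \<Omega> [i, i] (D [])" "\<lambda>_. 1"] weak_deriv_L2[OF w] by simp
  have GL2: "G is \<in> L2 d \<Omega>" if "set is \<subseteq> {..<d}" "length is \<le> s" for "is"
    unfolding G_def using L2.sum_in[of "{..<d}" "\<lambda>i. D (is @ [i, i])" "\<lambda>_. 1"] that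
    by (simp add: approximates_L2[OF A])
  have lim: "(\<lambda>n. L2_norm d \<Omega> (\<lambda>x. foldr partial is (lap d (\<eta> n)) x - G is x)) \<longlonglongrightarrow> 0"
    if "is": "set is \<subseteq> {..<d}" "length is \<le> s" for "is"
  proof -
    let ?f = "\<lambda>i n x. foldr partial (is @ [i, i]) (\<eta> n) x - D (is @ [i, i]) x"
    have le: "L2_norm d \<Omega> (\<lambda>x. foldr partial is (lap d (\<eta> n)) x - G is x) \<le> (\<Sum>i<d. L2_norm d \<Omega> (?f i n))" for n
    proof -
      have sm: "smooth d (partial i (partial i (\<eta> n)))" if "i < d" for i
        using that by (intro smooth_partial test_smooth \<eta>)
      have "L2_norm d \<Omega> (\<lambda>x. foldr partial is (lap d (\<eta> n)) x - G is x) = L2_norm d \<Omega> (\<lambda>x. \<Sum>i<d. ?f i n x)"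
      proof (rule L2_norm_cong)
        fix x assume "x \<in> \<Omega>"
        then have "x \<in> topspace (Rd d)" using dom_subset by blast
        then have "foldr partial is (lap d (\<eta> n)) x = (\<Sum>i<d. foldr partial is (partial i (partial i (\<eta> n))) x)"
          unfolding lap_def using "is"(1) by (intro foldr_partial_sum[of _ d] sm) auto
        then show "foldr partial is (lap d (\<eta> n)) x - G is x = (\<Sum>i<d. ?f i n x)"
          by (simp add: G_def sum_subtractf)
      qed
      also have "\<dots> \<le> (\<Sum>i<d. L2_norm d \<Omega> (?f i n))"
        using "is" by (intro L2_norm_sum_le L2.diff_in test_L2 test_foldr_partial \<eta> approximates_L2[OF A]) auto
      finally show ?thesis .
    qed
    have lim: "(\<lambda>n. \<Sum>i<d. L2_norm d \<Omega> (?f i n)) \<longlonglongrightarrow> (\<Sum>i<d. 0)"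
      using "is" by (intro tendsto_sum approximates_tendsto[OF A]) auto
    show ?thesis
      by (rule null_squeeze_nonneg[OF L2_norm_nonneg le]) (use lim in simp)
  qed
  have "approximates d \<Omega> s (\<lambda>n. lap d (\<eta> n)) E"
    unfolding approximates_def
  proof (intro conjI allI impI lap_test \<eta>)
    fix "is" assume "is": "set is \<subseteq> {..<d}" "length is \<le> s"
    show EL2: "E is \<in> L2 d \<Omega>" using lapL2 GL2[OF "is"] by (simp add: E_def)
    have "L2_norm d \<Omega> (\<lambda>x. foldr partial is (lap d (\<eta> n)) x - E is x)
        = L2_norm d \<Omega> (\<lambda>x. foldr partial is (lap d (\<eta> n)) x - G is x)" for n
    proof (rule L2_norm_cong_AE)
      show "AE x in leb_on d \<Omega>. foldr partial is (lap d (\<eta> n)) x - E is x = foldr partial is (lap d (\<eta> n)) x - G is x"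
        using AE by (rule eventually_mono) (simp add: E_def)
      show "(\<lambda>x. foldr partial is (lap d (\<eta> n)) x - E is x) \<in> L2 d \<Omega>"
        by (intro L2.diff_in EL2 test_L2 test_foldr_partial lap_test \<eta> "is")
      show "(\<lambda>x. foldr partial is (lap d (\<eta> n)) x - G is x) \<in> L2 d \<Omega>"
        by (intro L2.diff_in GL2 test_L2 test_foldr_partial lap_test \<eta> "is")
    qed
    then show "(\<lambda>n. L2_norm d \<Omega> (\<lambda>x. foldr partial is (lap d (\<eta> n)) x - E is x)) \<longlonglongrightarrow> 0"
      using lim[OF "is"] by simp
  qed
  moreover have "E [] = laplacian d \<Omega> (D [])" by (simp add: E_def)
  ultimately show ?thesis by blast
qed

lemma approximates_laplacian_pow:
  "approximates d \<Omega> (2 * m + r) \<eta> D \<Longrightarrow>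
    \<exists>E. approximates d \<Omega> r (\<lambda>n. (lap d ^^ m) (\<eta> n)) E \<and> E [] = (laplacian d \<Omega> ^^ m) (D [])"
proof (induction m arbitrary: r)
  case (Suc m)
  \<comment> \<open>The induction hypothesis keeps two spare orders of differentiation, which the
    outermost Laplacian consumes.\<close>
  have "approximates d \<Omega> (2 * m + Suc (Suc r)) \<eta> D" using Suc.prems by simp
  from Suc.IH[OF this] obtain E where
    "approximates d \<Omega> (Suc (Suc r)) (\<lambda>n. (lap d ^^ m) (\<eta> n)) E" "E [] = (laplacian d \<Omega> ^^ m) (D [])"
    by blast
  with approximates_laplacian[of r "\<lambda>n. (lap d ^^ m) (\<eta> n)" E] show ?case by simp
qed auto

text \<open>The bridge from the choice-laden norm to classical derivatives: its vanishing on null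
  functions and the Poincare inequality are both obtained through this limit.\<close>

lemma sobolev0_norm_tendsto:
  assumes A: "approximates d \<Omega> s \<eta> D"
  shows "(\<lambda>n. test_norm d \<Omega> s (\<eta> n)) \<longlonglongrightarrow> sobolev0_norm d \<Omega> s (D [])"
proof -
  define m where "m = s div 2"
  have "s = 2 * m + s mod 2" by (simp add: m_def)
  with A obtain E where E: "approximates d \<Omega> (s mod 2) (\<lambda>n. (lap d ^^ m) (\<eta> n)) E"
    and E0: "E [] = (laplacian d \<Omega> ^^ m) (D [])"
    using approximates_laplacian_pow[of m "s mod 2" \<eta> D] by auto
  note t = approximates_test[OF E]
  show ?thesis
  proof (cases "even s")
    case True
    have "(\<lambda>n. L2_norm d \<Omega> ((lap d ^^ m) (\<eta> n))) \<longlonglongrightarrow> L2_norm d \<Omega> (E [])"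
      using approximates_tendsto[OF E, of "[]"] by (intro L2_norm_tendsto test_L2 t approximates_L2[OF E]) simp_all
    then show ?thesis
      using True by (simp add: test_norm_def sobolev0_norm_def E0 m_def Let_def)
  next
    case False
    then have 1: "s mod 2 = 1" by presburger
    have "(\<lambda>n. sqrt (\<Sum>i<d. (L2_norm d \<Omega> (partial i ((lap d ^^ m) (\<eta> n))))\<^sup>2))
        \<longlonglongrightarrow> sqrt (\<Sum>i<d. (L2_norm d \<Omega> (E [i]))\<^sup>2)"
    proof (intro tendsto_intros)
      fix i assume i: "i \<in> {..<d}"
      then show "(\<lambda>n. L2_norm d \<Omega> (partial i ((lap d ^^ m) (\<eta> n)))) \<longlonglongrightarrow> L2_norm d \<Omega> (E [i])"
        using approximates_tendsto[OF E, of "[i]"] 1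
        by (intro L2_norm_tendsto test_L2 test_partial t approximates_L2[OF E]) simp_all
    qed
    moreover have "L2_norm d \<Omega> (E [i]) = L2_norm d \<Omega> (weak_deriv d \<Omega> [i] (E []))" if "i < d" for i
      using that 1 by (intro weak_deriv_norm[symmetric] approximates_is_weak_deriv[OF E]) auto
    ultimately show ?thesis
      using False by (simp add: test_norm_def sobolev0_norm_def E0 m_def Let_def)
  qed
qed

lemma sobolev0_norm_nonneg: "0 \<le> sobolev0_norm d \<Omega> s u"
  by (simp add: sobolev0_norm_def Let_def L2_norm_nonneg sum_nonneg)

lemma sobolev0_norm_AE_zero:
  assumes "u \<in> L2 d \<Omega>" "AE x in leb_on d \<Omega>. u x = 0"
  shows "sobolev0_norm d \<Omega> s u = 0"
proof -
  have "(\<lambda>n. test_norm d \<Omega> s (\<lambda>_. 0)) \<longlonglongrightarrow> sobolev0_norm d \<Omega> s u"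
    using sobolev0_norm_tendsto[OF approximates_zero[OF assms]] by simp
  moreover have p: "partial i (\<lambda>_. 0) = (\<lambda>_. 0)" for i by (simp add: partial_def fun_eq_iff)
  have "(lap d ^^ m) (\<lambda>_. 0) = (\<lambda>_. 0)" for m
    by (induction m) (simp_all add: lap_def p)
  then have "test_norm d \<Omega> s (\<lambda>_. 0) = 0"
    by (simp add: test_norm_def Let_def p L2_norm_def pairing_def)
  ultimately show ?thesis by (simp add: LIMSEQ_const_iff)
qed

lemma sobolev0_zero: "(\<lambda>_. 0) \<in> sobolev0 d \<Omega> s"
  unfolding sobolev0_iff using approximates_zero[OF L2.zero_in, of s] by auto

text \<open>Integration by parts bounds the squared norm of the gradient by the product of the norms
  of \<eta> and its Laplacian. Squaring \<open>Poincare_partial\<close> in direction 0 and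
  cancelling one norm of \<eta> gives \<open>4 * R\<^sup>2\<close>.\<close>

lemma Poincare_lap:
  assumes \<eta>: "\<eta> \<in> test_functions d \<Omega>" and d: "0 < d"
  shows "L2_norm d \<Omega> \<eta> \<le> 4 * R\<^sup>2 * L2_norm d \<Omega> (lap d \<eta>)"
proof -
  define a where "a = L2_norm d \<Omega> \<eta>"
  define b where "b = L2_norm d \<Omega> (lap d \<eta>)"
  define g where "g i = L2_norm d \<Omega> (partial i \<eta>)" for i
  have nn: "0 \<le> a" "0 \<le> b" by (simp_all add: a_def b_def L2_norm_nonneg)
  have "(g 0)\<^sup>2 \<le> (\<Sum>i<d. (g i)\<^sup>2)"
    using d by (intro member_le_sum) auto
  also have "\<dots> = (\<Sum>i<d. - pairing d \<Omega> (partial i (partial i \<eta>)) \<eta>)"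
    using parts[OF test_partial[OF \<eta>] \<eta>]
    by (intro sum.cong) (simp_all add: g_def L2_norm_power2)
  also have "\<dots> = - pairing d \<Omega> (lap d \<eta>) \<eta>"
    using L2.form_sum[of "{..<d}" "\<lambda>i. partial i (partial i \<eta>)" \<eta> "\<lambda>_. 1"]
    by (simp add: lap_def sum_negf test_L2 test_partial \<eta>)
  also have "\<dots> \<le> b * a"
    using pairing_le_norms[OF test_L2[OF lap_test[OF \<eta>]] test_L2[OF \<eta>]] by (simp add: a_def b_def)
  finally have g0: "(g 0)\<^sup>2 \<le> b * a" .
  have "a \<le> 2 * R * g 0" unfolding a_def g_def using \<eta> d by (rule Poincare_partial)
  then have "a\<^sup>2 \<le> (2 * R * g 0)\<^sup>2"
    using nn(1) by (rule power_mono)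
  also have "\<dots> \<le> (4 * R\<^sup>2) * (b * a)"
    using g0 by (simp add: power_mult_distrib mult_left_mono)
  finally have "a * a \<le> (4 * R\<^sup>2 * b) * a" by (simp add: mult.assoc power2_eq_square[of a])
  then show ?thesis
    using nn unfolding a_def[symmetric] b_def[symmetric] by (cases "a = 0") auto
qed

text \<open>Each Laplacian costs \<open>4 * R\<^sup>2\<close>, and the gradient at odd order costs
  \<open>2 * R\<close>.\<close>

definition Poincare_const :: "nat \<Rightarrow> real" where
  "Poincare_const s = (4 * R\<^sup>2) ^ (s div 2) * (if even s then 1 else 2 * R)"

lemma Poincare_const_nonneg: "0 \<le> Poincare_const s"
  using R_pos by (simp add: Poincare_const_def)

lemma Poincare_test:
  assumes \<eta>: "\<eta> \<in> test_functions d \<Omega>" and d: "0 < d"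
  shows "L2_norm d \<Omega> \<eta> \<le> Poincare_const s * test_norm d \<Omega> s \<eta>"
proof -
  define v where "v = (lap d ^^ (s div 2)) \<eta>"
  have v: "v \<in> test_functions d \<Omega>" unfolding v_def using \<eta> by (rule lap_pow_test)
  have pow: "L2_norm d \<Omega> \<eta> \<le> (4 * R\<^sup>2) ^ m * L2_norm d \<Omega> ((lap d ^^ m) \<eta>)" for m
  proof (induction m)
    case (Suc m)
    have "(4 * R\<^sup>2) ^ m * L2_norm d \<Omega> ((lap d ^^ m) \<eta>)
        \<le> (4 * R\<^sup>2) ^ m * (4 * R\<^sup>2 * L2_norm d \<Omega> (lap d ((lap d ^^ m) \<eta>)))"
      by (intro mult_left_mono Poincare_lap lap_pow_test \<eta> d) simp
    from order_trans[OF Suc this] show ?case by (simp add: mult_ac)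
  qed simp
  show ?thesis
  proof (cases "even s")
    case True
    then show ?thesis
      using pow[of "s div 2"] by (simp add: Poincare_const_def test_norm_def)
  next
    case False
    have "L2_norm d \<Omega> v \<le> 2 * R * L2_norm d \<Omega> (partial 0 v)"
      using v d by (rule Poincare_partial)
    also have "L2_norm d \<Omega> (partial 0 v) \<le> sqrt (\<Sum>i<d. (L2_norm d \<Omega> (partial i v))\<^sup>2)"
      using d by (intro real_le_rsqrt member_le_sum[where f = "\<lambda>i. (L2_norm d \<Omega> (partial i v))\<^sup>2"]) auto
    finally have "L2_norm d \<Omega> v \<le> 2 * R * sqrt (\<Sum>i<d. (L2_norm d \<Omega> (partial i v))\<^sup>2)"
      using R_pos by simp
    then have "(4 * R\<^sup>2) ^ (s div 2) * L2_norm d \<Omega> v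
        \<le> (4 * R\<^sup>2) ^ (s div 2) * (2 * R * sqrt (\<Sum>i<d. (L2_norm d \<Omega> (partial i v))\<^sup>2))"
      by (intro mult_left_mono) simp_all
    from order_trans[OF pow[of "s div 2", folded v_def] this] False show ?thesis
      by (simp add: Poincare_const_def test_norm_def v_def[symmetric] mult.assoc)
  qed
qed

lemma Poincare:
  assumes u: "u \<in> sobolev0 d \<Omega> s" and d: "0 < d"
  shows "L2_norm d \<Omega> u \<le> Poincare_const s * sobolev0_norm d \<Omega> s u"
proof -
  obtain \<eta> D where A: "approximates d \<Omega> s \<eta> D" and D: "D [] = u"
    using u unfolding sobolev0_iff by blast
  have "(\<lambda>n. L2_norm d \<Omega> (\<eta> n)) \<longlonglongrightarrow> L2_norm d \<Omega> u"
    using approximates_tendsto[OF A, of "[]"] D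
    by (intro L2_norm_tendsto test_L2 approximates_test[OF A] sobolev0_L2[OF u]) simp
  moreover have "(\<lambda>n. Poincare_const s * test_norm d \<Omega> s (\<eta> n)) \<longlonglongrightarrow> Poincare_const s * sobolev0_norm d \<Omega> s u"
    using sobolev0_norm_tendsto[OF A] unfolding D by (intro tendsto_intros)
  ultimately show ?thesis
    by (rule LIMSEQ_le) (use Poincare_test[OF approximates_test[OF A] d] in blast)
qed

end

section \<open>Condition numbers\<close>

lemma sum_id_mat:
  assumes "finite S"
  shows "(\<Sum>i\<in>S. \<Sum>j\<in>S. x i * (c * id_mat i j) * x j) = c * (\<Sum>i\<in>S. (x i)\<^sup>2)"
proof -
  have "(\<Sum>j\<in>S. x i * (c * id_mat i j) * x j) = c * (x i)\<^sup>2" if "i \<in> S" for i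
  proof -
    have "(\<Sum>j\<in>S. x i * (c * id_mat i j) * x j) = (\<Sum>j\<in>S. if j = i then c * (x i)\<^sup>2 else 0)"
      by (rule sum.cong) (auto simp: id_mat_def power2_eq_square)
    then show ?thesis using assms that by simp
  qed
  then show ?thesis by (simp add: sum_distrib_left)
qed

lemma mat_le_iff:
  assumes "finite S"
  shows "mat_le S (\<lambda>i j. c * id_mat i j) X \<longleftrightarrow>
      (\<forall>x. c * (\<Sum>i\<in>S. (x i)\<^sup>2) \<le> (\<Sum>i\<in>S. \<Sum>j\<in>S. x i * X i j * x j))"
    and "mat_le S X (\<lambda>i j. c * id_mat i j) \<longleftrightarrow>
      (\<forall>x. (\<Sum>i\<in>S. \<Sum>j\<in>S. x i * X i j * x j) \<le> c * (\<Sum>i\<in>S. (x i)\<^sup>2))"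
  unfolding mat_le_def by (simp_all add: sum_id_mat[OF assms])

lemma mat_le_id_mono:
  assumes "finite S"
  shows "mat_le S (\<lambda>i j. c * id_mat i j) X \<Longrightarrow> c' \<le> c \<Longrightarrow> mat_le S (\<lambda>i j. c' * id_mat i j) X"
    and "mat_le S X (\<lambda>i j. c * id_mat i j) \<Longrightarrow> c \<le> c' \<Longrightarrow> mat_le S X (\<lambda>i j. c' * id_mat i j)"
  unfolding mat_le_iff[OF assms]
  by (meson mult_right_mono order_trans sum_nonneg zero_le_power2)+

text \<open>An eigenvalue is the Rayleigh quotient of its eigenvector.\<close>

lemma eigenvalue_bounds:
  assumes S: "finite S"
    and lo: "mat_le S (\<lambda>i j. lo * id_mat i j) X" and hi: "mat_le S X (\<lambda>i j. hi * id_mat i j)"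
    and \<mu>: "\<mu> \<in> eigenvalues S X"
  shows "lo \<le> \<mu>" "\<mu> \<le> hi"
proof -
  obtain x where x: "\<exists>i\<in>S. x i \<noteq> 0" "\<And>i. i \<in> S \<Longrightarrow> (\<Sum>j\<in>S. X i j * x j) = \<mu> * x i"
    using \<mu> by (auto simp: eigenvalues_def)
  have pos: "0 < (\<Sum>i\<in>S. (x i)\<^sup>2)"
    using x(1) S by (auto intro: sum_pos2)
  have "(\<Sum>i\<in>S. \<Sum>j\<in>S. x i * X i j * x j) = (\<Sum>i\<in>S. x i * (\<Sum>j\<in>S. X i j * x j))"
    by (simp add: sum_distrib_left mult.assoc)
  also have "\<dots> = (\<Sum>i\<in>S. \<mu> * (x i)\<^sup>2)"
    by (intro sum.cong refl) (simp add: x(2) power2_eq_square)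
  also have "\<dots> = \<mu> * (\<Sum>i\<in>S. (x i)\<^sup>2)"
    by (simp add: sum_distrib_left)
  finally have eq: "(\<Sum>i\<in>S. \<Sum>j\<in>S. x i * X i j * x j) = \<mu> * (\<Sum>i\<in>S. (x i)\<^sup>2)" .
  have "lo * (\<Sum>i\<in>S. (x i)\<^sup>2) \<le> \<mu> * (\<Sum>i\<in>S. (x i)\<^sup>2)"
    "\<mu> * (\<Sum>i\<in>S. (x i)\<^sup>2) \<le> hi * (\<Sum>i\<in>S. (x i)\<^sup>2)"
    using lo hi unfolding mat_le_iff[OF S] eq[symmetric] by blast+
  then show "lo \<le> \<mu>" "\<mu> \<le> hi"
    using pos by simp_all
qed

text \<open>
  On an empty or infinite set \<open>Max\<close> and \<open>Min\<close> are the same unspecified number, so that their ratio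
  is at most \<open>1\<close>.  This case does occur: the index set \<open>J k\<close> may be empty.  Covering it also makes the
  existence and the finite number of eigenvalues irrelevant.
\<close>

lemma Max_eq_Min_junk: "\<not> (finite A \<and> A \<noteq> {}) \<Longrightarrow> Max A = Min A"
  by (cases "finite A") (simp_all add: Max.eq_fold' Min.eq_fold')

lemma cond_number_le:
  assumes S: "finite S" and "0 < lo"
    and lo: "mat_le S (\<lambda>i j. lo * id_mat i j) X" and hi: "mat_le S X (\<lambda>i j. hi * id_mat i j)"
    and c: "hi / lo \<le> c" "1 \<le> c"
  shows "cond_number S X \<le> c"
proof (cases "finite (eigenvalues S X) \<and> eigenvalues S X \<noteq> {}")
  case True
  note b = eigenvalue_bounds[OF S lo hi]
  have "Max (eigenvalues S X) \<in> eigenvalues S X" "Min (eigenvalues S X) \<in> eigenvalues S X"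
    using True by simp_all
  then have "lo \<le> Max (eigenvalues S X)" "Max (eigenvalues S X) \<le> hi" "lo \<le> Min (eigenvalues S X)"
    using b by blast+
  then have "Max (eigenvalues S X) / Min (eigenvalues S X) \<le> hi / lo"
    using \<open>0 < lo\<close> by (intro frac_le) linarith+
  then show ?thesis using c by (simp add: cond_number_def)
next
  case False
  then show ?thesis
    using c Max_eq_Min_junk[of "eigenvalues S X"] by (simp add: cond_number_def)
qed

section \<open>The energy norm\<close>

text \<open>The Poincare inequality is assumed with an abstract constant \<open>K\<close>, which
  shows in every later estimate whether the size of the domain enters. The equations for
  \<open>CL\<close> and \<open>CLi\<close> include finiteness of the suprema.\<close>

locale energy_space = domain d \<Omega> R for d \<Omega> R +
  fixes s :: nat and L :: "fn \<Rightarrow> fn \<Rightarrow> real" and CL CLi K :: real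
  assumes poincare: "\<And>u. u \<in> sobolev0 d \<Omega> s \<Longrightarrow> L2_norm d \<Omega> u \<le> K * sobolev0_norm d \<Omega> s u"
    and K_nonneg: "0 \<le> K"
    and bijection: "sym_pos_bijection d \<Omega> s L"
    and CL: "continuity_const d \<Omega> s L = ereal CL"
    and CLi: "inverse_continuity_const d \<Omega> s L = ereal CLi"
begin

abbreviation V :: "fn set" where "V \<equiv> sobolev0 d \<Omega> s"
abbreviation nrm :: "fn \<Rightarrow> real" where "nrm \<equiv> sobolev0_norm d \<Omega> s"
abbreviation dnorm :: "(fn \<Rightarrow> real) \<Rightarrow> real" where "dnorm \<equiv> dual_norm d \<Omega> s"

lemma L_dual: "u \<in> V \<Longrightarrow> L u \<in> sobolev_dual d \<Omega> s"
  and L_sym: "u \<in> V \<Longrightarrow> v \<in> V \<Longrightarrow> L u v = L v u"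
  and L_inj: "u \<in> V \<Longrightarrow> v \<in> V \<Longrightarrow> (\<And>w. w \<in> V \<Longrightarrow> L u w = L v w) \<Longrightarrow> AE x in leb_on d \<Omega>. u x = v x"
  using bijection unfolding sym_pos_bijection_def Let_def by blast+

sublocale E: psd_form V L
proof
  show "(\<lambda>_. 0) \<in> V" by (rule sobolev0_zero)
  show "(\<lambda>x. u x + v x) \<in> V" if "u \<in> V" "v \<in> V" for u v
    using sobolev0_lincomb[OF that, of 1 1] by simp
  show "(\<lambda>x. c * u x) \<in> V" if "u \<in> V" for u c
    using sobolev0_lincomb[OF that that, of c 0] by simp
qed (use bijection in \<open>unfold sym_pos_bijection_def Let_def, blast\<close>)+

lemma dual_bound:
  assumes "F \<in> sobolev_dual d \<Omega> s"
  obtains B where "\<And>v. v \<in> V \<Longrightarrow> \<bar>F v\<bar> \<le> B * nrm v"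
  using assms unfolding sobolev_dual_def by blast

lemma dual_zero: "F \<in> sobolev_dual d \<Omega> s \<Longrightarrow> v \<in> V \<Longrightarrow> nrm v = 0 \<Longrightarrow> F v = 0"
  by (metis abs_le_zero_iff dual_bound mult_zero_right)

text \<open>\<open>dual_norm\<close> is a supremum of reals and carries information only if the
  quotients are bounded above.\<close>

lemma dual_bdd: assumes "F \<in> sobolev_dual d \<Omega> s" shows "bdd_above ((\<lambda>v. F v / nrm v) ` V)"
proof -
  obtain B where B: "\<And>v. v \<in> V \<Longrightarrow> \<bar>F v\<bar> \<le> B * nrm v" using dual_bound[OF assms] by blast
  \<comment> \<open>Nothing gives \<open>B\<close> a sign, and the quotient 0 at a vector of norm
    zero must be covered too.\<close>
  have "F v / nrm v \<le> \<bar>B\<bar>" if "v \<in> V" for v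
  proof (cases "nrm v = 0")
    case False
    then have "0 < nrm v" using sobolev0_norm_nonneg[of s v] by simp
    moreover have "F v \<le> \<bar>B\<bar> * nrm v"
      using B[OF that] mult_right_mono[OF abs_ge_self[of B], of "nrm v"] sobolev0_norm_nonneg[of s v]
      by linarith
    ultimately show ?thesis by (simp add: divide_le_eq)
  qed simp
  then show ?thesis by (auto intro!: bdd_aboveI)
qed

text \<open>Where the norm of \<open>v\<close> vanishes the quotient is 0 by convention and says
  nothing about \<open>F v\<close>; there boundedness of \<open>F\<close> gives
  \<open>F v = 0\<close>.\<close>

lemma dual_norm_upper:
  assumes F: "F \<in> sobolev_dual d \<Omega> s" and v: "v \<in> V"
  shows "F v \<le> dnorm F * nrm v"
proof (cases "nrm v = 0")
  case False
  then have pos: "0 < nrm v" using sobolev0_norm_nonneg[of s v] by simp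
  have "F v / nrm v \<le> dnorm F"
    unfolding dual_norm_def using v dual_bdd[OF F] by (rule cSUP_upper)
  then show ?thesis using pos by (simp add: divide_le_eq)
qed (use dual_zero[OF F v] in simp)

lemma dual_norm_nonneg:
  assumes F: "F \<in> sobolev_dual d \<Omega> s"
  shows "0 \<le> dnorm F"
proof -
  have "nrm (\<lambda>_. 0) = 0" by (rule sobolev0_norm_AE_zero) (simp_all add: L2.zero_in)
  then show ?thesis
    unfolding dual_norm_def using dual_bdd[OF F] E.zero_in by (intro cSUP_upper2[where x = "\<lambda>_. 0"]) simp_all
qed

lemma dual_norm_least:
  assumes "\<And>v. v \<in> V \<Longrightarrow> F v \<le> B * nrm v" "0 \<le> B"
  shows "dnorm F \<le> B"
  unfolding dual_norm_def
proof (rule cSUP_least)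
  show "V \<noteq> {}" using E.zero_in by blast
  fix v assume "v \<in> V"
  then show "F v / nrm v \<le> B"
    using assms sobolev0_norm_nonneg[of s v] by (cases "nrm v = 0") (simp_all add: divide_le_eq)
qed

lemma pairing_dual:
  assumes f: "f \<in> L2 d \<Omega>"
  shows "pairing d \<Omega> f \<in> sobolev_dual d \<Omega> s"
  unfolding sobolev_dual_def
proof (intro CollectI conjI ballI allI exI)
  fix u v assume "u \<in> V" "v \<in> V"
  then show "pairing d \<Omega> f (\<lambda>x. u x + v x) = pairing d \<Omega> f u + pairing d \<Omega> f v"
    using f by (simp add: L2.form_add_right sobolev0_L2)
next
  fix u c assume "u \<in> V"
  then show "pairing d \<Omega> f (\<lambda>x. c * u x) = c * pairing d \<Omega> f u"
    using f by (simp add: L2.form_scale_right sobolev0_L2)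
next
  fix u assume u: "u \<in> V"
  have "\<bar>pairing d \<Omega> f u\<bar> \<le> L2_norm d \<Omega> f * L2_norm d \<Omega> u"
    using f sobolev0_L2[OF u] by (rule pairing_le_norms)
  also have "\<dots> \<le> L2_norm d \<Omega> f * (K * nrm u)"
    using poincare[OF u] L2_norm_nonneg by (rule mult_left_mono)
  finally show "\<bar>pairing d \<Omega> f u\<bar> \<le> (L2_norm d \<Omega> f * K) * nrm u" by (simp add: mult.assoc)
qed

text \<open>By symmetry this is the bounded functional \<open>L w\<close> evaluated at a vector of
  norm zero.\<close>

lemma L_zero_left: "u \<in> V \<Longrightarrow> w \<in> V \<Longrightarrow> nrm u = 0 \<Longrightarrow> L u w = 0"
  using dual_zero[OF L_dual] L_sym by metis

lemma CL_nonneg: "0 \<le> CL"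
proof -
  have "nrm (\<lambda>_. 0) = 0" by (rule sobolev0_norm_AE_zero) (simp_all add: L2.zero_in)
  then have "ereal 0 \<le> continuity_const d \<Omega> s L"
    unfolding continuity_const_def using E.zero_in by (intro SUP_upper2[of "\<lambda>_. 0"]) simp_all
  then show ?thesis by (simp add: CL)
qed

lemma dual_norm_L_le:
  assumes u: "u \<in> V"
  shows "dnorm (L u) \<le> CL * nrm u"
proof (cases "nrm u = 0")
  case True
  then show ?thesis using dual_norm_least[of "L u" 0] L_zero_left[OF u] by simp
next
  case False
  then have "0 < nrm u" using sobolev0_norm_nonneg[of s u] by simp
  have "ereal (dnorm (L u) / nrm u) \<le> continuity_const d \<Omega> s L"
    unfolding continuity_const_def using u by (rule SUP_upper)
  then have "dnorm (L u) / nrm u \<le> CL" by (simp add: CL)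
  then show ?thesis using \<open>0 < nrm u\<close> by (simp add: divide_le_eq)
qed

text \<open>If the dual norm of \<open>L u\<close> is zero, the quotient behind \<open>CLi\<close>
  is 0 by convention and gives no bound on \<open>u\<close>. In that case \<open>L u\<close>
  vanishes, and injectivity makes \<open>u\<close> a null function.\<close>

lemma nrm_le_dual_norm_L:
  assumes u: "u \<in> V"
  shows "nrm u \<le> CLi * dnorm (L u)"
proof (cases "dnorm (L u) = 0")
  case True
  have "L u w = L (\<lambda>_. 0) w" if w: "w \<in> V" for w
  proof -
    have "L u w \<le> 0"
      using dual_norm_upper[OF L_dual[OF u] w] True by simp
    \<comment> \<open>The supremum bounds \<open>L u\<close> from above only, so \<open>w\<close> is
      tried with both signs.\<close>
    moreover have "L u (\<lambda>x. -1 * w x) \<le> 0"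
      using dual_norm_upper[OF L_dual[OF u] E.scale_in[OF w]] True by (metis mult_zero_left)
    then have "-1 * L u w \<le> 0" by (simp only: E.form_scale_right[OF w u])
    ultimately show ?thesis using E.form_zero[OF w] by simp
  qed
  then have "AE x in leb_on d \<Omega>. u x = 0"
    using L_inj[OF u E.zero_in] by simp
  then show ?thesis
    using True sobolev0_norm_AE_zero[OF sobolev0_L2[OF u]] by simp
next
  case False
  then have "0 < dnorm (L u)" using dual_norm_nonneg[OF L_dual[OF u]] by simp
  have "ereal (nrm u / dnorm (L u)) \<le> inverse_continuity_const d \<Omega> s L"
    unfolding inverse_continuity_const_def using u by (rule SUP_upper)
  then have "nrm u / dnorm (L u) \<le> CLi" by (simp add: CLi)
  then show ?thesis using \<open>0 < dnorm (L u)\<close> by (simp add: divide_le_eq)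
qed

lemma CLi_nonneg: "0 \<le> CLi"
proof -
  have "nrm (\<lambda>_. 0) = 0" by (rule sobolev0_norm_AE_zero) (simp_all add: L2.zero_in)
  then have "ereal 0 \<le> inverse_continuity_const d \<Omega> s L"
    unfolding inverse_continuity_const_def using E.zero_in by (intro SUP_upper2[of "\<lambda>_. 0"]) simp_all
  then show ?thesis by (simp add: CLi)
qed

lemma energy_le:
  assumes u: "u \<in> V"
  shows "L u u \<le> CL * (nrm u)\<^sup>2"
proof -
  have "L u u \<le> dnorm (L u) * nrm u" by (rule dual_norm_upper[OF L_dual[OF u] u])
  also have "\<dots> \<le> CL * nrm u * nrm u"
    by (intro mult_right_mono dual_norm_L_le u sobolev0_norm_nonneg)
  finally show ?thesis by (simp add: power2_eq_square mult.assoc)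
qed

lemma dual_norm_L_le_energy:
  assumes u: "u \<in> V"
  shows "dnorm (L u) \<le> sqrt CL * sqrt (L u u)"
proof (rule dual_norm_least)
  fix w assume w: "w \<in> V"
  have "L u w \<le> sqrt (L u u) * sqrt (L w w)"
    using E.Cauchy_Schwarz_sqrt[OF u w] by simp
  also have "\<dots> \<le> sqrt (L u u) * sqrt (CL * (nrm w)\<^sup>2)"
    using energy_le[OF w] E.form_nonneg[OF u] by (intro mult_left_mono real_sqrt_le_mono) simp_all
  also have "\<dots> = sqrt CL * sqrt (L u u) * nrm w"
    by (simp add: real_sqrt_mult sobolev0_norm_nonneg)
  finally show "L u w \<le> sqrt CL * sqrt (L u u) * nrm w" .
qed (simp add: CL_nonneg E.form_nonneg[OF u])

lemma nrm_le_energy: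
  assumes u: "u \<in> V"
  shows "nrm u \<le> CLi * sqrt CL * sqrt (L u u)"
  using order_trans[OF nrm_le_dual_norm_L[OF u] mult_left_mono[OF dual_norm_L_le_energy[OF u] CLi_nonneg]]
  by (simp add: mult.assoc)

lemma quadratic_form_stiffness:
  assumes "\<And>i. i \<in> S \<Longrightarrow> f i \<in> V"
  shows "(\<Sum>i\<in>S. \<Sum>j\<in>S. x i * stiffness L f i j * x j) =
    L (\<lambda>z. \<Sum>i\<in>S. x i * f i z) (\<lambda>z. \<Sum>i\<in>S. x i * f i z)"
proof -
  have "L (\<lambda>z. \<Sum>i\<in>S. x i * f i z) (\<lambda>z. \<Sum>i\<in>S. x i * f i z) =
      (\<Sum>i\<in>S. x i * (\<Sum>j\<in>S. x j * L (f i) (f j)))"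
    using assms by (simp add: E.form_sum E.form_sum_right E.sum_in)
  then show ?thesis
    by (simp add: stiffness_def sum_distrib_left mult_ac)
qed

end

section \<open>Gamblets\<close>

locale gamblet_hierarchy = energy_space d \<Omega> R s L CL CLi K
  for d \<Omega> R s L CL CLi K +
  fixes q :: nat and Iq :: "index set" and P :: "nat \<Rightarrow> matrix" and \<phi> \<psi> :: "nat \<Rightarrow> index \<Rightarrow> fn"
    and Cs H :: real
  assumes hierarchy: "measurement_hierarchy d \<Omega> q Iq P \<phi>"
    and gamblets: "gamblets d \<Omega> s L q Iq \<phi> \<psi>"
    and Cs: "1 \<le> Cs" and H: "0 < H" "H < 1"
    and inverse_ineq: "\<And>k f. k \<in> {1..q} \<Longrightarrow> f \<in> measurement_span Iq \<phi> k \<Longrightarrow>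
      L2_norm d \<Omega> f \<le> Cs * inverse (H ^ k) * dual_norm d \<Omega> s (pairing d \<Omega> f)"
    and approx_ineq: "\<And>k f. k \<in> {1..q} \<Longrightarrow> f \<in> L2 d \<Omega> \<Longrightarrow>
      (\<And>h. h \<in> measurement_span Iq \<phi> k \<Longrightarrow> pairing d \<Omega> f h = 0) \<Longrightarrow>
      dual_norm d \<Omega> s (pairing d \<Omega> f) \<le> Cs * H ^ k * L2_norm d \<Omega> f"
begin

abbreviation I :: "nat \<Rightarrow> index set" where "I \<equiv> level Iq"

lemma finite_level: "finite (I k)"
  using hierarchy by (simp add: measurement_hierarchy_def index_tree_def level_def)

lemma level_q: "I q = Iq"
proof -
  have "take q i = i" if "i \<in> Iq" for i
    using hierarchy that by (simp add: measurement_hierarchy_def index_tree_def)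
  then show ?thesis by (force simp: level_def)
qed

lemma sum_id_mat_left: "finite S \<Longrightarrow> i \<in> S \<Longrightarrow> (\<Sum>j\<in>S. f j * id_mat i j) = f i"
  and sum_id_mat_right: "finite S \<Longrightarrow> i \<in> S \<Longrightarrow> (\<Sum>j\<in>S. f j * id_mat j i) = f i"
  by (simp_all add: id_mat_def if_distrib cong: if_cong)

lemma measurements_step:
  assumes "1 \<le> k" "k < q" "i \<in> I k"
  shows "\<phi> k i = (\<lambda>x. \<Sum>j \<in> I (Suc k). P k i j * \<phi> (Suc k) j x)"
  using hierarchy assms by (simp add: measurement_hierarchy_def)

text \<open>Induction from level \<open>q\<close> downwards: orthonormality passes to the coarser
  level because the rows of \<open>P k\<close> are orthonormal.\<close>

lemma measurements:
  assumes "1 \<le> k" "k \<le> q"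
  shows "(\<forall>i\<in>I k. \<phi> k i \<in> L2 d \<Omega>) \<and> (\<forall>i\<in>I k. \<forall>j\<in>I k. pairing d \<Omega> (\<phi> k i) (\<phi> k j) = id_mat i j)"
  using assms(2,1)
proof (induction rule: inc_induct)
  case base
  then show ?case using hierarchy by (simp add: measurement_hierarchy_def level_q)
next
  case (step k)
  then have L: "\<And>j. j \<in> I (Suc k) \<Longrightarrow> \<phi> (Suc k) j \<in> L2 d \<Omega>"
    and O: "\<And>i j. i \<in> I (Suc k) \<Longrightarrow> j \<in> I (Suc k) \<Longrightarrow> pairing d \<Omega> (\<phi> (Suc k) i) (\<phi> (Suc k) j) = id_mat i j"
    by auto
  note \<phi> = measurements_step[OF step.prems step.hyps(2)]
  have "pairing d \<Omega> (\<phi> k i) (\<phi> k i') = id_mat i i'" if i: "i \<in> I k" "i' \<in> I k" for i i'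
  proof -
    have "pairing d \<Omega> (\<phi> k i) (\<phi> k i') =
        (\<Sum>j\<in>I (Suc k). P k i j * (\<Sum>j'\<in>I (Suc k). P k i' j' * id_mat j j'))"
      unfolding \<phi>[OF i(1)] \<phi>[OF i(2)] by (simp add: L2.form_sum L2.form_sum_right L2.sum_in L O)
    also have "\<dots> = (\<Sum>j\<in>I (Suc k). P k i j * P k i' j)"
      by (simp add: sum_id_mat_left finite_level)
    also have "\<dots> = id_mat i i'"
      using hierarchy step.prems step.hyps i by (simp add: measurement_hierarchy_def)
    finally show ?thesis .
  qed
  moreover have "\<phi> k i \<in> L2 d \<Omega>" if "i \<in> I k" for i
    unfolding \<phi>[OF that] by (intro L2.sum_in L)
  ultimately show ?case by blast
qed

end

section \<open>Estimates at a fixed level\<close>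

locale gamblet_level = gamblet_hierarchy +
  fixes k
  assumes k: "k \<in> {1..q}"
begin

lemma \<phi>_L2: "i \<in> I k \<Longrightarrow> \<phi> k i \<in> L2 d \<Omega>"
  using measurements[of k] k by auto

lemma \<phi>_orthonormal: "i \<in> I k \<Longrightarrow> j \<in> I k \<Longrightarrow> pairing d \<Omega> (\<phi> k i) (\<phi> k j) = id_mat i j"
  using measurements[of k] k by auto

definition synth :: "(index \<Rightarrow> real) \<Rightarrow> fn" where
  "synth y = (\<lambda>x. \<Sum>i\<in>I k. y i * \<phi> k i x)"

lemma synth_L2: "synth y \<in> L2 d \<Omega>"
  unfolding synth_def by (intro L2.sum_in \<phi>_L2)

lemma synth_span: "synth y \<in> measurement_span Iq \<phi> k"
  unfolding synth_def measurement_span_def by blast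

lemma pairing_synth: "f \<in> L2 d \<Omega> \<Longrightarrow> pairing d \<Omega> (synth y) f = (\<Sum>i\<in>I k. y i * pairing d \<Omega> (\<phi> k i) f)"
  unfolding synth_def by (intro L2.form_sum \<phi>_L2)

lemma pairing_\<phi>_synth: "j \<in> I k \<Longrightarrow> pairing d \<Omega> (\<phi> k j) (synth y) = y j"
  using L2.form_sum_right[of "I k" "\<phi> k" "\<phi> k j" y] \<phi>_L2
  by (simp add: synth_def \<phi>_orthonormal sum_id_mat_left finite_level)

lemma norm_synth: "(L2_norm d \<Omega> (synth y))\<^sup>2 = (\<Sum>i\<in>I k. (y i)\<^sup>2)"
  unfolding L2_norm_power2 pairing_synth[OF synth_L2]
  by (simp add: pairing_\<phi>_synth power2_eq_square)

definition coords :: "fn \<Rightarrow> index \<Rightarrow> real" where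
  "coords f i = pairing d \<Omega> (\<phi> k i) f"

text \<open>Cauchy--Schwarz between \<open>v\<close> and the synthesis of its own coordinates, whose
  pairing and whose squared norm are both the sum on the left.\<close>

lemma Bessel:
  assumes v: "v \<in> L2 d \<Omega>"
  shows "(\<Sum>i\<in>I k. (coords v i)\<^sup>2) \<le> (L2_norm d \<Omega> v)\<^sup>2"
proof -
  define N where "N = (\<Sum>i\<in>I k. (coords v i)\<^sup>2)"
  have "pairing d \<Omega> (synth (coords v)) v = N"
    unfolding pairing_synth[OF v] N_def by (simp add: coords_def power2_eq_square)
  then have "N * N \<le> N * (L2_norm d \<Omega> v)\<^sup>2"
    using L2.Cauchy_Schwarz[OF synth_L2 v, of "coords v"]
    by (simp add: N_def power2_eq_square[of "pairing d \<Omega> _ _"] flip: L2_norm_power2 norm_synth)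
  moreover have "0 \<le> N" by (simp add: N_def sum_nonneg)
  ultimately show ?thesis unfolding N_def[symmetric] by (cases "N = 0") simp_all
qed

lemma \<psi>_V: "i \<in> I k \<Longrightarrow> \<psi> k i \<in> V"
  and \<psi>_dual: "i \<in> I k \<Longrightarrow> j \<in> I k \<Longrightarrow> pairing d \<Omega> (\<phi> k j) (\<psi> k i) = id_mat i j"
  using gamblets k unfolding gamblets_def is_arg_min_def by blast+

text \<open>First variation: adding a multiple of \<open>w\<close> preserves the constraints on
  \<psi>, so the energy along this line is minimal at \<open>t = 0\<close>.\<close>

lemma \<psi>_orthogonal:
  assumes i: "i \<in> I k" and w: "w \<in> V" and ker: "\<And>j. j \<in> I k \<Longrightarrow> coords w j = 0"
  shows "L (\<psi> k i) w = 0"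
proof (rule E.linear_coeff_zero)
  fix t :: real
  let ?v = "\<lambda>x. \<psi> k i x + t * w x"
  have v: "?v \<in> V" using \<psi>_V[OF i] w by (intro E.add_in E.scale_in)
  have "pairing d \<Omega> (\<phi> k j) ?v = id_mat i j" if "j \<in> I k" for j
    using ker[OF that] \<psi>_dual[OF i that] \<phi>_L2[OF that] w \<psi>_V[OF i]
    by (simp add: coords_def L2.form_add_right L2.form_scale_right L2.scale_in sobolev0_L2)
  then have "\<not> energy_norm L ?v < energy_norm L (\<psi> k i)"
    using gamblets k i v unfolding gamblets_def is_arg_min_def by blast
  then have "L (\<psi> k i) (\<psi> k i) \<le> L ?v ?v"
    by (simp add: energy_norm_def)
  then show "0 \<le> 2 * t * L (\<psi> k i) w + t\<^sup>2 * L w w"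
    using E.form_square_expand[OF \<psi>_V[OF i] w, of t] by simp
qed

definition comb :: "(index \<Rightarrow> real) \<Rightarrow> fn" where
  "comb y = (\<lambda>x. \<Sum>i\<in>I k. y i * \<psi> k i x)"

lemma comb_V: "comb y \<in> V"
  unfolding comb_def by (intro E.sum_in \<psi>_V)

lemma coords_comb: "j \<in> I k \<Longrightarrow> coords (comb y) j = y j"
  using L2.form_sum_right[of "I k" "\<psi> k" "\<phi> k j" y] \<phi>_L2 sobolev0_L2[OF \<psi>_V]
  by (simp add: comb_def coords_def \<psi>_dual sum_id_mat_right finite_level)

lemma comb_orthogonal:
  "w \<in> V \<Longrightarrow> (\<And>j. j \<in> I k \<Longrightarrow> coords w j = 0) \<Longrightarrow> L (comb y) w = 0"
  unfolding comb_def by (simp add: E.form_sum \<psi>_V \<psi>_orthogonal)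

lemma coords_residual:
  assumes w: "w \<in> V" and j: "j \<in> I k"
  shows "coords (\<lambda>x. w x - comb (coords w) x) j = 0"
proof -
  have "coords (\<lambda>x. w x - comb (coords w) x) j = coords w j - coords (comb (coords w)) j"
    unfolding coords_def[of _ j] using w j comb_V \<phi>_L2 by (intro L2.form_diff_right) (auto intro: sobolev0_L2)
  then show ?thesis by (simp add: coords_comb[OF j])
qed

text \<open>Replacing \<open>w\<close> by the gamblet combination with the same measurements changes
  \<open>w\<close> by a function with vanishing measurements, to which \<open>comb y\<close> is
  \<open>L\<close>-orthogonal.\<close>

lemma L_comb:
  assumes w: "w \<in> V"
  shows "L (comb y) w = pairing d \<Omega> (synth (\<lambda>i. L (comb y) (\<psi> k i))) w"
proof -
  have "L (comb y) (\<lambda>x. w x - comb (coords w) x) = 0"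
    using w comb_V coords_residual[OF w] by (intro comb_orthogonal E.diff_in)
  then have "L (comb y) w = L (comb y) (comb (coords w))"
    using E.form_diff_right[OF w comb_V comb_V] by simp
  also have "\<dots> = (\<Sum>i\<in>I k. coords w i * L (comb y) (\<psi> k i))"
    unfolding comb_def[of "coords w"] by (intro E.form_sum_right \<psi>_V comb_V)
  also have "\<dots> = pairing d \<Omega> (synth (\<lambda>i. L (comb y) (\<psi> k i))) w"
    unfolding pairing_synth[OF sobolev0_L2[OF w]] by (simp add: coords_def mult.commute)
  finally show ?thesis .
qed

text \<open>With \<open>a\<close> the product of the stiffness matrix and \<open>y\<close>, the
  energy \<open>X\<close> is the scalar product of \<open>y\<close> and \<open>a\<close>. By
  orthonormality and (i), \<open>a\<close> has length at most \<open>c * sqrt X\<close>; cancelling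
  \<open>sqrt X\<close> and squaring gives the square of \<open>c\<close> in front.\<close>

lemma energy_upper: "L (comb y) (comb y) \<le> Cs\<^sup>2 * CL * inverse (H ^ (2 * k)) * (\<Sum>i\<in>I k. (y i)\<^sup>2)"
proof -
  define X where "X = L (comb y) (comb y)"
  define a where "a = (\<lambda>i. L (comb y) (\<psi> k i))"
  define c where "c = Cs * inverse (H ^ k) * sqrt CL"
  define n where "n = L2_set y (I k)"
  have X: "0 \<le> X" unfolding X_def by (intro E.form_nonneg comb_V)
  have c: "0 \<le> c" using Cs H CL_nonneg by (simp add: c_def)
  \<comment> \<open>The dual norm sees values on \<open>V\<close> only, where the two functionals
    agree by \<open>L_comb\<close>.\<close>
  have "dual_norm d \<Omega> s (pairing d \<Omega> (synth a)) = dual_norm d \<Omega> s (L (comb y))"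
    unfolding dual_norm_def a_def by (rule SUP_cong) (simp_all add: L_comb)
  also have "\<dots> \<le> sqrt CL * sqrt X"
    unfolding X_def by (intro dual_norm_L_le_energy comb_V)
  finally have "Cs * inverse (H ^ k) * dual_norm d \<Omega> s (pairing d \<Omega> (synth a)) \<le> Cs * inverse (H ^ k) * (sqrt CL * sqrt X)"
    using Cs H by (intro mult_left_mono) auto
  with inverse_ineq[OF k synth_span, of a]
  have f: "L2_norm d \<Omega> (synth a) \<le> c * sqrt X" by (simp add: c_def mult.assoc)
  have "X = (\<Sum>i\<in>I k. y i * a i)"
    unfolding X_def a_def comb_def[of y] using E.form_sum_right[of "I k" "\<psi> k" "comb y" y] \<psi>_V comb_V
    by (simp add: comb_def)
  also have "\<dots> \<le> (\<Sum>i\<in>I k. \<bar>y i\<bar> * \<bar>a i\<bar>)"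
    by (intro sum_mono) (metis abs_ge_self abs_mult)
  also have "\<dots> \<le> n * L2_set a (I k)"
    unfolding n_def by (rule L2_set_mult_ineq)
  also have "L2_set a (I k) = L2_norm d \<Omega> (synth a)"
    unfolding L2_set_def norm_synth[symmetric] by (simp add: L2_norm_nonneg)
  also have "n * \<dots> \<le> n * (c * sqrt X)"
    using f by (intro mult_left_mono) (simp_all add: n_def)
  finally have "sqrt X * sqrt X \<le> (n * c) * sqrt X" using X by (simp add: mult.assoc)
  then have "sqrt X \<le> n * c" if "0 < X"
    by (rule mult_right_le_imp_le) (use that in simp)
  then have "sqrt X \<le> n * c"
    using X c by (cases "X = 0") (simp_all add: n_def)
  then have "X \<le> (n * c)\<^sup>2" by (rule sqrt_le_D)
  also have "\<dots> = Cs\<^sup>2 * CL * inverse (H ^ (2 * k)) * (\<Sum>i\<in>I k. (y i)\<^sup>2)"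
    using CL_nonneg by (simp add: n_def c_def L2_set_def power_mult_distrib sum_nonneg power_inverse mult_ac
        flip: power_mult)
  finally show ?thesis by (simp add: X_def)
qed

text \<open>Duality: (ii) is applied to \<open>v\<close> itself, whose squared \<open>L2\<close>
  norm is at most its dual norm times its \<open>sobolev0\<close> norm. One \<open>L2\<close> norm
  cancels.\<close>

lemma orthogonal_norm_le:
  assumes v: "v \<in> V" and orth: "\<And>i. i \<in> I k \<Longrightarrow> coords v i = 0"
  shows "L2_norm d \<Omega> v \<le> Cs * H ^ k * nrm v"
proof -
  note v2 = sobolev0_L2[OF v]
  have "pairing d \<Omega> v h = 0" if h: "h \<in> measurement_span Iq \<phi> k" for h
  proof -
    obtain c where "h = synth c" using h unfolding measurement_span_def synth_def by blast
    then have "pairing d \<Omega> v h = pairing d \<Omega> (synth c) v" using L2.form_sym[OF v2 synth_L2] by simp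
    also have "\<dots> = 0" using orth by (simp add: pairing_synth[OF v2] coords_def)
    finally show ?thesis .
  qed
  then have "dual_norm d \<Omega> s (pairing d \<Omega> v) \<le> Cs * H ^ k * L2_norm d \<Omega> v"
    using approx_ineq[OF k v2] by blast
  then have "dual_norm d \<Omega> s (pairing d \<Omega> v) * nrm v \<le> Cs * H ^ k * L2_norm d \<Omega> v * nrm v"
    by (intro mult_right_mono sobolev0_norm_nonneg)
  with dual_norm_upper[OF pairing_dual[OF v2] v]
  have "L2_norm d \<Omega> v * L2_norm d \<Omega> v \<le> (Cs * H ^ k * nrm v) * L2_norm d \<Omega> v"
    by (simp add: mult_ac flip: L2_norm_power2 power2_eq_square)
  then show ?thesis
    using L2_norm_nonneg[of v] Cs H sobolev0_norm_nonneg[of s v]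
    by (cases "L2_norm d \<Omega> v = 0") simp_all
qed

text \<open>The comparison constant \<open>b\<close> between norm and energy is paid twice, once
  inside the bound on the energy of the error and once to return to the norm; this is the origin of
  \<open>CLi\<^sup>2 * CL\<close>.\<close>

lemma approximation_error:
  assumes u: "u \<in> V" and g: "g \<in> L2 d \<Omega>" and Lu: "\<And>v. v \<in> V \<Longrightarrow> L u v = pairing d \<Omega> g v"
  shows "nrm (\<lambda>x. u x - comb (coords u) x) \<le> CLi\<^sup>2 * CL * Cs * H ^ k * L2_norm d \<Omega> g"
proof -
  define v where "v = (\<lambda>x. u x - comb (coords u) x)"
  define e where "e = sqrt (L v v)"
  define b where "b = CLi * sqrt CL"
  have v: "v \<in> V" unfolding v_def by (intro E.diff_in u comb_V)
  have kv: "coords v j = 0" if "j \<in> I k" for j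
    unfolding v_def by (rule coords_residual[OF u that])
  have b: "0 \<le> b" unfolding b_def using CLi_nonneg CL_nonneg by simp
  have e: "0 \<le> e" unfolding e_def using E.form_nonneg[OF v] by simp
  have nv: "nrm v \<le> b * e" using nrm_le_energy[OF v] by (simp add: b_def e_def)
  \<comment> \<open>Galerkin orthogonality: the error is \<open>L\<close>-orthogonal to the
    approximation, so its energy is tested against the data \<open>g\<close> alone.\<close>
  have "L v v = L u v - L (comb (coords u)) v"
    using E.form_diff[OF u comb_V v] by (simp add: v_def)
  also have "\<dots> = pairing d \<Omega> g v"
    using comb_orthogonal[OF v kv] Lu[OF v] by simp
  also have "\<dots> \<le> L2_norm d \<Omega> g * L2_norm d \<Omega> v"
    using pairing_le_norms[OF g sobolev0_L2[OF v]] by simp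
  also have "\<dots> \<le> L2_norm d \<Omega> g * (Cs * H ^ k * nrm v)"
    by (intro mult_left_mono orthogonal_norm_le v kv L2_norm_nonneg)
  also have "\<dots> \<le> L2_norm d \<Omega> g * (Cs * H ^ k * (b * e))"
    using nv Cs H L2_norm_nonneg[of g] by (intro mult_left_mono) auto
  finally have "e * e \<le> (Cs * H ^ k * L2_norm d \<Omega> g * b) * e"
    using E.form_nonneg[OF v] by (simp add: e_def mult_ac)
  then have "e \<le> Cs * H ^ k * L2_norm d \<Omega> g * b"
    using e Cs H b L2_norm_nonneg[of g] by (cases "e = 0") simp_all
  with nv b have "nrm v \<le> b * (Cs * H ^ k * L2_norm d \<Omega> g * b)"
    using mult_left_mono order_trans by blast
  also have "\<dots> = b\<^sup>2 * (Cs * H ^ k * L2_norm d \<Omega> g)"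
    by (simp add: power2_eq_square mult_ac)
  also have "b\<^sup>2 = CLi\<^sup>2 * CL"
    using CL_nonneg by (simp add: b_def power_mult_distrib)
  finally show ?thesis unfolding v_def by (simp add: mult.assoc)
qed

text \<open>The coordinates of \<open>comb y\<close> are \<open>y\<close>, so Bessel turns an
  \<open>L2\<close> bound into a bound on \<open>y\<close>. It is used with \<open>c = K\<close> for
  the stiffness of the \<psi> and with \<open>c = Cs * H ^ (k - 1)\<close> for that of the
  \<chi>.\<close>

lemma energy_lower_if:
  assumes "0 \<le> c" and n: "L2_norm d \<Omega> (comb y) \<le> c * nrm (comb y)"
  shows "(\<Sum>i\<in>I k. (y i)\<^sup>2) \<le> c\<^sup>2 * (CLi\<^sup>2 * CL) * L (comb y) (comb y)"
proof -
  have "(\<Sum>i\<in>I k. (y i)\<^sup>2) = (\<Sum>i\<in>I k. (coords (comb y) i)\<^sup>2)"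
    by (simp add: coords_comb)
  also have "\<dots> \<le> (L2_norm d \<Omega> (comb y))\<^sup>2"
    by (intro Bessel sobolev0_L2[OF comb_V])
  also have "\<dots> \<le> (c * (CLi * sqrt CL * sqrt (L (comb y) (comb y))))\<^sup>2"
    using order_trans[OF n mult_left_mono[OF nrm_le_energy[OF comb_V] \<open>0 \<le> c\<close>]] L2_norm_nonneg
    by (rule power_mono)
  also have "\<dots> = c\<^sup>2 * (CLi\<^sup>2 * CL) * L (comb y) (comb y)"
    using CL_nonneg E.form_nonneg[OF comb_V] by (simp add: power_mult_distrib)
  finally show ?thesis .
qed

end

section \<open>Bounds with a single constant\<close>

context gamblet_hierarchy
begin

text \<open>A common majorant of the factors met so far. The absolute value and the leading 1 keep
  the formula at least 1 for arbitrary real arguments, as the theorem asks of a constant given by a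
  function.\<close>

definition M :: real where "M = 1 + Cs\<^sup>2 * \<bar>CL\<bar> * (1 + CLi\<^sup>2)"

lemma M_bounds: "1 \<le> M" "Cs\<^sup>2 * CL \<le> M" "Cs\<^sup>2 * (CLi\<^sup>2 * CL) \<le> M" "CLi\<^sup>2 * CL \<le> M" "CLi\<^sup>2 * CL * Cs \<le> M"
proof -
  have nn: "0 \<le> Cs\<^sup>2 * CL" "0 \<le> CLi\<^sup>2 * CL" "0 \<le> Cs\<^sup>2 * (CLi\<^sup>2 * CL)" using CL_nonneg by simp_all
  have M: "M = 1 + Cs\<^sup>2 * CL + Cs\<^sup>2 * (CLi\<^sup>2 * CL)"
    using CL_nonneg by (simp add: M_def algebra_simps)
  show "1 \<le> M" "Cs\<^sup>2 * CL \<le> M" and 3: "Cs\<^sup>2 * (CLi\<^sup>2 * CL) \<le> M"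
    using nn unfolding M by linarith+
  have "Cs \<le> Cs\<^sup>2" using Cs by (simp add: power2_eq_square)
  then have "Cs * (CLi\<^sup>2 * CL) \<le> Cs\<^sup>2 * (CLi\<^sup>2 * CL)" "1 * (CLi\<^sup>2 * CL) \<le> Cs\<^sup>2 * (CLi\<^sup>2 * CL)"
    using nn Cs by (intro mult_right_mono; linarith)+
  then show "CLi\<^sup>2 * CL \<le> M" "CLi\<^sup>2 * CL * Cs \<le> M" using 3 by (simp_all add: mult.commute)
qed

lemma approximation:
  assumes k: "k \<in> {1..q}" and u: "u \<in> V" and g: "g \<in> L2 d \<Omega>"
    and Lu: "\<And>v. v \<in> V \<Longrightarrow> L u v = pairing d \<Omega> g v"
  shows "nrm (\<lambda>x. u x - gamblet_approx d \<Omega> Iq \<phi> \<psi> k u x) \<le> M * H ^ k * L2_norm d \<Omega> g"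
proof -
  interpret gamblet_level d \<Omega> R s L CL CLi K q Iq P \<phi> \<psi> Cs H k by unfold_locales (rule k)
  have eq: "gamblet_approx d \<Omega> Iq \<phi> \<psi> k u = comb (coords u)"
    by (simp add: gamblet_approx_def comb_def coords_def)
  have "nrm (\<lambda>x. u x - comb (coords u) x) \<le> CLi\<^sup>2 * CL * Cs * H ^ k * L2_norm d \<Omega> g"
    using u g Lu by (rule approximation_error)
  also have "CLi\<^sup>2 * CL * Cs * H ^ k * L2_norm d \<Omega> g \<le> M * H ^ k * L2_norm d \<Omega> g"
    using H L2_norm_nonneg[of g] by (intro mult_right_mono M_bounds(5)) simp_all
  finally show ?thesis unfolding eq .
qed

lemma stiffness_A:
  assumes "k \<in> {1..q}"
  shows "mat_le (I k) (\<lambda>i j. inverse (M * (1 + K\<^sup>2)) * id_mat i j) (stiffness L (\<psi> k))"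
    and "mat_le (I k) (stiffness L (\<psi> k)) (\<lambda>i j. M * inverse (H ^ (2 * k)) * id_mat i j)"
proof -
  interpret gamblet_level d \<Omega> R s L CL CLi K q Iq P \<phi> \<psi> Cs H k by unfold_locales (rule assms)
  have quad: "(\<Sum>i\<in>I k. \<Sum>j\<in>I k. x i * stiffness L (\<psi> k) i j * x j) = L (comb x) (comb x)" for x
    unfolding comb_def by (rule quadratic_form_stiffness) (rule \<psi>_V)
  have "inverse (M * (1 + K\<^sup>2)) * (\<Sum>i\<in>I k. (x i)\<^sup>2) \<le> L (comb x) (comb x)" for x
  proof -
    have "(\<Sum>i\<in>I k. (x i)\<^sup>2) \<le> K\<^sup>2 * (CLi\<^sup>2 * CL) * L (comb x) (comb x)"
      by (intro energy_lower_if K_nonneg poincare comb_V)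
    \<comment> \<open>The locale knows only \<open>0 \<le> K\<close>; adding 1 keeps the factor to
      be inverted positive.\<close>
    also have "\<dots> \<le> (1 + K\<^sup>2) * M * L (comb x) (comb x)"
      using M_bounds(4) CL_nonneg by (intro mult_right_mono mult_mono E.form_nonneg comb_V) simp_all
    finally show ?thesis
      using M_bounds(1) by (simp add: field_simps add_pos_nonneg)
  qed
  then show "mat_le (I k) (\<lambda>i j. inverse (M * (1 + K\<^sup>2)) * id_mat i j) (stiffness L (\<psi> k))"
    unfolding mat_le_iff[OF finite_level] quad by blast
  have "L (comb x) (comb x) \<le> M * inverse (H ^ (2 * k)) * (\<Sum>i\<in>I k. (x i)\<^sup>2)" for x
  proof (rule order_trans[OF energy_upper])
    show "Cs\<^sup>2 * CL * inverse (H ^ (2 * k)) * (\<Sum>i\<in>I k. (x i)\<^sup>2) \<le> M * inverse (H ^ (2 * k)) * (\<Sum>i\<in>I k. (x i)\<^sup>2)"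
      using H by (intro mult_right_mono M_bounds(2) sum_nonneg) simp_all
  qed
  then show "mat_le (I k) (stiffness L (\<psi> k)) (\<lambda>i j. M * inverse (H ^ (2 * k)) * id_mat i j)"
    unfolding mat_le_iff[OF finite_level] quad by blast
qed

text \<open>The form of \<open>B\<close> at \<open>x\<close> is that of \<open>A\<close> at the
  transpose of \<open>W k\<close> applied to \<open>x\<close>, a vector of equal length in the
  kernel of \<open>P (k - 1)\<close>. Membership in the kernel makes the gamblet combination
  orthogonal to the coarser measurements, so (ii) is available at level \<open>k - 1\<close>; the
  upper bound is inherited from level \<open>k\<close>.\<close>

lemma stiffness_B:
  assumes k2: "k \<in> {2..q}" and wavelets: "wavelet_matrices q Iq P J W"
  shows "mat_le (J k) (\<lambda>i j. inverse M * inverse (H ^ (2 * (k - 1))) * id_mat i j) (stiffness L (chi Iq W \<psi> k))"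
    and "mat_le (J k) (stiffness L (chi Iq W \<psi> k)) (\<lambda>i j. M * inverse (H ^ (2 * k)) * id_mat i j)"
proof -
  have k': "k \<in> {1..q}" "k - 1 \<in> {1..q}" "1 \<le> k - 1" "k - 1 < q" "Suc (k - 1) = k" using k2 by auto
  interpret gamblet_level d \<Omega> R s L CL CLi K q Iq P \<phi> \<psi> Cs H k by unfold_locales (rule k')
  interpret coarse: gamblet_level d \<Omega> R s L CL CLi K q Iq P \<phi> \<psi> Cs H "k - 1" by unfold_locales (rule k')
  have finJ: "finite (J k)"
    and im: "\<And>x. (\<exists>y. \<forall>j \<in> I k. x j = (\<Sum>l \<in> J k. W k l j * y l)) \<longleftrightarrow>
             (\<forall>i \<in> I (k - 1). (\<Sum>j \<in> I k. P (k - 1) i j * x j) = 0)"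
    and orth: "\<And>l l'. l \<in> J k \<Longrightarrow> l' \<in> J k \<Longrightarrow> (\<Sum>j \<in> I k. W k l j * W k l' j) = id_mat l l'"
    using wavelets[unfolded wavelet_matrices_def, THEN bspec, OF k2] by blast+
  \<comment> \<open>The coefficients with respect to the \<psi> of the combination of the \<chi>
    with coefficients \<open>x\<close>.\<close>
  define wt where "wt x = (\<lambda>j. \<Sum>l\<in>J k. W k l j * x l)" for x :: "index \<Rightarrow> real"
  have ker: "(\<Sum>j \<in> I k. P (k - 1) i j * wt x j) = 0" if "i \<in> I (k - 1)" for x i
    \<comment> \<open>\<open>wt x\<close> lies in the image of the transpose, with \<open>x\<close>
      itself as witness.\<close>
    using im[of "wt x"] that unfolding wt_def by blast
  have iso: "(\<Sum>j\<in>I k. (wt x j)\<^sup>2) = (\<Sum>l\<in>J k. (x l)\<^sup>2)" for x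
  proof -
    have "(\<Sum>j\<in>I k. (wt x j)\<^sup>2) = (\<Sum>j\<in>I k. \<Sum>l\<in>J k. \<Sum>l'\<in>J k. x l * x l' * (W k l j * W k l' j))"
      unfolding wt_def power2_eq_square sum_product by (intro sum.cong refl) (simp add: mult_ac)
    also have "\<dots> = (\<Sum>l\<in>J k. \<Sum>j\<in>I k. \<Sum>l'\<in>J k. x l * x l' * (W k l j * W k l' j))"
      by (rule sum.swap)
    also have "\<dots> = (\<Sum>l\<in>J k. \<Sum>l'\<in>J k. x l * x l' * (\<Sum>j\<in>I k. W k l j * W k l' j))"
      unfolding sum_distrib_left by (intro sum.cong refl sum.swap)
    also have "\<dots> = (\<Sum>l\<in>J k. \<Sum>l'\<in>J k. x l * (1 * id_mat l l') * x l')"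
      by (intro sum.cong refl) (simp add: orth)
    also have "\<dots> = (\<Sum>l\<in>J k. (x l)\<^sup>2)"
      using sum_id_mat[OF finJ, of x 1] by simp
    finally show ?thesis .
  qed
  have chi: "chi Iq W \<psi> k l = comb (W k l)" for l
    by (simp add: chi_def comb_def)
  have comb_chi: "(\<lambda>z. \<Sum>l\<in>J k. x l * chi Iq W \<psi> k l z) = comb (wt x)" for x
  proof
    fix z
    have "(\<Sum>l\<in>J k. x l * chi Iq W \<psi> k l z) = (\<Sum>l\<in>J k. \<Sum>i\<in>I k. W k l i * x l * \<psi> k i z)"
      by (simp add: chi_def sum_distrib_left mult_ac)
    also have "\<dots> = (\<Sum>i\<in>I k. \<Sum>l\<in>J k. W k l i * x l * \<psi> k i z)"
      by (rule sum.swap)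
    also have "\<dots> = comb (wt x) z"
      by (simp add: comb_def wt_def sum_distrib_right)
    finally show "(\<Sum>l\<in>J k. x l * chi Iq W \<psi> k l z) = comb (wt x) z" .
  qed
  have quad: "(\<Sum>i\<in>J k. \<Sum>j\<in>J k. x i * stiffness L (chi Iq W \<psi> k) i j * x j) = L (comb (wt x)) (comb (wt x))" for x
    unfolding comb_chi[symmetric] by (rule quadratic_form_stiffness) (simp add: chi comb_V)
  have "inverse M * inverse (H ^ (2 * (k - 1))) * (\<Sum>l\<in>J k. (x l)\<^sup>2) \<le> L (comb (wt x)) (comb (wt x))" for x
  proof -
    define v where "v = comb (wt x)"
    have v: "v \<in> V" unfolding v_def by (rule comb_V)
    have "coarse.coords v i = 0" if i: "i \<in> I (k - 1)" for i
    proof -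
      \<comment> \<open>Measurements of level \<open>k - 1\<close> are \<open>P (k - 1)\<close>
        applied to those of level \<open>k\<close>, and on \<open>comb (wt x)\<close> the latter are
        \<open>wt x\<close>.\<close>
      have "coarse.coords v i = (\<Sum>j\<in>I k. P (k - 1) i j * coords v j)"
        unfolding coarse.coords_def coords_def measurements_step[OF k'(3,4) i] k'(5)
        by (intro L2.form_sum \<phi>_L2 sobolev0_L2[OF v])
      also have "\<dots> = (\<Sum>j\<in>I k. P (k - 1) i j * wt x j)"
        by (intro sum.cong refl) (simp add: v_def coords_comb)
      finally show ?thesis using ker[OF i] by simp
    qed
    then have "L2_norm d \<Omega> v \<le> Cs * H ^ (k - 1) * nrm v"
      by (rule coarse.orthogonal_norm_le[OF v])
    then have "(\<Sum>i\<in>I k. (wt x i)\<^sup>2) \<le> (Cs * H ^ (k - 1))\<^sup>2 * (CLi\<^sup>2 * CL) * L v v"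
      unfolding v_def using Cs H by (intro energy_lower_if) simp_all
    also have "\<dots> = Cs\<^sup>2 * (CLi\<^sup>2 * CL) * (H ^ (2 * (k - 1)) * L v v)"
      by (simp add: power_mult_distrib mult_ac flip: power_mult)
    also have "\<dots> \<le> M * (H ^ (2 * (k - 1)) * L v v)"
      using H E.form_nonneg[OF v] by (intro mult_right_mono M_bounds(3)) simp
    finally show ?thesis
      using M_bounds(1) H unfolding iso v_def by (simp add: field_simps)
  qed
  then show "mat_le (J k) (\<lambda>i j. inverse M * inverse (H ^ (2 * (k - 1))) * id_mat i j) (stiffness L (chi Iq W \<psi> k))"
    unfolding mat_le_iff[OF finJ] quad by blast
  have "L (comb (wt x)) (comb (wt x)) \<le> M * inverse (H ^ (2 * k)) * (\<Sum>i\<in>J k. (x i)\<^sup>2)" for x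
  proof (rule order_trans[OF energy_upper])
    show "Cs\<^sup>2 * CL * inverse (H ^ (2 * k)) * (\<Sum>i\<in>I k. (wt x i)\<^sup>2) \<le> M * inverse (H ^ (2 * k)) * (\<Sum>i\<in>J k. (x i)\<^sup>2)"
      unfolding iso using H by (intro mult_right_mono M_bounds(2) sum_nonneg) simp_all
  qed
  then show "mat_le (J k) (stiffness L (chi Iq W \<psi> k)) (\<lambda>i j. M * inverse (H ^ (2 * k)) * id_mat i j)"
    unfolding mat_le_iff[OF finJ] quad by blast
qed

end

section \<open>Assembly and choice of the constants\<close>

theorem theorem2p14:
  "\<exists>C :: real \<Rightarrow> real \<Rightarrow> real \<Rightarrow> real.
     (\<forall>a b c. 0 < C a b c) \<and>
     (\<forall>d \<Omega> s. 1 \<le> d \<longrightarrow> bounded_lipschitz_domain d \<Omega> \<longrightarrow>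
       (\<exists>C\<^sub>\<Omega> :: real \<Rightarrow> real \<Rightarrow> real \<Rightarrow> real.
         (\<forall>a b c. 0 < C\<^sub>\<Omega> a b c) \<and>
         (\<forall>L C\<^sub>L C\<^sub>L\<^sub>i q Iq P \<phi> \<psi> J W C\<^sub>s H.
            sym_pos_bijection d \<Omega> s L \<longrightarrow>
            continuity_const d \<Omega> s L = ereal C\<^sub>L \<longrightarrow>
            inverse_continuity_const d \<Omega> s L = ereal C\<^sub>L\<^sub>i \<longrightarrow>
            measurement_hierarchy d \<Omega> q Iq P \<phi> \<longrightarrow>
            gamblets d \<Omega> s L q Iq \<phi> \<psi> \<longrightarrow>
            wavelet_matrices q Iq P J W \<longrightarrow>
            1 \<le> C\<^sub>s \<longrightarrow> 0 < H \<longrightarrow> H < 1 \<longrightarrow>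
            (\<forall>k\<in>{1..q}. \<forall>f \<in> measurement_span Iq \<phi> k.
               L2_norm d \<Omega> f \<le> C\<^sub>s * inverse (H ^ k) * dual_norm d \<Omega> s (pairing d \<Omega> f)) \<longrightarrow>
            (\<forall>k\<in>{1..q}. \<forall>f \<in> L2 d \<Omega>.
               (\<forall>h \<in> measurement_span Iq \<phi> k. pairing d \<Omega> f h = 0) \<longrightarrow>
               dual_norm d \<Omega> s (pairing d \<Omega> f) \<le> C\<^sub>s * H ^ k * L2_norm d \<Omega> f) \<longrightarrow>
            (let c = C C\<^sub>s C\<^sub>L C\<^sub>L\<^sub>i; c\<^sub>\<Omega> = C\<^sub>\<Omega> C\<^sub>s C\<^sub>L C\<^sub>L\<^sub>i;
                 I1 = level Iq 1; A1 = stiffness L (\<psi> 1);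
                 B = (\<lambda>k. stiffness L (chi Iq W \<psi> k))
             in
              (\<forall>u \<in> sobolev0 d \<Omega> s. \<forall>k\<in>{1..q}. \<forall>g \<in> L2 d \<Omega>.
                 (\<forall>v \<in> sobolev0 d \<Omega> s. L u v = pairing d \<Omega> g v) \<longrightarrow>
                 sobolev0_norm d \<Omega> s (\<lambda>x. u x - gamblet_approx d \<Omega> Iq \<phi> \<psi> k u x)
                   \<le> c * H ^ k * L2_norm d \<Omega> g) \<and>
              mat_le I1 (\<lambda>i j. inverse c\<^sub>\<Omega> * id_mat i j) A1 \<and>
              mat_le I1 A1 (\<lambda>i j. c * inverse (H ^ 2) * id_mat i j) \<and>
              cond_number I1 A1 \<le> c\<^sub>\<Omega> * inverse (H ^ 2) \<and>
              (\<forall>k\<in>{2..q}.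
                 mat_le (J k) (\<lambda>i j. inverse c * inverse (H ^ (2 * (k - 1))) * id_mat i j) (B k) \<and>
                 mat_le (J k) (B k) (\<lambda>i j. c * inverse (H ^ (2 * k)) * id_mat i j) \<and>
                 cond_number (J k) (B k) \<le> c * inverse (H ^ 2))))))"
proof -
  define m :: "real \<Rightarrow> real \<Rightarrow> real \<Rightarrow> real" where "m a b c = 1 + a\<^sup>2 * \<bar>b\<bar> * (1 + c\<^sup>2)" for a b c
  have m1: "1 \<le> m a b c" for a b c by (simp add: m_def)
  show ?thesis
  \<comment> \<open>The matrix bounds hold with \<open>m\<close> and its inverse; the quotient of
    upper by lower bound produces the square, which also dominates \<open>m\<close> because
    \<open>m\<close> is at least 1.\<close>
  proof (rule exI[of _ "\<lambda>a b c. (m a b c)\<^sup>2"], intro conjI allI impI, goal_cases)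
    case (1 a b c)
    show ?case using less_le_trans[OF zero_less_one m1[of a b c]] by simp
  next
    case (2 d \<Omega> s)
    then obtain r where r: "\<And>x i. x \<in> \<Omega> \<Longrightarrow> i < d \<Longrightarrow> \<bar>x i\<bar> \<le> r" and op: "openin (Rd d) \<Omega>"
      unfolding bounded_lipschitz_domain_def by blast
    \<comment> \<open>The given bound may fail to be positive, for instance if the domain is
      empty.\<close>
    define R where "R = max r 1"
    interpret domain d \<Omega> R
      by unfold_locales (use op r in \<open>auto simp: R_def le_max_iff_disj\<close>)
    define K where "K = Poincare_const s"
    have K: "0 \<le> K" "\<And>u. u \<in> sobolev0 d \<Omega> s \<Longrightarrow> L2_norm d \<Omega> u \<le> K * sobolev0_norm d \<Omega> s u"
      using Poincare 2 by (auto simp: K_def Poincare_const_nonneg)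
    show ?case
    \<comment> \<open>\<open>K\<close> depends on \<open>R\<close> and \<open>s\<close> only, both
      fixed before the operator and the hierarchy.\<close>
    proof (rule exI[of _ "\<lambda>a b c. (m a b c)\<^sup>2 * (1 + K\<^sup>2)"], intro conjI allI impI, goal_cases)
      case (1 a b c)
      show ?case using less_le_trans[OF zero_less_one m1[of a b c]] by (simp add: add_pos_nonneg)
    next
      case (2 L CL CLi q Iq P \<phi> \<psi> J W Cs H)
      interpret gamblet_hierarchy d \<Omega> R s L CL CLi K q Iq P \<phi> \<psi> Cs H
        by unfold_locales (use 2 K in blast)+
      have M_eq: "m Cs CL CLi = M" by (simp add: m_def M_def)
      note stiffness_B = stiffness_B[OF _ 2(6)]
      have q: "1 \<in> {1..q}"
        using 2(4) by (simp add: measurement_hierarchy_def index_tree_def)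
      have MM: "M \<le> M\<^sup>2" using M_bounds(1) by (simp add: power2_eq_square)
      have M2: "1 \<le> M\<^sup>2" using M_bounds(1) by simp
      have finJ: "finite (J k)" if "k \<in> {2..q}" for k
        using 2(6) that by (simp add: wavelet_matrices_def)
      \<comment> \<open>Ensures that the claimed bounds on condition numbers are at least 1, which
        \<open>cond_number_le\<close> requires for the degenerate spectrum.\<close>
      have H1: "1 \<le> inverse (H\<^sup>2)"
        using 2(8,9) by (simp add: one_le_inverse_iff power_le_one less_imp_le)
      show ?case
        unfolding Let_def M_eq
      proof (intro conjI ballI impI, goal_cases)
        case (1 u k g)
        have "M * (H ^ k * L2_norm d \<Omega> g) \<le> M\<^sup>2 * (H ^ k * L2_norm d \<Omega> g)"
          using MM H L2_norm_nonneg[of g] by (intro mult_right_mono) simp_all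
        with approximation[OF 1(2,1,3)] 1(4) show ?case by (simp add: mult.assoc)
      next
        case 2
        have "inverse (M\<^sup>2 * (1 + K\<^sup>2)) \<le> inverse (M * (1 + K\<^sup>2))"
          using MM M_bounds(1) by (intro le_imp_inverse_le mult_right_mono mult_pos_pos add_pos_nonneg) simp_all
        with stiffness_A(1)[OF q] show ?case
          by (rule mat_le_id_mono(1)[OF finite_level])
      next
        case 3
        have "M * inverse (H ^ (2 * 1)) \<le> M\<^sup>2 * inverse (H\<^sup>2)"
          using MM by (simp add: mult_right_mono)
        with stiffness_A(2)[OF q] show ?case
          by (rule mat_le_id_mono(2)[OF finite_level])
      next
        case 4
        show ?case
        proof (rule cond_number_le[OF finite_level _ stiffness_A[OF q]])
          show "0 < inverse (M * (1 + K\<^sup>2))"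
            using M_bounds(1) by (simp add: add_pos_nonneg)
          show "M * inverse (H ^ (2 * 1)) / inverse (M * (1 + K\<^sup>2)) \<le> M\<^sup>2 * (1 + K\<^sup>2) * inverse (H\<^sup>2)"
            by (simp add: divide_inverse power2_eq_square mult_ac)
          have "1 * 1 * 1 \<le> M\<^sup>2 * (1 + K\<^sup>2) * inverse (H\<^sup>2)"
            using M2 H1 by (intro mult_mono) simp_all
          then show "1 \<le> M\<^sup>2 * (1 + K\<^sup>2) * inverse (H\<^sup>2)" by simp
        qed
      next
        case (5 k)
        have "inverse (M\<^sup>2) * inverse (H ^ (2 * (k - 1))) \<le> inverse M * inverse (H ^ (2 * (k - 1)))"
          using MM M_bounds(1) by (intro mult_right_mono le_imp_inverse_le) simp_all
        with stiffness_B(1)[OF 5] show ?case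
          by (rule mat_le_id_mono(1)[OF finJ[OF 5]])
      next
        case (6 k)
        have "M * inverse (H ^ (2 * k)) \<le> M\<^sup>2 * inverse (H ^ (2 * k))"
          using MM by (intro mult_right_mono) simp_all
        with stiffness_B(2)[OF 6] show ?case
          by (rule mat_le_id_mono(2)[OF finJ[OF 6]])
      next
        case (7 k)
        show ?case
        proof (rule cond_number_le[OF finJ[OF 7] _ stiffness_B[OF 7]])
          show "0 < inverse M * inverse (H ^ (2 * (k - 1)))"
            using M_bounds(1) H by simp
          \<comment> \<open>The upper bound lives at level \<open>k\<close>, the lower one at level
            \<open>k - 1\<close>; their quotient retains exactly one factor
            \<open>inverse (H\<^sup>2)\<close>, uniformly in \<open>k\<close>.\<close>
          have "2 * k = 2 * (k - 1) + 2" using 7 by auto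
          then have "H ^ (2 * k) = H ^ (2 * (k - 1)) * H\<^sup>2"
            by (metis power_add)
          then show "M * inverse (H ^ (2 * k)) / (inverse M * inverse (H ^ (2 * (k - 1)))) \<le> M\<^sup>2 * inverse (H\<^sup>2)"
            using H by (simp add: divide_inverse power2_eq_square mult_ac)
          have "1 * 1 \<le> M\<^sup>2 * inverse (H\<^sup>2)"
            using M2 H1 by (intro mult_mono) simp_all
          then show "1 \<le> M\<^sup>2 * inverse (H\<^sup>2)" by simp
        qed
      qed
    qed
  qed
qed

end
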